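(* Let $f,g$ be functions with $f(n)\to\infty$, $g(n)=O(f(n)/\ln n)$ and $g(n)=o(\sqrt n)$ as $n\to\infty$. For each $n$ let $\mu=(m_1,\dots,m_t)\vdash n$ be a partition with distinct parts $m_1>\dots>m_t$, such that $t\le g(n)$ and $m_t\ge f(n)$. Fix $a>0$ and, for $\nu\vdash n$, define $R_\nu$ by \[ \langle L_\mu,s_\nu\rangle=\frac{f^\nu}{z_\mu}(1+R_\nu),\qquad z_\mu=m_1\cdots m_t . \] Then for every fixed $q>0$, $\sup\{|R_\nu|:\nu\vdash n,\ \nu_1,\nu'_1\le a\sqrt n\}=o(f(n)^{-q})$ as $n\to\infty$. In particular $\langle L_\mu,s_\nu\rangle\sim f^\nu/z_\mu$ for balanced $\nu$, and $\psi^\mu$ tends to be regular.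
   Context: For $\nu\vdash n$, $f^\nu$ is the number of standard Young tableaux of shape $\nu$, $s_\nu$ the Schur function, $\nu_1,\nu'_1$ the lengths of the first row and first column, $\langle\cdot,\cdot\rangle$ the Hall inner product. For $\lambda=(1^{m_1}2^{m_2}\cdots)\vdash n$, $z_\lambda=\prod_i i^{m_i}m_i!$; let $Z_\lambda\cong\prod_i \mathfrak S_{m_i}[\mathbb Z_i]$ be the centralizer of a permutation of cycle type $\lambda$, where $\mathbb Z_i$ is the cyclic group generated by an $i$-cycle; let $\zeta_i$ be a primitive (faithful) linear character of $\mathbb Z_i$ and $\mathrm{id}_{m_i}[\zeta_i]$ the character of the wreath product $\mathfrak S_{m_i}[\mathbb Z_i]$ obtained from $\zeta_i$ and the trivial character of $\mathfrak S_{m_i}$. The higher Lie character is $\psi^\lambda=\mathrm{Ind}_{Z_\lambda}^{\mathfrak S_n}(\mathrm{id}_{m_1}[\zeta_1]\otimes\mathrm{id}_{m_2}[\zeta_2]\otimes\cdots)$, and $L_\lambda$ is its Frobenius characteristic. A family of partitions $\nu\vdash n$ is balanced if there is a constant $a$ with $\nu_1,\nu'_1\le a\sqrt n$. A sequence of characters tends to be regular if $\langle\rho_n,\chi^{\nu^{(n)}}\rangle/\rho_n(1)\sim f^{\nu^{(n)}}/n!$ for Plancherel-typical (in particular, it suffices: for all balanced) $(\nu^{(n)})$; for $\rho=\psi^\lambda$ this reads $\langle L_\lambda,s_\nu\rangle\sim f^\nu/z_\lambda$. *)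

theory Defs
  imports Complex_Main "HOL-Combinatorics.Combinatorics" "HOL-Library.FuncSet"
    "HOL-Library.Landau_Symbols"
begin

definition is_partition :: "nat \<Rightarrow> nat list \<Rightarrow> bool" where
  "is_partition n \<nu> \<longleftrightarrow> sum_list \<nu> = n \<and> (\<forall>x\<in>set \<nu>. 0 < x) \<and> sorted_wrt (\<ge>) \<nu>"

text \<open>Length of the first row (nu_1); the first column length nu'_1 is length nu.\<close>
definition first_row :: "nat list \<Rightarrow> nat" where
  "first_row \<nu> = (case \<nu> of [] \<Rightarrow> 0 | x # _ \<Rightarrow> x)"

definition cells :: "nat list \<Rightarrow> (nat \<times> nat) set" where
  "cells \<nu> = {(i, j). i < length \<nu> \<and> j < \<nu> ! i}"

definition num_syt :: "nat list \<Rightarrow> nat" where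
  "num_syt \<nu> = card {T \<in> cells \<nu> \<rightarrow>\<^sub>E {1..sum_list \<nu>}.
      bij_betw T (cells \<nu>) {1..sum_list \<nu>} \<and>
      (\<forall>i j. (i, Suc j) \<in> cells \<nu> \<longrightarrow> T (i, j) < T (i, Suc j)) \<and>
      (\<forall>i j. (Suc i, j) \<in> cells \<nu> \<longrightarrow> T (i, j) < T (Suc i, j))}"

definition Sym :: "nat \<Rightarrow> (nat \<Rightarrow> nat) set" where
  "Sym n = {p. p permutes {0..<n}}"

definition cycles_of :: "nat \<Rightarrow> (nat \<Rightarrow> nat) \<Rightarrow> nat set set" where
  "cycles_of n \<sigma> = (\<lambda>x. {(\<sigma> ^^ k) x | k. True}) ` {0..<n}"

text \<open>Irreducible character chi^nu of S_n (nu a partition of n), given by Frobenius'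
  character formula: chi^nu(sigma) is the coefficient of x^(nu+delta) in
  a_delta(x) * p_rho(x), where rho is the cycle type of sigma, in l = length nu variables,
  delta = (l-1, ..., 1, 0).\<close>
definition irr_char :: "nat list \<Rightarrow> nat \<Rightarrow> (nat \<Rightarrow> nat) \<Rightarrow> int" where
  "irr_char \<nu> n \<sigma> =
    (let l = length \<nu>; C = cycles_of n \<sigma> in
     \<Sum>w\<in>{w. w permutes {0..<l}}. sign w * int (card
        {c \<in> C \<rightarrow>\<^sub>E {0..<l}. \<forall>i<l.
           int (\<Sum>X\<in>{X\<in>C. c X = i}. card X) = int (\<nu> ! i) + int (l - 1 - i) - int (l - 1 - w i)}))"

definition block_start :: "nat list \<Rightarrow> nat \<Rightarrow> nat" where
  "block_start \<mu> i = sum_list (take i \<mu>)"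

definition std_perm :: "nat list \<Rightarrow> nat \<Rightarrow> nat" where
  "std_perm \<mu> = foldr (\<lambda>i p. cycle_of_list [block_start \<mu> i..<block_start \<mu> (Suc i)] \<circ> p)
                   [0..<length \<mu>] id"

definition centralizer :: "nat list \<Rightarrow> (nat \<Rightarrow> nat) set" where
  "centralizer \<mu> = {g \<in> Sym (sum_list \<mu>). g \<circ> std_perm \<mu> = std_perm \<mu> \<circ> g}"

text \<open>For mu with distinct parts, Z_mu is the direct product of the cyclic groups generated by
  the cycles c_i of std_perm mu (S_1[Z_(m_i)] = Z_(m_i)); an element acting as c_i^(k_i) on the
  i-th cycle is mapped to the product of zeta_(m_i)^(k_i), with zeta_m(c) = exp(2 pi i / m),
  a faithful linear character. Here k_i = g(b_i) - b_i.\<close>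
definition lie_lin_char :: "nat list \<Rightarrow> (nat \<Rightarrow> nat) \<Rightarrow> complex" where
  "lie_lin_char \<mu> g = (\<Prod>i<length \<mu>.
      cis (2 * pi * (real (g (block_start \<mu> i)) - real (block_start \<mu> i)) / real (\<mu> ! i)))"

text \<open>Higher Lie character psi^mu = Ind_(Z_mu)^(S_n) (lie_lin_char mu), for mu with distinct parts,
  via the induced character formula.\<close>
definition higher_lie_char :: "nat list \<Rightarrow> (nat \<Rightarrow> nat) \<Rightarrow> complex" where
  "higher_lie_char \<mu> \<sigma> = (1 / of_nat (card (centralizer \<mu>))) *
     (\<Sum>g\<in>Sym (sum_list \<mu>).
        (if g \<circ> \<sigma> \<circ> inv g \<in> centralizer \<mu> then lie_lin_char \<mu> (g \<circ> \<sigma> \<circ> inv g) else 0))"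

text \<open>The Hall inner product <L_mu, s_nu> = <psi^mu, chi^nu> (the Frobenius characteristic is
  an isometry), computed as the inner product of class functions on S_n.\<close>
definition lie_schur_coeff :: "nat list \<Rightarrow> nat list \<Rightarrow> complex" where
  "lie_schur_coeff \<mu> \<nu> = (let n = sum_list \<mu> in
     (1 / of_nat (fact n)) *
     (\<Sum>\<sigma>\<in>Sym n. higher_lie_char \<mu> \<sigma> * cnj (of_int (irr_char \<nu> n \<sigma>))))"

definition z_distinct :: "nat list \<Rightarrow> nat" where
  "z_distinct \<mu> = prod_list \<mu>"

definition rel_err :: "nat list \<Rightarrow> nat list \<Rightarrow> complex" where
  "rel_err \<mu> \<nu> = lie_schur_coeff \<mu> \<nu> * of_nat (z_distinct \<mu>) / of_nat (num_syt \<nu>) - 1"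

end

(*  Frobenius reciprocity gives 1 + R_nu as the average of zeta(h) chi^nu(h) / f^nu over h in Z_mu, times
    z_mu; the identity contributes 1, so |R_nu| is at most the sum of |chi^nu(h)| / f^nu over the other h.
    It therefore suffices to bound the character ratio of a permutation h moving A points by
    (C / A^(1/4))^A, with C depending only on a.  Branching to S_A,

      chi^nu(h) = sum over alpha |- A of f^(nu/alpha) chi^alpha(h restricted to its support).

    A partition of A has at most sqrt(2A) removable rim hooks of any given length, so Murnaghan-Nakayama
    gives |chi^alpha(h)| <= sqrt(2A)^(number of cycles) <= (2A)^(A/4) and f^alpha <= (2A)^(A/2), and there
    are at most 2^A partitions alpha.  Finally f^(nu/alpha) / f^nu <= const^A f^alpha / A!.  In terms of
    the beta-numbers b of nu and c of alpha this is an upper bound for the ratio of the determinant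
    det (b_i (b_i - 1) ... (b_i - c_j + 1)) to the Vandermonde determinants of b and c; it follows by
    induction on the size, a column reduction expressing the determinant through smaller ones indexed by
    the interlacing sequences. *)

theory Submission
  imports Defs "Jordan_Normal_Form.Determinant" "HOL-Real_Asymp.Real_Asymp"
begin

section \<open>Determinants\<close>

text \<open>The inequality f^\<alpha> f^(\<nu>/\<alpha>) \<le> f^\<nu> alone is too weak: for a
  one-row \<alpha> it bounds f^(\<nu>/\<alpha>) / f^\<nu> only by 1 and gives no decay. Balance of
  \<nu> has to enter, and it does so through one number L, the sum of the first row and first column
  lengths, which bounds all beta-numbers: L^2 = O(n), and these powers cancel against the n^A in n!
  / (n - A)!. What remains is A^(3A/4) from the two rim hook estimates against A^A, hence the
  exponent 1/4. The bound has to be uniform in A, from the smallest part of \<mu> up to n, so the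
  estimates are explicit inequalities for every A rather than asymptotics. The sum over the
  centralizer is controlled because its elements rotate whole cycles: once the ratio is at most
  (1/4)^A, a cycle of length m contributes m - 1 nontrivial rotations of weight (1/4)^m, and
  distinctness of the parts turns the sum over cycles into a piece of a geometric series.\<close>

definition ldet :: "nat \<Rightarrow> (nat \<Rightarrow> nat \<Rightarrow> real) \<Rightarrow> real" where
  "ldet l E = (\<Sum>w\<in>{w. w permutes {0..<l}}. of_int (sign w) * (\<Prod>i<l. E i (w i)))"

lemma permutes_less:
  fixes i l :: nat
  assumes "w permutes {0..<l}" "i < l"
  shows "w i < l"
  using permutes_in_image[OF assms(1), of i] assms(2) by auto

text \<open>Gives access to products, row expansion and transposition of matrices; elsewhere the
  explicit sum over permutations is kept, because the alternating coefficient sums below unfold to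
  exactly this shape.\<close>

lemma ldet_eq_det: "ldet l E = det (mat l l (\<lambda>(i, j). E i j))"
proof -
  have "det (mat l l (\<lambda>(i, j). E i j)) =
      (\<Sum>w\<in>{w. w permutes {0..<l}}. of_int (sign w) * (\<Prod>i = 0..<l. mat l l (\<lambda>(i, j). E i j) $$ (i, w i)))"
    by (subst det_def'[of _ l]) auto
  also have "\<dots> = ldet l E"
    unfolding ldet_def
    by (intro sum.cong refl arg_cong2[where f = "(*)"] prod.cong)
      (auto simp: permutes_in_image lessThan_atLeast0 permutes_less)
  finally show ?thesis by simp
qed

lemma ldet_cong:
  assumes "\<And>i j. i < l \<Longrightarrow> j < l \<Longrightarrow> E i j = F i j"
  shows "ldet l E = ldet l F"
  unfolding ldet_def using assms
  by (intro sum.cong refl arg_cong2[where f = "(*)"] prod.cong) (auto simp: permutes_less)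

lemma ldet_scale:
  "ldet l (\<lambda>i j. r i * (c j * E i j)) = (\<Prod>i<l. r i) * (\<Prod>j<l. c j) * ldet l E"
proof -
  have "(\<Prod>i<l. r i * (c (w i) * E i (w i))) = (\<Prod>i<l. r i) * (\<Prod>j<l. c j) * (\<Prod>i<l. E i (w i))"
    if "w permutes {0..<l}" for w
  proof -
    have "(\<Prod>i<l. c (w i)) = (\<Prod>j<l. c j)"
      using prod.permute[OF that, of c] by (simp add: lessThan_atLeast0 o_def)
    then show ?thesis by (simp add: prod.distrib)
  qed
  then show ?thesis unfolding ldet_def
    by (simp add: sum_distrib_left algebra_simps)
qed

text \<open>Multilinearity in the columns, all of them expanded at once: \<kappa> records which
  summand is chosen in each column.\<close>

lemma ldet_column_sums:
  assumes "\<And>j. j < l \<Longrightarrow> finite (S j)"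
  shows "ldet l (\<lambda>i j. \<Sum>k\<in>S j. c j k * F i k) =
    (\<Sum>\<kappa>\<in>PiE {..<l} S. (\<Prod>j<l. c j (\<kappa> j)) * ldet l (\<lambda>i j. F i (\<kappa> j)))"
proof -
  have *: "(\<Prod>i<l. \<Sum>k\<in>S (w i). c (w i) k * F i k) =
      (\<Sum>\<kappa>\<in>PiE {..<l} S. (\<Prod>j<l. c j (\<kappa> j)) * (\<Prod>i<l. F i (\<kappa> (w i))))"
    if w: "w permutes {0..<l}" for w
  proof -
    have perm: "(\<Prod>i<l. g (w i)) = (\<Prod>j<l. g j)" for g :: "nat \<Rightarrow> real"
      using prod.permute[OF w, of g] by (simp add: lessThan_atLeast0 o_def)
    \<comment> \<open>The product is reindexed by columns, since the range of summation
      \<open>S j\<close> belongs to the column, while the Leibniz formula runs over rows.\<close>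
    let ?v = "inv_into UNIV w"
    have v: "?v (w i) = i" for i using permutes_inverses[OF w] by simp
    have "(\<Prod>i<l. \<Sum>k\<in>S (w i). c (w i) k * F i k) =
        (\<Prod>j<l. \<Sum>k\<in>S j. c j k * F (?v j) k)"
      using perm[of "\<lambda>j. \<Sum>k\<in>S j. c j k * F (?v j) k"] by (simp add: v)
    also have "\<dots> = (\<Sum>\<kappa>\<in>PiE {..<l} S. \<Prod>j<l. c j (\<kappa> j) * F (?v j) (\<kappa> j))"
      using assms by (subst prod_sum_PiE) auto
    also have "\<dots> = (\<Sum>\<kappa>\<in>PiE {..<l} S. (\<Prod>j<l. c j (\<kappa> j)) * (\<Prod>i<l. F i (\<kappa> (w i))))"
    proof (intro sum.cong refl)
      fix \<kappa> show "(\<Prod>j<l. c j (\<kappa> j) * F (?v j) (\<kappa> j)) = (\<Prod>j<l. c j (\<kappa> j)) * (\<Prod>i<l. F i (\<kappa> (w i)))"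
        using perm[of "\<lambda>j. F (?v j) (\<kappa> j)"] by (simp add: v prod.distrib)
    qed
    finally show ?thesis .
  qed
  have "ldet l (\<lambda>i j. \<Sum>k\<in>S j. c j k * F i k) =
      (\<Sum>w\<in>{w. w permutes {0..<l}}. \<Sum>\<kappa>\<in>PiE {..<l} S.
        of_int (sign w) * ((\<Prod>j<l. c j (\<kappa> j)) * (\<Prod>i<l. F i (\<kappa> (w i)))))"
    unfolding ldet_def by (intro sum.cong refl) (simp add: * sum_distrib_left)
  then show ?thesis
    unfolding ldet_def by (subst (asm) sum.swap) (simp add: sum_distrib_left mult_ac)
qed

text \<open>Every column except the first loses a multiple of its original left neighbour,
  simultaneously; this is right multiplication by a unit bidiagonal matrix and keeps the
  determinant. The first row is then zero beyond its first entry, and expansion along it leaves a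
  single minor.\<close>

lemma ldet_peel:
  assumes "\<And>j. j < l \<Longrightarrow> E 0 (Suc j) = c j * E 0 j"
  shows "ldet (Suc l) E = E 0 0 * ldet l (\<lambda>i j. E (Suc i) (Suc j) - c j * E (Suc i) j)"
proof -
  define A where "A = mat (Suc l) (Suc l) (\<lambda>(i, j). E i j)"
  define U where "U = mat (Suc l) (Suc l)
     (\<lambda>(i, j). if i = j then 1 else if j = Suc i then - c i else (0::real))"
  define B where "B = mat (Suc l) (Suc l)
     (\<lambda>(i, j). if j = 0 then E i 0 else E i j - c (j - 1) * E i (j - 1))"
  have A: "A \<in> carrier_mat (Suc l) (Suc l)" and U: "U \<in> carrier_mat (Suc l) (Suc l)"
    and B: "B \<in> carrier_mat (Suc l) (Suc l)"
    by (auto simp: A_def U_def B_def)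
  have "det U = 1"
  proof -
    have "diag_mat U = map (\<lambda>_. 1) [0..<Suc l]"
      unfolding diag_mat_def by (rule map_cong) (auto simp: U_def)
    then show ?thesis
      by (subst det_upper_triangular[OF _ U]) (auto simp: U_def map_replicate_const)
  qed
  have "A * U = B"
  proof (rule eq_matI)
    fix i j assume ij: "i < dim_row B" "j < dim_col B"
    then have ij': "i < Suc l" "j < Suc l" using B by auto
    have "(A * U) $$ (i, j) = (\<Sum>k<Suc l. E i k * (if k = j then 1 else if j = Suc k then - c k else 0))"
      using ij' by (simp add: A_def U_def scalar_prod_def lessThan_atLeast0 del: sum.op_ivl_Suc)
    also have "\<dots> = (\<Sum>k<Suc l. (if k = j then E i k else 0) + (if j = Suc k then - c k * E i k else 0))"
      by (intro sum.cong) auto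
    also have "\<dots> = (if j = 0 then E i 0 else E i j - c (j - 1) * E i (j - 1))"
    proof (cases j)
      case 0 then show ?thesis by (simp add: sum.distrib sum.delta)
    next
      case (Suc j')
      then have "j' < Suc l" using ij' by simp
      then show ?thesis using ij' Suc unfolding sum.distrib
        by (simp add: sum.delta sum.delta' del: sum.lessThan_Suc)
    qed
    finally show "(A * U) $$ (i, j) = B $$ (i, j)" using ij' by (simp add: B_def)
  qed (use A U B in auto)
  then have "det A = det B" using det_mult[OF A U] \<open>det U = 1\<close> by simp
  also have "det B = (\<Sum>j<Suc l. B $$ (0, j) * cofactor B 0 j)"
    using laplace_expansion_row[OF B] by blast
  also have "\<dots> = (\<Sum>j<Suc l. if j = 0 then B $$ (0, 0) * cofactor B 0 0 else 0)"
    by (intro sum.cong refl) (auto simp: B_def assms dest!: gr0_implies_Suc)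
  also have "\<dots> = E 0 0 * cofactor B 0 0" by (simp add: B_def)
  also have "cofactor B 0 0 = ldet l (\<lambda>i j. E (Suc i) (Suc j) - c j * E (Suc i) j)"
    unfolding cofactor_def ldet_eq_det
    by (simp, rule arg_cong[where f = det], rule eq_matI) (auto simp: mat_delete_def B_def)
  finally show ?thesis by (simp add: ldet_eq_det A_def)
qed

section \<open>Alternants of falling factorials\<close>

definition falling :: "real \<Rightarrow> nat \<Rightarrow> real" where
  "falling x m = (\<Prod>s<m. x - real s)"

lemma falling_0 [simp]: "falling x 0 = 1"
  by (simp add: falling_def)

lemma falling_Suc: "falling x (Suc m) = falling x m * (x - real m)"
  by (simp add: falling_def)

lemma falling_Suc': "falling x (Suc m) = x * falling (x - 1) m"
  unfolding falling_def by (subst prod.lessThan_Suc_shift) (simp add: algebra_simps)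

lemma falling_add: "falling x (a + b) = falling x a * falling (x - real a) b"
  by (induction b) (simp_all add: falling_Suc algebra_simps)

lemma falling_shift_diff:
  "falling (x + 1) (Suc m) - falling x (Suc m) = real (Suc m) * falling x m"
  unfolding falling_Suc'[of "x + 1"] by (simp add: falling_Suc algebra_simps)

text \<open>The products \<open>t k\<close> interpolate between the two terms on the left: the first
  k factors use y, the others x. Passing from k to k + 1 replaces the factor x - k by y - k, so
  every difference contains y - x, which can be pulled out of a whole row of the
  determinant.\<close>

lemma falling_telescope:
  assumes "p \<le> q"
  shows "falling y q - falling (x - real p) (q - p) * falling y p =
    (y - x) * (\<Sum>k\<in>{p..<q}. falling (x - real k - 1) (q - 1 - k) * falling y k)"
proof -
  define t where "t k = falling y k * falling (x - real k) (q - k)" for k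
  have "t (Suc k) - t k = (y - x) * (falling (x - real k - 1) (q - 1 - k) * falling y k)"
    if "k \<in> {p..<q}" for k
  proof -
    obtain m where q: "q = Suc (k + m)" using \<open>k \<in> {p..<q}\<close> less_iff_Suc_add[of k q] by auto
    show ?thesis
      unfolding t_def q falling_Suc by (simp add: Suc_diff_le falling_Suc' algebra_simps)
  qed
  then have "(y - x) * (\<Sum>k\<in>{p..<q}. falling (x - real k - 1) (q - 1 - k) * falling y k) =
      (\<Sum>k\<in>{p..<q}. t (Suc k) - t k)"
    by (simp add: sum_distrib_left)
  also have "\<dots> = t q - t p" by (rule sum_Suc_diff'[OF assms])
  finally show ?thesis by (simp add: t_def)
qed

lemma abs_falling_le:
  assumes "\<And>s. s < m \<Longrightarrow> \<bar>x - real s\<bar> \<le> B"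
  shows "\<bar>falling x m\<bar> \<le> B ^ m"
proof -
  have "\<bar>falling x m\<bar> = (\<Prod>s<m. \<bar>x - real s\<bar>)" by (simp add: falling_def abs_prod)
  also have "\<dots> \<le> (\<Prod>s<m. B)" using assms by (intro prod_mono) auto
  finally show ?thesis by simp
qed

lemma ldet_transpose: "ldet l (\<lambda>i j. E j i) = ldet l E"
proof -
  have "transpose_mat (mat l l (\<lambda>(i, j). E i j)) = mat l l (\<lambda>(i, j). E j i)"
    by (rule eq_matI) auto
  then show ?thesis
    using det_transpose[of "mat l l (\<lambda>(i, j). E i j)" l] by (simp add: ldet_eq_det)
qed

text \<open>Subtracting suitable multiples of neighbouring columns clears the first row up to its first
  entry; the remaining entries telescope into sums over the interlacing positions \<open>\<kappa>\<close>.\<close>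

lemma ldet_falling_Suc:
  assumes "\<And>j. j < l \<Longrightarrow> \<gamma> j \<le> \<gamma> (Suc j)"
  shows "ldet (Suc l) (\<lambda>i j. falling (\<beta> i) (\<gamma> j)) =
    falling (\<beta> 0) (\<gamma> 0) * (\<Prod>i<l. \<beta> (Suc i) - \<beta> 0) *
    (\<Sum>\<kappa>\<in>PiE {..<l} (\<lambda>j. {\<gamma> j..<\<gamma> (Suc j)}).
      (\<Prod>j<l. falling (\<beta> 0 - real (\<kappa> j) - 1) (\<gamma> (Suc j) - 1 - \<kappa> j)) *
      ldet l (\<lambda>i j. falling (\<beta> (Suc i)) (\<kappa> j)))"
proof -
  let ?c = "\<lambda>j. falling (\<beta> 0 - real (\<gamma> j)) (\<gamma> (Suc j) - \<gamma> j)"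
  let ?g = "\<lambda>j k. falling (\<beta> 0 - real k - 1) (\<gamma> (Suc j) - 1 - k)"
  have "ldet (Suc l) (\<lambda>i j. falling (\<beta> i) (\<gamma> j)) = falling (\<beta> 0) (\<gamma> 0) *
      ldet l (\<lambda>i j. falling (\<beta> (Suc i)) (\<gamma> (Suc j)) - ?c j * falling (\<beta> (Suc i)) (\<gamma> j))"
  proof (rule ldet_peel)
    fix j assume "j < l"
    then have "\<gamma> (Suc j) = \<gamma> j + (\<gamma> (Suc j) - \<gamma> j)" using assms by simp
    then have "falling (\<beta> 0) (\<gamma> (Suc j)) = falling (\<beta> 0) (\<gamma> j) * ?c j"
      by (metis falling_add)
    then show "falling (\<beta> 0) (\<gamma> (Suc j)) = ?c j * falling (\<beta> 0) (\<gamma> j)" by simp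
  qed
  also have "ldet l (\<lambda>i j. falling (\<beta> (Suc i)) (\<gamma> (Suc j)) - ?c j * falling (\<beta> (Suc i)) (\<gamma> j)) =
      ldet l (\<lambda>i j. (\<beta> (Suc i) - \<beta> 0) * (1 * (\<Sum>k\<in>{\<gamma> j..<\<gamma> (Suc j)}. ?g j k * falling (\<beta> (Suc i)) k)))"
    by (rule ldet_cong) (simp add: falling_telescope assms)
  also have "\<dots> = (\<Prod>i<l. \<beta> (Suc i) - \<beta> 0) *
      ldet l (\<lambda>i j. \<Sum>k\<in>{\<gamma> j..<\<gamma> (Suc j)}. ?g j k * falling (\<beta> (Suc i)) k)"
    by (subst ldet_scale) simp
  also have "ldet l (\<lambda>i j. \<Sum>k\<in>{\<gamma> j..<\<gamma> (Suc j)}. ?g j k * falling (\<beta> (Suc i)) k) =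
      (\<Sum>\<kappa>\<in>PiE {..<l} (\<lambda>j. {\<gamma> j..<\<gamma> (Suc j)}).
      (\<Prod>j<l. ?g j (\<kappa> j)) * ldet l (\<lambda>i j. falling (\<beta> (Suc i)) (\<kappa> j)))"
    by (rule ldet_column_sums) simp
  finally show ?thesis by simp
qed

text \<open>This is the ordinary Vandermonde determinant, as \<open>falling x j\<close> is a monic
  polynomial of degree j in x. Falling factorials replace powers because they are what quotients of
  factorials produce.\<close>

definition vander :: "nat \<Rightarrow> (nat \<Rightarrow> real) \<Rightarrow> real" where
  "vander l \<beta> = ldet l (\<lambda>i j. falling (\<beta> i) j)"

lemma vander_0 [simp]: "vander 0 \<beta> = 1"
  by (simp add: vander_def ldet_def)

lemma vander_Suc: "vander (Suc l) \<beta> = (\<Prod>i<l. \<beta> (Suc i) - \<beta> 0) * vander l (\<lambda>i. \<beta> (Suc i))"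
proof -
  \<comment> \<open>Between consecutive integers there is exactly one interlacing sequence, so the
    general expansion collapses to one term.\<close>
  let ?r = "restrict (\<lambda>j. j) {..<l}"
  have "PiE {..<l} (\<lambda>j. {j..<Suc j}) = PiE {..<l} (\<lambda>j. {?r j})"
    by (rule PiE_cong) auto
  also have "\<dots> = {?r}" by (rule PiE_singleton) (simp add: extensional_def)
  finally have P: "PiE {..<l} (\<lambda>j. {j..<Suc j}) = {?r}" .
  have "ldet l (\<lambda>i j. falling (\<beta> (Suc i)) (?r j)) = ldet l (\<lambda>i j. falling (\<beta> (Suc i)) j)"
    by (rule ldet_cong) simp
  moreover have "(\<Prod>j<l. falling (\<beta> 0 - real (?r j) - 1) (Suc j - 1 - ?r j)) = 1"
    by (rule prod.neutral) simp
  ultimately show ?thesis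
    using ldet_falling_Suc[of l "\<lambda>j. j" \<beta>] unfolding P vander_def by simp
qed

lemma vander_pos:
  assumes "\<And>i j. i < j \<Longrightarrow> j < l \<Longrightarrow> \<beta> i < \<beta> j"
  shows "vander l \<beta> > 0"
  using assms
proof (induction l arbitrary: \<beta>)
  case (Suc l)
  have "vander l (\<lambda>i. \<beta> (Suc i)) > 0" by (rule Suc.IH) (use Suc.prems in auto)
  moreover have "(\<Prod>i<l. \<beta> (Suc i) - \<beta> 0) > 0"
    by (rule prod_pos) (use Suc.prems in auto)
  ultimately show ?case by (simp add: vander_Suc)
qed simp

text \<open>Divided by the product of the factorials below its order, a Vandermonde determinant in
  integers is the dimension of a representation of a general linear group; the identity is the
  branching rule for these dimensions. After transposition the first row consists of ones, so
  peeling takes differences of neighbouring columns, and each difference is a sum of discrete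
  derivatives.\<close>

lemma vander_interlacing_sum:
  fixes \<gamma> :: "nat \<Rightarrow> nat"
  assumes "\<And>j. j < l \<Longrightarrow> \<gamma> j \<le> \<gamma> (Suc j)"
  shows "vander (Suc l) (\<lambda>j. real (\<gamma> j)) =
    fact l * (\<Sum>\<kappa>\<in>PiE {..<l} (\<lambda>j. {\<gamma> j..<\<gamma> (Suc j)}). vander l (\<lambda>j. real (\<kappa> j)))"
proof -
  have "vander (Suc l) (\<lambda>j. real (\<gamma> j)) = ldet (Suc l) (\<lambda>i j. falling (real (\<gamma> j)) i)"
    unfolding vander_def by (rule ldet_transpose[symmetric])
  also have "\<dots> = ldet l (\<lambda>i j. falling (real (\<gamma> (Suc j))) (Suc i) - falling (real (\<gamma> j)) (Suc i))"
    by (subst ldet_peel[where c = "\<lambda>_. 1"]) auto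
  \<comment> \<open>The factors 1 only bring the entries into the form expected by
    \<open>ldet_scale\<close> and \<open>ldet_column_sums\<close>.\<close>
  also have "\<dots> = ldet l (\<lambda>i j. real (Suc i) * (1 * (\<Sum>k\<in>{\<gamma> j..<\<gamma> (Suc j)}. 1 * falling (real k) i)))"
  proof (rule ldet_cong)
    fix i j assume "j < l"
    have "falling (real (\<gamma> (Suc j))) (Suc i) - falling (real (\<gamma> j)) (Suc i) =
        (\<Sum>k\<in>{\<gamma> j..<\<gamma> (Suc j)}. falling (real (Suc k)) (Suc i) - falling (real k) (Suc i))"
      using sum_Suc_diff'[OF assms[OF \<open>j < l\<close>], of "\<lambda>k. falling (real k) (Suc i)"] by simp
    also have "\<dots> = (\<Sum>k\<in>{\<gamma> j..<\<gamma> (Suc j)}. real (Suc i) * falling (real k) i)"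
      by (intro sum.cong refl) (metis falling_shift_diff of_nat_Suc add.commute)
    finally show "falling (real (\<gamma> (Suc j))) (Suc i) - falling (real (\<gamma> j)) (Suc i) =
        real (Suc i) * (1 * (\<Sum>k\<in>{\<gamma> j..<\<gamma> (Suc j)}. 1 * falling (real k) i))"
      by (simp add: sum_distrib_left)
  qed
  also have "\<dots> = (\<Prod>i<l. real (Suc i)) *
      ldet l (\<lambda>i j. \<Sum>k\<in>{\<gamma> j..<\<gamma> (Suc j)}. 1 * falling (real k) i)"
    by (subst ldet_scale) simp
  also have "(\<Prod>i<l. real (Suc i)) = fact l"
    by (simp add: fact_prod_Suc lessThan_atLeast0)
  also have "ldet l (\<lambda>i j. \<Sum>k\<in>{\<gamma> j..<\<gamma> (Suc j)}. 1 * falling (real k) i) =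
      (\<Sum>\<kappa>\<in>PiE {..<l} (\<lambda>j. {\<gamma> j..<\<gamma> (Suc j)}). ldet l (\<lambda>i j. falling (real (\<kappa> j)) i))"
    by (subst ldet_column_sums) auto
  also have "\<dots> = (\<Sum>\<kappa>\<in>PiE {..<l} (\<lambda>j. {\<gamma> j..<\<gamma> (Suc j)}). vander l (\<lambda>j. real (\<kappa> j)))"
    unfolding vander_def by (intro sum.cong refl ldet_transpose)
  finally show ?thesis .
qed

text \<open>The determinant and the Vandermonde determinant of \<gamma> expand over the same
  interlacing sequences. In the first expansion the weights are falling factorials all of whose
  factors lie between -L and L; in the second they are constant. Estimating the former by powers of
  L therefore lets the second expansion be summed back exactly. The product of factorials collects
  the \<open>fact l\<close> of each round, and the power of L stands on the left to avoid a
  subtraction of exponents.\<close>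

lemma ldet_falling_bound:
  fixes \<beta> :: "nat \<Rightarrow> real" and \<gamma> :: "nat \<Rightarrow> nat"
  assumes "\<And>i j. i < j \<Longrightarrow> j < l \<Longrightarrow> \<beta> i < \<beta> j"
    and "\<And>i j. i < j \<Longrightarrow> j < l \<Longrightarrow> \<gamma> i < \<gamma> j"
    and "\<And>i. i < l \<Longrightarrow> 0 \<le> \<beta> i \<and> \<beta> i \<le> real L"
    and "\<And>i. i < l \<Longrightarrow> \<gamma> i \<le> L"
  shows "\<bar>ldet l (\<lambda>i j. falling (\<beta> i) (\<gamma> j))\<bar> * (\<Prod>m<l. fact m) * real L ^ (\<Sum>m<l. m)
    \<le> real L ^ (\<Sum>j<l. \<gamma> j) * vander l \<beta> * vander l (\<lambda>j. real (\<gamma> j))"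
  using assms
proof (induction l arbitrary: \<beta> \<gamma>)
  case 0
  then show ?case by (simp add: ldet_def)
next
  case (Suc l)
  let ?K = "PiE {..<l} (\<lambda>j. {\<gamma> j..<\<gamma> (Suc j)})"
  let ?P = "\<Prod>i<l. \<beta> (Suc i) - \<beta> 0"
  let ?D = "\<lambda>\<kappa>. ldet l (\<lambda>i j. falling (\<beta> (Suc i)) (\<kappa> j))"
  let ?G = "\<lambda>\<kappa>. \<Prod>j<l. falling (\<beta> 0 - real (\<kappa> j) - 1) (\<gamma> (Suc j) - 1 - \<kappa> j)"
  let ?F = "(\<Prod>m<l. fact m) :: real"
  let ?B = "vander l (\<lambda>i. \<beta> (Suc i))"
  have P: "?P \<ge> 0" by (intro prod_nonneg) (use Suc.prems(1) in \<open>auto simp: less_imp_le\<close>)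
  have mono: "\<gamma> j \<le> \<gamma> (Suc j)" if "j < l" for j using Suc.prems(2)[of j "Suc j"] that by simp
  have f0: "\<bar>falling (\<beta> 0) (\<gamma> 0)\<bar> \<le> real L ^ \<gamma> 0"
  proof (rule abs_falling_le)
    fix s assume "s < \<gamma> 0"
    then have "real s \<le> real L" using Suc.prems(4)[of 0] by simp
    then show "\<bar>\<beta> 0 - real s\<bar> \<le> real L" using Suc.prems(3)[of 0] by (auto simp: abs_le_iff)
  qed
  \<comment> \<open>One summand of the recursion. The additional powers of L, with exponent
    \<open>l + \<gamma> 0\<close>, come from the longer sum over m and from the factor
    \<open>falling (\<beta> 0) (\<gamma> 0)\<close>.\<close>
  have step: "\<bar>?G \<kappa> * ?D \<kappa>\<bar> * ?F * real L ^ (\<Sum>m<Suc l. m) * real L ^ \<gamma> 0 \<le>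
      real L ^ (\<Sum>j<Suc l. \<gamma> j) * ?B * vander l (\<lambda>j. real (\<kappa> j))" if \<kappa>: "\<kappa> \<in> ?K" for \<kappa>
  proof -
    have k: "\<gamma> j \<le> \<kappa> j" "\<kappa> j < \<gamma> (Suc j)" if "j < l" for j using \<kappa> that by (auto dest!: PiE_mem)
    have g: "\<bar>?G \<kappa>\<bar> \<le> real L ^ (\<Sum>j<l. \<gamma> (Suc j) - 1 - \<kappa> j)"
    proof -
      have "\<bar>falling (\<beta> 0 - real (\<kappa> j) - 1) (\<gamma> (Suc j) - 1 - \<kappa> j)\<bar> \<le> real L ^ (\<gamma> (Suc j) - 1 - \<kappa> j)"
        if "j < l" for j
      proof (rule abs_falling_le)
        fix s assume "s < \<gamma> (Suc j) - 1 - \<kappa> j"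
        then have "\<kappa> j + 1 + s \<le> L" using Suc.prems(4)[of "Suc j"] that by simp
        then have "real (\<kappa> j) + 1 + real s \<le> real L" by linarith
        then show "\<bar>\<beta> 0 - real (\<kappa> j) - 1 - real s\<bar> \<le> real L"
          using Suc.prems(3)[of 0] by (simp add: abs_le_iff)
      qed
      then have "\<bar>?G \<kappa>\<bar> \<le> (\<Prod>j<l. real L ^ (\<gamma> (Suc j) - 1 - \<kappa> j))"
        unfolding abs_prod by (intro prod_mono) auto
      then show ?thesis by (simp add: power_sum)
    qed
    have "\<bar>?D \<kappa>\<bar> * ?F * real L ^ (\<Sum>m<l. m) \<le>
        real L ^ (\<Sum>j<l. \<kappa> j) * ?B * vander l (\<lambda>j. real (\<kappa> j))"
    proof (rule Suc.IH)
      fix i j :: nat assume "i < j" "j < l"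
      moreover have "\<gamma> (Suc i) \<le> \<gamma> j"
      proof (cases "Suc i = j")
        case False
        then show ?thesis using Suc.prems(2)[of "Suc i" j] \<open>i < j\<close> \<open>j < l\<close> by simp
      qed simp
      ultimately show "\<kappa> i < \<kappa> j" using k[of i] k[of j] by simp
    next
      fix i assume "i < l"
      then show "\<kappa> i \<le> L" using k[of i] Suc.prems(4)[of "Suc i"] by simp
    qed (use Suc.prems in auto)
    then have "real L ^ (\<Sum>j<l. \<gamma> (Suc j) - 1 - \<kappa> j) * (\<bar>?D \<kappa>\<bar> * ?F * real L ^ (\<Sum>m<l. m)) \<le>
        real L ^ (\<Sum>j<l. \<gamma> (Suc j) - 1 - \<kappa> j) * (real L ^ (\<Sum>j<l. \<kappa> j) * ?B * vander l (\<lambda>j. real (\<kappa> j)))"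
      by (intro mult_left_mono) auto
    moreover have "\<bar>?G \<kappa>\<bar> * (\<bar>?D \<kappa>\<bar> * ?F * real L ^ (\<Sum>m<l. m)) \<le>
       real L ^ (\<Sum>j<l. \<gamma> (Suc j) - 1 - \<kappa> j) * (\<bar>?D \<kappa>\<bar> * ?F * real L ^ (\<Sum>m<l. m))"
      by (intro mult_right_mono g mult_nonneg_nonneg prod_nonneg) auto
    ultimately have "\<bar>?G \<kappa>\<bar> * (\<bar>?D \<kappa>\<bar> * ?F * real L ^ (\<Sum>m<l. m)) \<le>
        real L ^ (\<Sum>j<l. \<gamma> (Suc j) - 1 - \<kappa> j) * (real L ^ (\<Sum>j<l. \<kappa> j) * ?B * vander l (\<lambda>j. real (\<kappa> j)))"
      by linarith
    then have ineq: "\<bar>?G \<kappa>\<bar> * (\<bar>?D \<kappa>\<bar> * ?F * real L ^ (\<Sum>m<l. m)) * real L ^ (l + \<gamma> 0) \<le>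
        real L ^ (\<Sum>j<l. \<gamma> (Suc j) - 1 - \<kappa> j) * (real L ^ (\<Sum>j<l. \<kappa> j) * ?B * vander l (\<lambda>j. real (\<kappa> j)))
        * real L ^ (l + \<gamma> 0)"
      by (intro mult_right_mono) auto
    \<comment> \<open>In column j the exponents of the weight and of the smaller determinant add up
      to \<open>\<gamma> (Suc j) - 1\<close>; the l missing units are supplied by the extra power of
      L.\<close>
    have "(\<Sum>j<l. \<gamma> (Suc j) - 1 - \<kappa> j) + (\<Sum>j<l. \<kappa> j) + (l + \<gamma> 0) = (\<Sum>j<Suc l. \<gamma> j)"
    proof -
      have "(\<Sum>j<l. \<gamma> (Suc j) - 1 - \<kappa> j) + (\<Sum>j<l. \<kappa> j) + l = (\<Sum>j<l. (\<gamma> (Suc j) - 1 - \<kappa> j) + \<kappa> j + 1)"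
        by (simp only: sum.distrib) simp
      also have "\<dots> = (\<Sum>j<l. \<gamma> (Suc j))"
        by (intro sum.cong refl) (use k in fastforce)
      finally show ?thesis by (subst sum.lessThan_Suc_shift) simp
    qed
    then have pow: "real L ^ (\<Sum>j<l. \<gamma> (Suc j) - 1 - \<kappa> j) * real L ^ (\<Sum>j<l. \<kappa> j) * real L ^ (l + \<gamma> 0) =
       real L ^ (\<Sum>j<Suc l. \<gamma> j)" by (metis power_add)
    have rearrange: "X * (Y * b * v) * Z = W * b * v" if "X * Y * Z = W" for X Y Z W b v :: real
      using that by (auto simp: mult_ac)
    have "\<bar>?G \<kappa>\<bar> * (\<bar>?D \<kappa>\<bar> * ?F * real L ^ (\<Sum>m<l. m)) * real L ^ (l + \<gamma> 0) =
        \<bar>?G \<kappa> * ?D \<kappa>\<bar> * ?F * real L ^ (\<Sum>m<Suc l. m) * real L ^ \<gamma> 0"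
      by (simp add: abs_mult power_add mult_ac)
    then show ?thesis using ineq unfolding rearrange[OF pow] by (simp only:)
  qed
  have "\<bar>ldet (Suc l) (\<lambda>i j. falling (\<beta> i) (\<gamma> j))\<bar> =
      \<bar>falling (\<beta> 0) (\<gamma> 0)\<bar> * ?P * \<bar>\<Sum>\<kappa>\<in>?K. ?G \<kappa> * ?D \<kappa>\<bar>"
    using P by (subst ldet_falling_Suc) (use mono in \<open>auto simp: abs_mult\<close>)
  also have "\<dots> \<le> real L ^ \<gamma> 0 * ?P * (\<Sum>\<kappa>\<in>?K. \<bar>?G \<kappa> * ?D \<kappa>\<bar>)"
    using P f0 by (intro mult_mono sum_abs) auto
  finally have "\<bar>ldet (Suc l) (\<lambda>i j. falling (\<beta> i) (\<gamma> j))\<bar> * ((\<Prod>m<Suc l. fact m) * real L ^ (\<Sum>m<Suc l. m))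
     \<le> real L ^ \<gamma> 0 * ?P * (\<Sum>\<kappa>\<in>?K. \<bar>?G \<kappa> * ?D \<kappa>\<bar>) * ((\<Prod>m<Suc l. fact m) * real L ^ (\<Sum>m<Suc l. m))"
    by (intro mult_right_mono mult_nonneg_nonneg prod_nonneg) auto
  also have "\<dots> = ?P * fact l * (\<Sum>\<kappa>\<in>?K. \<bar>?G \<kappa> * ?D \<kappa>\<bar> * ?F * real L ^ (\<Sum>m<Suc l. m) * real L ^ \<gamma> 0)"
    by (simp add: sum_distrib_left sum_distrib_right mult_ac del: sum.lessThan_Suc)
  also have "\<dots> \<le> ?P * fact l * (\<Sum>\<kappa>\<in>?K. real L ^ (\<Sum>j<Suc l. \<gamma> j) * ?B * vander l (\<lambda>j. real (\<kappa> j)))"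
    using P by (intro mult_left_mono sum_mono step) auto
  also have "\<dots> = real L ^ (\<Sum>j<Suc l. \<gamma> j) * (?P * ?B) *
      (fact l * (\<Sum>\<kappa>\<in>?K. vander l (\<lambda>j. real (\<kappa> j))))"
    by (simp add: sum_distrib_left mult_ac del: sum.lessThan_Suc)
  also have "\<dots> = real L ^ (\<Sum>j<Suc l. \<gamma> j) * vander (Suc l) \<beta> * vander (Suc l) (\<lambda>j. real (\<gamma> j))"
    using vander_interlacing_sum[of l \<gamma>] mono by (simp add: vander_Suc del: sum.lessThan_Suc)
  finally show ?case by (simp only: mult.assoc)
qed

section \<open>Frobenius' coefficients\<close>

text \<open>A colouring picks one monomial x_i^(sz X) from each power sum, and v is the resulting
  exponent vector. The exponents are integers so that subtracting too much yields an empty set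
  rather than a truncated value.\<close>

definition colourings :: "nat \<Rightarrow> 'c set \<Rightarrow> ('c \<Rightarrow> nat) \<Rightarrow> (nat \<Rightarrow> int) \<Rightarrow> ('c \<Rightarrow> nat) set" where
  "colourings l C sz v =
    {c \<in> C \<rightarrow>\<^sub>E {0..<l}. \<forall>i<l. int (\<Sum>X\<in>{X\<in>C. c X = i}. sz X) = v i}"

text \<open>The coefficient of \<open>x\<^sup>b\<close> in the product of the Vandermonde alternant and the power sums \<open>p\<^bsub>sz X\<^esub>\<close>,
  \<open>X \<in> C\<close>.  Exponents increase here, from \<open>\<delta> = (0, 1, \<dots>, l - 1)\<close>, in contrast to \<open>irr_char\<close>; this keeps
  all signs in the determinant recursions positive.\<close>

definition frob :: "nat \<Rightarrow> 'c set \<Rightarrow> ('c \<Rightarrow> nat) \<Rightarrow> (nat \<Rightarrow> int) \<Rightarrow> int" where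
  "frob l C sz b =
    (\<Sum>w\<in>{w. w permutes {0..<l}}. sign w * int (card (colourings l C sz (\<lambda>i. b i - int (w i)))))"

lemma finite_colourings: "finite C \<Longrightarrow> finite (colourings l C sz v)"
  unfolding colourings_def by (rule finite_subset[of _ "C \<rightarrow>\<^sub>E {0..<l}"]) (auto intro: finite_PiE)

lemma colourings_cong:
  assumes "\<And>i. i < l \<Longrightarrow> v i = v' i"
  shows "colourings l C sz v = colourings l C sz v'"
  using assms by (auto simp: colourings_def)

lemma colourings_empty: "colourings l {} sz v = (if \<forall>i<l. v i = 0 then {\<lambda>_. undefined} else {})"
  by (auto simp: colourings_def)

text \<open>The colourings are sorted by the colour i of X, whose size is then taken off the i-th
  target. The restricted colouring is reset to \<open>undefined\<close> at X to be extensional on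
  C.\<close>

lemma card_colourings_insert:
  assumes "finite C" "X \<notin> C"
  shows "card (colourings l (insert X C) sz v) =
    (\<Sum>i<l. card (colourings l C sz (v(i := v i - int (sz X)))))"
proof -
  let ?S = "SIGMA i:{..<l}. colourings l C sz (v(i := v i - int (sz X)))"
  have sum_eq: "(\<Sum>Y\<in>{Y\<in>insert X C. c Y = j}. sz Y) =
      (if c X = j then sz X else 0) + (\<Sum>Y\<in>{Y\<in>C. c' Y = j}. sz Y)"
    if "\<And>Y. Y \<in> C \<Longrightarrow> c' Y = c Y" for c c' :: "'a \<Rightarrow> nat" and j
  proof -
    have "{Y\<in>insert X C. c Y = j} = (if c X = j then {X} else {}) \<union> {Y\<in>C. c' Y = j}"
      using that by auto
    moreover have "X \<notin> {Y\<in>C. c' Y = j}" "finite {Y\<in>C. c' Y = j}" using assms by auto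
    ultimately show ?thesis by auto
  qed
  have aux1: "int S = (w(k := w k - int z)) j" if "int T = w j" "T = (if k = j then z else 0) + S"
    for S T z k j and w :: "nat \<Rightarrow> int" using that by auto
  have aux2: "int T = w j" if "int S = (w(k := w k - int z)) j" "T = (if k = j then z else 0) + S"
    for S T z k j and w :: "nat \<Rightarrow> int" using that by (auto split: if_splits)
  have "bij_betw (\<lambda>c. (c X, c(X := undefined))) (colourings l (insert X C) sz v) ?S"
  proof (rule bij_betw_byWitness[where f' = "\<lambda>(i, c). c(X := i)"])
    show "(\<lambda>c. (c X, c(X := undefined))) ` colourings l (insert X C) sz v \<subseteq> ?S"
    proof clarify
      fix c assume c: "c \<in> colourings l (insert X C) sz v"
      let ?c = "c(X := undefined)"
      have cX: "c X < l" using c by (auto simp: colourings_def dest!: PiE_mem)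
      have "?c \<in> C \<rightarrow>\<^sub>E {0..<l}" using c assms by (auto simp: colourings_def PiE_def extensional_def)
      moreover have "int (\<Sum>Y\<in>{Y\<in>C. ?c Y = j}. sz Y) = (v(c X := v (c X) - int (sz X))) j" if "j < l" for j
      proof -
        have "int (\<Sum>Y\<in>{Y\<in>insert X C. c Y = j}. sz Y) = v j"
          using c that by (simp add: colourings_def)
        moreover have "(\<Sum>Y\<in>{Y\<in>insert X C. c Y = j}. sz Y) =
          (if c X = j then sz X else 0) + (\<Sum>Y\<in>{Y\<in>C. ?c Y = j}. sz Y)"
          by (rule sum_eq) (use assms(2) in auto)
        ultimately show ?thesis by (rule aux1)
      qed
      ultimately show "c X \<in> {..<l} \<and> ?c \<in> colourings l C sz (v(c X := v (c X) - int (sz X)))"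
        using cX unfolding colourings_def by blast
    qed
    show "(\<lambda>(i, c). c(X := i)) ` ?S \<subseteq> colourings l (insert X C) sz v"
    proof clarify
      fix i c assume i: "i < l" and c: "c \<in> colourings l C sz (v(i := v i - int (sz X)))"
      let ?c = "c(X := i)"
      have "?c \<in> insert X C \<rightarrow>\<^sub>E {0..<l}" using c assms i by (auto simp: colourings_def PiE_def extensional_def)
      moreover have "int (\<Sum>Y\<in>{Y\<in>insert X C. ?c Y = j}. sz Y) = v j" if "j < l" for j
      proof -
        have "int (\<Sum>Y\<in>{Y\<in>C. c Y = j}. sz Y) = (v(i := v i - int (sz X))) j"
          using c that by (simp add: colourings_def)
        moreover have "(\<Sum>Y\<in>{Y\<in>insert X C. ?c Y = j}. sz Y) =
          (if ?c X = j then sz X else 0) + (\<Sum>Y\<in>{Y\<in>C. c Y = j}. sz Y)"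
          by (rule sum_eq) (use assms(2) in auto)
        then have "(\<Sum>Y\<in>{Y\<in>insert X C. ?c Y = j}. sz Y) =
          (if i = j then sz X else 0) + (\<Sum>Y\<in>{Y\<in>C. c Y = j}. sz Y)"
          by (simp only: fun_upd_same)
        ultimately show ?thesis by (rule aux2)
      qed
      ultimately show "?c \<in> colourings l (insert X C) sz v" unfolding colourings_def by blast
    qed
    show "\<forall>c\<in>colourings l (insert X C) sz v. (case (c X, c(X := undefined)) of (i, c) \<Rightarrow> c(X := i)) = c"
      by auto
    show "\<forall>p\<in>?S. ((case p of (i, c) \<Rightarrow> c(X := i)) X, (case p of (i, c) \<Rightarrow> c(X := i))(X := undefined)) = p"
      using assms(2) by (auto simp: colourings_def PiE_def extensional_def fun_eq_iff)
  qed
  then have "card (colourings l (insert X C) sz v) = card ?S" by (rule bij_betw_same_card)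
  also have "\<dots> = (\<Sum>i<l. card (colourings l C sz (v(i := v i - int (sz X)))))"
    by (subst card_SigmaI) (auto intro: finite_colourings assms)
  finally show ?thesis .
qed

section \<open>Antisymmetry and the Murnaghan-Nakayama recursion\<close>

lemma frob_cong:
  assumes "\<And>i. i < l \<Longrightarrow> b i = b' i"
  shows "frob l C sz b = frob l C sz b'"
  unfolding frob_def using assms
  by (intro sum.cong refl arg_cong2[where f = "(*)"] arg_cong[where f = int]
      arg_cong[where f = card] colourings_cong) auto

lemma frob_empty:
  "frob l {} sz b = (\<Sum>w\<in>{w. w permutes {0..<l}}. if \<forall>i<l. b i = int (w i) then sign w else 0)"
  unfolding frob_def colourings_empty by (intro sum.cong refl) auto

text \<open>The Murnaghan-Nakayama rule before sorting: removing a rim hook of length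
  \<open>sz X\<close> lowers one beta-number by that amount. The exponents are not put in order
  afterwards, so no heights of hooks appear; their signs are hidden in the antisymmetry of
  \<open>frob\<close>.\<close>

lemma frob_insert:
  assumes "finite C" "X \<notin> C"
  shows "frob l (insert X C) sz b = (\<Sum>i<l. frob l C sz (b(i := b i - int (sz X))))"
proof -
  have "(\<lambda>j. b j - int (w j))(i := b i - int (w i) - int (sz X)) =
      (\<lambda>j. (b(i := b i - int (sz X))) j - int (w j))" for i and w :: "nat \<Rightarrow> nat"
    by auto
  then have "frob l (insert X C) sz b = (\<Sum>w\<in>{w. w permutes {0..<l}}. \<Sum>i<l. sign w *
      int (card (colourings l C sz (\<lambda>j. (b(i := b i - int (sz X))) j - int (w j)))))"
    unfolding frob_def card_colourings_insert[OF assms] by (simp add: sum_distrib_left)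
  also have "\<dots> = (\<Sum>i<l. frob l C sz (b(i := b i - int (sz X))))"
    unfolding frob_def by (rule sum.swap)
  finally show ?thesis .
qed

text \<open>The alternant is antisymmetric and the power sums are symmetric. On coefficients, the
  recursion commutes with permuting the exponents, so only the case without power sums has to be
  computed.\<close>

lemma frob_permute:
  assumes "finite C" "u permutes {0..<l}"
  shows "frob l C sz (b \<circ> u) = sign u * frob l C sz b"
  using assms(1)
proof (induction C arbitrary: b)
  case empty
  have "frob l {} sz (b \<circ> u) = (\<Sum>w\<in>{w. w permutes {0..<l}}.
      if \<forall>i<l. (b \<circ> u) i = int ((w \<circ> u) i) then sign (w \<circ> u) else 0)"
    unfolding frob_empty by (rule sum_permutations_compose_right[OF assms(2)]) 
  also have "\<dots> = (\<Sum>w\<in>{w. w permutes {0..<l}}. sign u * (if \<forall>i<l. b i = int (w i) then sign w else 0))"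
  proof (rule sum.cong[OF refl])
    fix w assume "w \<in> {w. w permutes {0..<l}}"
    then have w: "w permutes {0..<l}" by simp
    have "(\<forall>i<l. (b \<circ> u) i = int ((w \<circ> u) i)) \<longleftrightarrow> (\<forall>i\<in>u ` {0..<l}. b i = int (w i))" by auto
    also have "u ` {0..<l} = {0..<l}" by (rule permutes_image[OF assms(2)])
    finally have "(\<forall>i<l. (b \<circ> u) i = int ((w \<circ> u) i)) \<longleftrightarrow> (\<forall>i<l. b i = int (w i))" by auto
    moreover have "sign (w \<circ> u) = sign u * sign w"
      using w assms(2) by (subst sign_compose) (auto intro: permutation_permutes[THEN iffD2])
    ultimately show "(if \<forall>i<l. (b \<circ> u) i = int ((w \<circ> u) i) then sign (w \<circ> u) else 0) =
        sign u * (if \<forall>i<l. b i = int (w i) then sign w else 0)" by simp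
  qed
  also have "\<dots> = sign u * frob l {} sz b" by (simp add: frob_empty sum_distrib_left)
  finally show ?case .
next
  case (insert X C)
  have "frob l (insert X C) sz (b \<circ> u) = (\<Sum>i<l. frob l C sz ((b(u i := b (u i) - int (sz X))) \<circ> u))"
    unfolding frob_insert[OF insert.hyps]
    by (intro sum.cong refl arg_cong[where f = "frob l C sz"])
      (auto simp: fun_eq_iff dest: permutes_inj[OF assms(2), THEN injD])
  also have "\<dots> = (\<Sum>i<l. sign u * frob l C sz (b(u i := b (u i) - int (sz X))))"
    by (simp only: insert.IH)
  also have "\<dots> = sign u * (\<Sum>i<l. frob l C sz (b(i := b i - int (sz X))))"
    using sum.permute[OF assms(2), of "\<lambda>i. frob l C sz (b(i := b i - int (sz X)))"]
    by (simp add: sum_distrib_left[symmetric] lessThan_atLeast0 o_def)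
  finally show ?case by (simp only: frob_insert[OF insert.hyps])
qed

text \<open>Exchanging the two positions fixes b but changes the sign. Together with the vanishing
  for negative exponents this discards the terms of the recursion that correspond to no removable
  rim hook.\<close>

lemma frob_eq_0_repeat:
  assumes "finite C" "i < l" "j < l" "i \<noteq> j" "b i = b j"
  shows "frob l C sz b = 0"
proof -
  let ?u = "Transposition.transpose i j"
  have "?u permutes {0..<l}" using assms by (intro permutes_swap_id) auto
  then have "frob l C sz (b \<circ> ?u) = - frob l C sz b"
    using frob_permute[OF assms(1)] sign_swap_id[of i j] assms(4) by simp
  moreover have "b \<circ> ?u = b" using assms(5) by (auto simp: fun_eq_iff transpose_def)
  ultimately show ?thesis by simp
qed

lemma frob_eq_0_neg:
  assumes "finite C" "i < l" "b i < 0"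
  shows "frob l C sz b = 0"
  using assms
proof (induction C arbitrary: b)
  case empty
  then show ?case by (force simp: frob_empty intro!: sum.neutral)
next
  case (insert X C)
  then show ?case
    by (subst frob_insert) (auto intro!: sum.neutral insert.IH)
qed

section \<open>Beta-sets and the number of removable rim hooks\<close>

lemma sum_permutes: "w permutes {0..<l} \<Longrightarrow> (\<Sum>i<l. w i) = (\<Sum>i<l. i)" for l :: nat
  using sum.permute[of w "{0..<l}" "\<lambda>i. i"] by (simp add: lessThan_atLeast0 o_def)

text \<open>If X is the beta-set of a partition, an element x has as many gaps below it as the row
  belonging to x has cells. So the pairs count the cells, and the sum of X exceeds that number by 0
  + 1 + ... + (card X - 1).\<close>

lemma sum_nat_set_gaps:
  fixes X :: "nat set"
  assumes "finite X"
  shows "card {(x, y). x \<in> X \<and> y \<notin> X \<and> y < x} + (\<Sum>i<card X. i) = \<Sum> X"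
  using assms
proof (induction X rule: finite_linorder_max_induct)
  case empty
  then show ?case by simp
next
  case (insert b X)
  let ?G = "\<lambda>X. {(x, y). x \<in> X \<and> y \<notin> X \<and> y < (x::nat)}"
  have b: "b \<notin> X" using insert by auto
  have "?G (insert b X) = ?G X \<union> {b} \<times> ({..<b} - X)" using insert by auto
  moreover have "finite (?G X)"
    by (rule finite_subset[of _ "X \<times> {..<b}"]) (use insert in \<open>auto dest: less_trans\<close>)
  moreover have "?G X \<inter> {b} \<times> ({..<b} - X) = {}" using b by auto
  ultimately have "card (?G (insert b X)) = card (?G X) + card ({b} \<times> ({..<b} - X))"
    by (simp add: card_Un_disjoint)
  also have "card ({b} \<times> ({..<b} - X)) = b - card X"
    using insert by (simp add: card_cartesian_product_singleton card_Diff_subset subset_iff)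
  finally have "card (?G (insert b X)) = card (?G X) + (b - card X)" .
  moreover have "card X \<le> b" using card_mono[of "{..<b}" X] insert by auto
  ultimately show ?case using insert b by simp
qed

text \<open>The beta-set version of the fact that a partition of \<open>A\<close> has at most \<open>sqrt (2 * A)\<close> removable
  rim hooks of a given length: the elements \<open>x\<close> below and their gaps \<open>x - r\<close> span a staircase of pairs.\<close>

lemma card_removable_squared:
  fixes X :: "nat set"
  assumes "finite X" "r > 0"
  shows "(card {x \<in> X. r \<le> x \<and> x - r \<notin> X})\<^sup>2 + 2 * (\<Sum>i<card X. i) \<le> 2 * \<Sum> X"
proof -
  let ?R = "{x \<in> X. r \<le> x \<and> x - r \<notin> X}"
  let ?G = "{(x, y). x \<in> X \<and> y \<notin> X \<and> y < x}"
  let ?T = "{(x, x'). x \<in> ?R \<and> x' \<in> ?R \<and> x' \<le> x}"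
  have finR: "finite ?R" using assms by simp
  have finT: "finite ?T" by (rule finite_subset[of _ "?R \<times> ?R"]) (use finR in auto)
  have "finite ?G"
  proof (rule finite_subset)
    show "?G \<subseteq> (SIGMA x:X. {..<x})" by auto
  qed (use assms in auto)
  moreover have "(\<lambda>(x, x'). (x, x' - r)) ` ?T \<subseteq> ?G" using assms(2) by auto
  moreover have "inj_on (\<lambda>(x, x'). (x, x' - r)) ?T" by (auto simp: inj_on_def)
  ultimately have "card ?T \<le> card ?G" by (intro card_inj_on_le)
  have "card ?R * card ?R = card (?R \<times> ?R)" by (simp only: card_cartesian_product)
  also have "\<dots> \<le> card (?T \<union> prod.swap ` ?T)"
    by (rule card_mono) (use finT in \<open>auto simp: image_iff\<close>)
  also have "\<dots> \<le> card ?T + card (prod.swap ` ?T)" by (rule card_Un_le)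
  also have "\<dots> \<le> 2 * card ?T" using card_image_le[OF finT, of prod.swap] by simp
  finally show ?thesis
    using \<open>card ?T \<le> card ?G\<close> sum_nat_set_gaps[OF assms(1)] by (simp add: power2_eq_square)
qed

text \<open>Each removal of a rim hook branches into at most sqrt(2A) nonzero terms. The size enters
  only as an upper bound, which removals preserve, so the same A serves at all levels of the
  induction; b need be neither sorted nor injective.\<close>

lemma abs_frob_le:
  assumes "finite C" "\<And>X. X \<in> C \<Longrightarrow> sz X > 0" "(\<Sum>i<l. b i) \<le> int A + int (\<Sum>i<l. i)"
  shows "\<bar>real_of_int (frob l C sz b)\<bar> \<le> sqrt (2 * real A) ^ card C"
  using assms
proof (induction C arbitrary: b)
  case empty
  show ?case
  proof (cases "\<exists>w. w permutes {0..<l} \<and> (\<forall>i<l. b i = int (w i))")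
    case True
    then obtain w where w: "w permutes {0..<l}" "\<forall>i<l. b i = int (w i)" by auto
    have "w' = w" if "w' permutes {0..<l}" "\<forall>i<l. b i = int (w' i)" for w'
    proof
      fix i show "w' i = w i"
        using w that by (cases "i < l") (auto simp: permutes_def)
    qed
    then have "frob l {} sz b = (\<Sum>w'\<in>{w'. w' permutes {0..<l}}. if w' = w then sign w else 0)"
      unfolding frob_empty using w by (intro sum.cong) auto
    also have "\<dots> = sign w" using w by (simp add: sum.delta finite_permutations)
    finally show ?thesis by (simp add: sign_def)
  next
    case False
    then have "frob l {} sz b = 0" by (auto simp: frob_empty intro!: sum.neutral)
    then show ?thesis by simp
  qed
next
  case (insert X C)
  show ?case
  proof (cases "inj_on b {..<l} \<and> (\<forall>i<l. b i \<ge> 0)")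
    case False
    then consider i j where "i < l" "j < l" "i \<noteq> j" "b i = b j" | i where "i < l" "b i < 0"
      unfolding inj_on_def by (metis lessThan_iff not_le)
    then have "frob l (insert X C) sz b = 0"
      using insert.hyps by cases (auto intro: frob_eq_0_repeat frob_eq_0_neg)
    then show ?thesis by simp
  next
    case True
    define \<gamma> where "\<gamma> i = nat (b i)" for i
    have \<gamma>: "b i = int (\<gamma> i)" if "i < l" for i using True that by (simp add: \<gamma>_def)
    have inj: "inj_on \<gamma> {..<l}" using True \<gamma> by (auto simp: inj_on_def)
    define r where "r = sz X"
    have r: "r > 0" using insert.prems by (simp add: r_def)
    let ?R = "{x \<in> \<gamma> ` {..<l}. r \<le> x \<and> x - r \<notin> \<gamma> ` {..<l}}"
    let ?I = "{i\<in>{..<l}. \<gamma> i \<in> ?R}"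
    \<comment> \<open>If \<open>\<gamma> i\<close> cannot be lowered by r inside the complement of
      the beta-set, the new exponent is either negative or equal to another one.\<close>
    have zero: "frob l C sz (b(i := b i - int r)) = 0" if "i < l" "i \<notin> ?I" for i
    proof (cases "r \<le> \<gamma> i")
      case False
      then show ?thesis using that by (intro frob_eq_0_neg[of _ i]) (auto simp: insert.hyps \<gamma>)
    next
      case True
      then have "\<gamma> i - r \<in> \<gamma> ` {..<l}" using that by auto
      then obtain j where j: "j < l" "\<gamma> j = \<gamma> i - r" by auto
      then have "j \<noteq> i" using r True by auto
      then show ?thesis using j that True
        by (intro frob_eq_0_repeat[of _ i _ j]) (auto simp: insert.hyps \<gamma>)
    qed
    have "(\<Sum>x\<in>\<gamma> ` {..<l}. x) = (\<Sum>i<l. \<gamma> i)" by (simp add: sum.reindex[OF inj])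
    moreover have "int (\<Sum>i<l. \<gamma> i) = (\<Sum>i<l. b i)" by (simp add: \<gamma>)
    ultimately have "\<Sum> (\<gamma> ` {..<l}) \<le> A + (\<Sum>i<l. i)" using insert.prems(2) by linarith
    moreover have "(card ?R)\<^sup>2 + 2 * (\<Sum>i<card (\<gamma> ` {..<l}). i) \<le> 2 * \<Sum> (\<gamma> ` {..<l})"
      by (rule card_removable_squared) (use r in auto)
    moreover have "card (\<gamma> ` {..<l}) = l" using card_image[OF inj] by simp
    ultimately have "(card ?R)\<^sup>2 \<le> 2 * A" by simp
    then have "real ((card ?R)\<^sup>2) \<le> real (2 * A)" by (simp only: of_nat_le_iff)
    then have R: "(real (card ?R))\<^sup>2 \<le> 2 * real A" by simp
    have "(real (card ?I))\<^sup>2 \<le> (real (card ?R))\<^sup>2"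
      by (intro power_mono of_nat_mono card_inj_on_le[of \<gamma>]) (use inj in \<open>auto simp: inj_on_def\<close>)
    then have "(real (card ?I))\<^sup>2 \<le> 2 * real A" using R by (rule order_trans)
    then have I: "real (card ?I) \<le> sqrt (2 * real A)" by (rule real_le_rsqrt)
    have "\<bar>real_of_int (frob l (insert X C) sz b)\<bar> = \<bar>\<Sum>i<l. real_of_int (frob l C sz (b(i := b i - int r)))\<bar>"
      by (simp add: frob_insert insert.hyps r_def)
    also have "\<dots> = \<bar>\<Sum>i\<in>?I. real_of_int (frob l C sz (b(i := b i - int r)))\<bar>"
      by (rule arg_cong[where f = abs], rule sum.mono_neutral_right) (use zero in auto)
    also have "\<dots> \<le> (\<Sum>i\<in>?I. \<bar>real_of_int (frob l C sz (b(i := b i - int r)))\<bar>)" by (rule sum_abs)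
    also have "\<dots> \<le> (\<Sum>i\<in>?I. sqrt (2 * real A) ^ card C)"
    proof (rule sum_mono)
      fix i assume "i \<in> ?I"
      then have "(\<Sum>j<l. (b(i := b i - int r)) j) \<le> (\<Sum>j<l. b j)" by (intro sum_mono) auto
      then show "\<bar>real_of_int (frob l C sz (b(i := b i - int r)))\<bar> \<le> sqrt (2 * real A) ^ card C"
        using insert.prems by (intro insert.IH) auto
    qed
    also have "\<dots> = real (card ?I) * sqrt (2 * real A) ^ card C" by simp
    also have "\<dots> \<le> sqrt (2 * real A) * sqrt (2 * real A) ^ card C"
      using I by (intro mult_right_mono) auto
    also have "\<dots> = sqrt (2 * real A) ^ card (insert X C)" using insert.hyps by simp
    finally show ?thesis .
  qed
qed

section \<open>Adding fixed points\<close>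

text \<open>With 1/k! read as 0 for negative k, the recurrence 1/(k-1)! = k/k! holds for all
  integers, including k = 0, and quotients by falling factorials need no case distinction:
  \<open>falling (real x) k\<close> vanishes for k > x as well.\<close>

definition inv_fact :: "int \<Rightarrow> real" where
  "inv_fact z = (if z < 0 then 0 else inverse (fact (nat z)))"

lemma inv_fact_pred: "inv_fact (z - 1) = of_int z * inv_fact z"
proof (cases "z > 0")
  case True
  then obtain m where "z = int (Suc m)" using zero_less_imp_eq_int[of z] gr0_implies_Suc by blast
  moreover have "1 + real m \<noteq> 0" by linarith
  ultimately show ?thesis by (simp add: inv_fact_def nat_add_distrib)
qed (auto simp: inv_fact_def)

lemma inv_fact_diff: "inv_fact (int x - int k) = inverse (fact x) * falling (real x) k"
proof (cases "k \<le> x")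
  case True
  then obtain m where x: "x = m + k" using le_Suc_ex[of k x] by (auto simp: add.commute)
  have eq: "fact (m + k) = fact m * falling (real (m + k)) k"
  proof (induction k)
    case (Suc k)
    then show ?case
      by (simp add: falling_Suc' algebra_simps)
  qed simp
  have "falling (real (m + k)) k = fact (m + k) / fact m" unfolding eq by simp
  then show ?thesis by (simp add: x inv_fact_def inverse_eq_divide)
next
  case False
  then have "falling (real x) k = 0" unfolding falling_def by (intro prod_zero) auto
  then show ?thesis using False by (simp add: inv_fact_def)
qed

text \<open>With equal totals, the differences are all zero or one of them is negative. This starts
  the induction that adds unit parts.\<close>

lemma prod_inv_fact_eq_indicator:
  fixes l :: nat
  assumes "(\<Sum>i<l. b i) = (\<Sum>i<l. e i)"
  shows "(\<Prod>i<l. inv_fact (b i - e i)) = (if \<forall>i<l. b i = e i then 1 else 0)"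
proof (cases "\<forall>i<l. b i = e i")
  case True
  then show ?thesis by (simp add: inv_fact_def)
next
  case False
  have "\<exists>i<l. b i < e i"
  proof (rule ccontr)
    assume *: "\<not> (\<exists>i<l. b i < e i)"
    have le: "e i \<le> b i" if "i < l" for i using * that by (meson not_less)
    obtain k where "k < l" "b k \<noteq> e k" using False by auto
    then have "e k < b k" using le[of k] by simp
    then have "(\<Sum>i<l. e i) < (\<Sum>i<l. b i)"
      by (intro sum_strict_mono_ex1) (use le \<open>k < l\<close> in auto)
    then show False using assms by simp
  qed
  then have "(\<Prod>i<l. inv_fact (b i - e i)) = 0"
    by (intro prod_zero) (auto simp: inv_fact_def)
  then show ?thesis by (subst if_not_P[OF False])
qed

text \<open>Adding unit parts to an expansion into point masses: this is multiplication by powers of the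
  first power sum, whose coefficients are multinomial.\<close>

lemma frob_unit_expansion:
  fixes a :: "'t \<Rightarrow> real" and e :: "'t \<Rightarrow> nat \<Rightarrow> int"
  assumes C1: "finite C1"
    and T: "\<And>t. t \<in> T \<Longrightarrow> (\<Sum>i<l. e t i) = S"
    and base: "\<And>b. (\<And>i. i < l \<Longrightarrow> b i \<le> L) \<Longrightarrow> (\<Sum>i<l. b i) = S \<Longrightarrow>
      real_of_int (frob l C1 sz b) = (\<Sum>t\<in>T. a t * (if \<forall>i<l. b i = e t i then 1 else 0))"
    and "finite C0" "C0 \<inter> C1 = {}" "\<And>X. X \<in> C0 \<Longrightarrow> sz X = 1"
    and "\<And>i. i < l \<Longrightarrow> b i \<le> L" "(\<Sum>i<l. b i) = S + int (card C0)"
  shows "real_of_int (frob l (C0 \<union> C1) sz b) =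
    fact (card C0) * (\<Sum>t\<in>T. a t * (\<Prod>i<l. inv_fact (b i - e t i)))"
  using assms(4-)
proof (induction C0 arbitrary: b)
  case empty
  then have "real_of_int (frob l ({} \<union> C1) sz b) =
      (\<Sum>t\<in>T. a t * (if \<forall>i<l. b i = e t i then 1 else 0))"
    using base[of b] by simp
  also have "\<dots> = (\<Sum>t\<in>T. a t * (\<Prod>i<l. inv_fact (b i - e t i)))"
    using empty T by (intro sum.cong refl, subst prod_inv_fact_eq_indicator) auto
  finally show ?case by simp
next
  case (insert X C)
  have X: "X \<notin> C \<union> C1" using insert by auto
  have step: "real_of_int (frob l (C \<union> C1) sz (b(i := b i - 1))) =
      fact (card C) * (\<Sum>t\<in>T. a t * (of_int (b i - e t i) * (\<Prod>j<l. inv_fact (b j - e t j))))"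
    if i: "i < l" for i
  proof -
    have "(\<Sum>j<l. (b(i := b i - 1)) j) = (\<Sum>j<l. b j) - 1"
      using i by (subst (1 2) sum.remove[of _ i]) (auto intro!: sum.cong)
    moreover have "(b(i := b i - 1)) j \<le> L" if "j < l" for j
      using insert.prems(3)[OF that] insert.prems(3)[OF i] by simp
    ultimately have IH: "real_of_int (frob l (C \<union> C1) sz (b(i := b i - 1))) =
        fact (card C) * (\<Sum>t\<in>T. a t * (\<Prod>j<l. inv_fact ((b(i := b i - 1)) j - e t j)))"
      using insert.prems insert.hyps by (intro insert.IH) auto
    have prod_eq: "(\<Prod>j<l. inv_fact ((b(i := b i - 1)) j - e t j)) =
        of_int (b i - e t i) * (\<Prod>j<l. inv_fact (b j - e t j))" for t
    proof -
      have "(\<Prod>j<l. inv_fact ((b(i := b i - 1)) j - e t j)) =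
          inv_fact (b i - 1 - e t i) * (\<Prod>j\<in>{..<l} - {i}. inv_fact ((b(i := b i - 1)) j - e t j))"
        using i by (subst prod.remove[of _ i]) auto
      also have "b i - 1 - e t i = (b i - e t i) - 1" by simp
      also have "(\<Prod>j\<in>{..<l} - {i}. inv_fact ((b(i := b i - 1)) j - e t j)) =
          (\<Prod>j\<in>{..<l} - {i}. inv_fact (b j - e t j))"
        by (intro prod.cong) auto
      finally show ?thesis
        using i by (subst prod.remove[of "{..<l}" i]) (simp_all add: inv_fact_pred)
    qed
    show ?thesis unfolding IH prod_eq ..
  qed
  \<comment> \<open>The factors \<open>b i - e t i\<close> produced by lowering the exponents add up
    to the number of unit parts, the same for every t; this is what builds up the factorial in
    front.\<close>
  have weight: "(\<Sum>i<l. real_of_int (b i - e t i)) = real (Suc (card C))" if "t \<in> T" for t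
  proof -
    have "(\<Sum>i<l. b i - e t i) = int (Suc (card C))"
      using T[OF that] insert.prems insert.hyps by (simp add: sum_subtractf)
    then show ?thesis by (metis of_int_of_nat_eq of_int_sum)
  qed
  have "real_of_int (frob l (insert X C \<union> C1) sz b) =
      (\<Sum>i<l. real_of_int (frob l (C \<union> C1) sz (b(i := b i - 1))))"
    using frob_insert[OF _ X, of l sz b] C1 insert by simp
  also have "\<dots> = (\<Sum>i<l. fact (card C) *
      (\<Sum>t\<in>T. a t * (of_int (b i - e t i) * (\<Prod>j<l. inv_fact (b j - e t j)))))"
    by (intro sum.cong refl step) simp
  also have "\<dots> = fact (card C) *
      (\<Sum>t\<in>T. \<Sum>i<l. a t * (of_int (b i - e t i) * (\<Prod>j<l. inv_fact (b j - e t j))))"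
    by (subst sum.swap) (simp add: sum_distrib_left)
  also have "\<dots> = fact (card C) *
      (\<Sum>t\<in>T. a t * (\<Prod>j<l. inv_fact (b j - e t j)) * (\<Sum>i<l. real_of_int (b i - e t i)))"
    by (simp add: sum_distrib_left mult_ac)
  also have "\<dots> = fact (card C) *
      (\<Sum>t\<in>T. a t * (\<Prod>j<l. inv_fact (b j - e t j)) * real (Suc (card C)))"
    by (intro arg_cong2[where f = "(*)"] sum.cong refl) (simp only: weight)
  also have "\<dots> = fact (card (insert X C)) * (\<Sum>t\<in>T. a t * (\<Prod>j<l. inv_fact (b j - e t j)))"
    using insert.hyps by (simp add: sum_distrib_left sum_distrib_right mult_ac del: of_nat_Suc)
  finally show ?case .
qed

text \<open>Without longer cycles the point masses are the terms of the alternant itself, and their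
  sum is a Vandermonde determinant. The result is Frobenius' degree formula in terms of
  beta-numbers.\<close>

lemma frob_units:
  assumes "finite C" "\<And>X. X \<in> C \<Longrightarrow> sz X = 1" "(\<Sum>i<l. \<beta> i) = card C + (\<Sum>i<l. i)"
  shows "real_of_int (frob l C sz (\<lambda>i. int (\<beta> i))) =
    fact (card C) * (vander l (\<lambda>i. real (\<beta> i)) / (\<Prod>i<l. fact (\<beta> i)))"
proof -
  let ?T = "{w. w permutes {0..<l}}"
  have "real_of_int (frob l (C \<union> {}) sz (\<lambda>i. int (\<beta> i))) =
      fact (card C) * (\<Sum>w\<in>?T. of_int (sign w) * (\<Prod>i<l. inv_fact (int (\<beta> i) - int (w i))))"
  proof (rule frob_unit_expansion[where S = "int (\<Sum>i<l. i)" and L = "int (\<Sum>i<l. \<beta> i)"])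
    show "(\<Sum>i<l. int (w i)) = int (\<Sum>i<l. i)" if "w \<in> ?T" for w
      using sum_permutes[of w l] that by (metis mem_Collect_eq of_nat_sum)
    show "real_of_int (frob l {} sz b) =
        (\<Sum>w\<in>?T. of_int (sign w) * (if \<forall>i<l. b i = int (w i) then 1 else 0))" for b
      unfolding frob_empty of_int_sum by (intro sum.cong refl) auto
    show "int (\<beta> i) \<le> int (\<Sum>i<l. \<beta> i)" if "i < l" for i
      using member_le_sum[of i "{..<l}" \<beta>] that by (simp only: of_nat_le_iff) simp
    show "(\<Sum>i<l. int (\<beta> i)) = int (\<Sum>i<l. i) + int (card C)"
      using assms(3) by (simp flip: of_nat_sum)
  qed (use assms in auto)
  also have "(\<Sum>w\<in>?T. of_int (sign w) * (\<Prod>i<l. inv_fact (int (\<beta> i) - int (w i)))) =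
      ldet l (\<lambda>i j. inverse (fact (\<beta> i)) * (1 * falling (real (\<beta> i)) j))"
    unfolding ldet_def by (simp add: inv_fact_diff)
  also have "\<dots> = vander l (\<lambda>i. real (\<beta> i)) / (\<Prod>i<l. fact (\<beta> i))"
    unfolding ldet_scale vander_def using prod_inversef[of "\<lambda>i. fact (\<beta> i) :: real" "{..<l}"]
    by (simp add: comp_def divide_inverse mult.commute)
  finally show ?thesis by simp
qed

text \<open>A set with l elements and sum S encodes a partition of S - (0 + ... + (l - 1)) with at
  most l rows. The cap L makes the family finite; it will be a bound for the beta-numbers of the
  ambient partition.\<close>

definition beta_sets :: "nat \<Rightarrow> nat \<Rightarrow> nat \<Rightarrow> nat set set" where
  "beta_sets l L S = {X. X \<subseteq> {0..L} \<and> card X = l \<and> \<Sum> X = S}"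

abbreviation enum :: "nat set \<Rightarrow> nat \<Rightarrow> nat" where
  "enum X i \<equiv> sorted_list_of_set X ! i"

lemma finite_beta_sets: "finite (beta_sets l L S)"
  unfolding beta_sets_def by (rule finite_subset[of _ "Pow {0..L}"]) auto

lemma
  assumes "finite X"
  shows enum_less: "i < j \<Longrightarrow> j < card X \<Longrightarrow> enum X i < enum X j"
    and bij_betw_enum: "bij_betw (enum X) {..<card X} X"
proof -
  show "i < j \<Longrightarrow> j < card X \<Longrightarrow> enum X i < enum X j"
    using strict_sorted_list_of_set[of X] assms by (auto simp: sorted_wrt_iff_nth_less)
  show "bij_betw (enum X) {..<card X} X"
    using bij_betw_nth[of "sorted_list_of_set X" "{..<card X}" X] assms by simp
qed

lemma sum_enum: "finite X \<Longrightarrow> (\<Sum>i<card X. g (enum X i)) = (\<Sum>x\<in>X. g x)"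
  by (rule sum.reindex_bij_betw[OF bij_betw_enum])

text \<open>The branching rule in coordinates. Since 1/(\<beta>_i - c_j)! is a falling factorial of
  \<beta>_i divided by \<beta>_i!, the determinant with the prefactor is Aitken's determinant for
  the number of standard tableaux of a skew shape; C0 consists of the fixed points and the sets X
  are the beta-sets of the smaller partitions.\<close>

lemma frob_expansion:
  assumes "finite C0" "finite C1" "C0 \<inter> C1 = {}" "\<And>X. X \<in> C0 \<Longrightarrow> sz X = 1"
    and "\<And>i. i < l \<Longrightarrow> \<beta> i \<le> L" "(\<Sum>i<l. \<beta> i) = S + card C0"
  shows "real_of_int (frob l (C0 \<union> C1) sz (\<lambda>i. int (\<beta> i))) =
    fact (card C0) / (\<Prod>i<l. fact (\<beta> i)) * (\<Sum>X\<in>beta_sets l L S.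
      of_int (frob l C1 sz (\<lambda>i. int (enum X i))) * ldet l (\<lambda>i j. falling (real (\<beta> i)) (enum X j)))"
proof -
  let ?W = "{w. w permutes {0..<l}}"
  let ?T = "beta_sets l L S \<times> ?W"
  let ?a = "\<lambda>(X, w). of_int (sign w) * real_of_int (frob l C1 sz (\<lambda>i. int (enum X i)))"
  let ?e = "\<lambda>(X, w) i. int (enum X (w i))"
  have fin: "finite ?T" by (simp add: finite_beta_sets finite_permutations)
  have X: "finite X" "card X = l" "\<Sum> X = S" "X \<subseteq> {0..L}" if "X \<in> beta_sets l L S" for X
    using that by (auto simp: beta_sets_def intro: finite_subset)
  have "real_of_int (frob l (C0 \<union> C1) sz (\<lambda>i. int (\<beta> i))) =
      fact (card C0) * (\<Sum>t\<in>?T. ?a t * (\<Prod>i<l. inv_fact (int (\<beta> i) - ?e t i)))"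
  proof (rule frob_unit_expansion[where S = "int S" and L = "int L"])
    show "(\<Sum>i<l. ?e t i) = int S" if "t \<in> ?T" for t
    proof -
      obtain Y w where t: "t = (Y, w)" "Y \<in> beta_sets l L S" "w permutes {0..<l}" using \<open>t \<in> ?T\<close> by auto
      have "(\<Sum>i<l. enum Y (w i)) = (\<Sum>i<l. enum Y i)"
        using sum.permute[OF t(3), of "enum Y"] by (simp add: lessThan_atLeast0 o_def)
      also have "\<dots> = S" using sum_enum[OF X(1)[OF t(2)], of "\<lambda>x. x"] X[OF t(2)] by simp
      finally show ?thesis by (simp add: t(1) flip: of_nat_sum)
    qed
    \<comment> \<open>An exponent vector with distinct nonnegative entries is a rearrangement of
      exactly one sorted beta-set, in exactly one way. For all other vectors both sides
      vanish.\<close>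
    show "real_of_int (frob l C1 sz b) = (\<Sum>t\<in>?T. ?a t * (if \<forall>i<l. b i = ?e t i then 1 else 0))"
      if b: "\<And>i. i < l \<Longrightarrow> b i \<le> int L" "(\<Sum>i<l. b i) = int S" for b
    proof (cases "inj_on b {..<l} \<and> (\<forall>i<l. b i \<ge> 0)")
      case False
      then consider i j where "i < l" "j < l" "i \<noteq> j" "b i = b j" | i where "i < l" "b i < 0"
        unfolding inj_on_def by (metis lessThan_iff not_le)
      then have "frob l C1 sz b = 0"
        using assms(2) by cases (auto intro: frob_eq_0_repeat frob_eq_0_neg)
      moreover have "\<not> (\<forall>i<l. b i = ?e (Y, w) i)" if "Y \<in> beta_sets l L S" "w permutes {0..<l}" for Y w
      proof
        assume eq: "\<forall>i<l. b i = ?e (Y, w) i"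
        have "inj_on (enum Y \<circ> w) {..<l}"
        proof (rule comp_inj_on)
          show "inj_on w {..<l}" by (rule permutes_inj_on[OF that(2)])
          have "w ` {..<l} = {..<card Y}"
            using permutes_image[OF that(2)] X(2)[OF that(1)] by (simp add: lessThan_atLeast0)
          then show "inj_on (enum Y) (w ` {..<l})"
            using bij_betw_enum[OF X(1)[OF that(1)]] by (simp add: bij_betw_def)
        qed
        then have "inj_on b {..<l}" using eq by (auto simp: inj_on_def)
        moreover have "\<forall>i<l. b i \<ge> 0" using eq by simp
        ultimately show False using False by simp
      qed
      then have "(\<Sum>t\<in>?T. ?a t * (if \<forall>i<l. b i = ?e t i then 1 else 0)) = 0"
        by (intro sum.neutral) fastforce
      ultimately show ?thesis by simp
    next
      case True
      define \<gamma> where "\<gamma> i = nat (b i)" for i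
      have \<gamma>: "b i = int (\<gamma> i)" if "i < l" for i using True that by (simp add: \<gamma>_def)
      have inj: "inj_on \<gamma> {..<l}" using True \<gamma> by (auto simp: inj_on_def)
      define Y where "Y = \<gamma> ` {..<l}"
      have cY: "card Y = l" using card_image[OF inj] by (simp add: Y_def)
      have "\<Sum> Y = (\<Sum>i<l. \<gamma> i)" unfolding Y_def by (simp add: sum.reindex[OF inj])
      moreover have "int (\<Sum>i<l. \<gamma> i) = int S" using b(2) \<gamma> by simp
      then have "(\<Sum>i<l. \<gamma> i) = S" by (simp only: of_nat_eq_iff)
      ultimately have "\<Sum> Y = S" by simp
      moreover have "Y \<subseteq> {0..L}" using b(1) \<gamma> by (force simp: Y_def)
      ultimately have Y: "Y \<in> beta_sets l L S" using cY by (simp add: beta_sets_def)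
      have enY: "bij_betw (enum Y) {..<l} Y" using bij_betw_enum[OF X(1)[OF Y]] cY by simp
      \<comment> \<open>The sorting permutation: \<open>w i\<close> is the rank of
        \<open>\<gamma> i\<close> within Y.\<close>
      define w where "w i = (if i < l then inv_into {..<l} (enum Y) (\<gamma> i) else i)" for i
      have bw: "bij_betw w {0..<l} {0..<l}"
      proof -
        have "bij_betw (inv_into {..<l} (enum Y) \<circ> \<gamma>) {..<l} {..<l}"
          by (rule bij_betw_trans[OF _ bij_betw_inv_into[OF enY]]) (simp add: inj bij_betw_def Y_def)
        then have "bij_betw w {..<l} {..<l}"
          by (rule bij_betw_cong[THEN iffD1, rotated]) (simp add: w_def)
        then show ?thesis by (simp add: lessThan_atLeast0)
      qed
      then have w: "w permutes {0..<l}" by (rule bij_imp_permutes) (simp add: w_def)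
      have ew: "enum Y (w i) = \<gamma> i" if "i < l" for i
        using that enY by (simp add: w_def f_inv_into_f Y_def bij_betw_def)
      have uniq: "t = (Y, w)" if "t \<in> ?T" "\<forall>i<l. b i = ?e t i" for t
      proof -
        obtain Y' w' where t: "t = (Y', w')" "Y' \<in> beta_sets l L S" "w' permutes {0..<l}"
          using \<open>t \<in> ?T\<close> by auto
        have eq: "enum Y' (w' i) = \<gamma> i" if "i < l" for i
          using \<open>\<forall>i<l. b i = ?e t i\<close> that \<gamma>[OF that] by (simp add: t(1))
        have enY': "bij_betw (enum Y') {..<l} Y'"
          using bij_betw_enum[OF X(1)[OF t(2)]] X(2)[OF t(2)] by simp
        have "Y' = enum Y' ` w' ` {..<l}"
          using enY' permutes_image[OF t(3)] by (simp add: bij_betw_def lessThan_atLeast0)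
        also have "\<dots> = Y" unfolding Y_def image_image by (intro image_cong refl) (simp add: eq)
        finally have "Y' = Y" .
        have "w' i = w i" for i
        proof (cases "i < l")
          case True
          then have "w' i < l" "w i < l" using permutes_less[OF t(3)] permutes_less[OF w] by auto
          moreover have "enum Y (w' i) = enum Y (w i)" using eq ew True \<open>Y' = Y\<close> by simp
          ultimately show ?thesis using enY by (auto simp: bij_betw_def inj_on_def)
        next
          case False
          then show ?thesis using t(3) w by (auto simp: permutes_def)
        qed
        then show ?thesis using t(1) \<open>Y' = Y\<close> by auto
      qed
      have "(\<Sum>t\<in>?T. ?a t * (if \<forall>i<l. b i = ?e t i then 1 else 0)) =
          (\<Sum>t\<in>?T. if t = (Y, w) then ?a (Y, w) else 0)"
      proof (intro sum.cong refl)
        fix t assume "t \<in> ?T"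
        show "?a t * (if \<forall>i<l. b i = ?e t i then 1 else 0) = (if t = (Y, w) then ?a (Y, w) else 0)"
        proof (cases "t = (Y, w)")
          case True
          then show ?thesis by (simp add: ew \<gamma>)
        next
          case False
          then have "\<not> (\<forall>i<l. b i = ?e t i)" using uniq \<open>t \<in> ?T\<close> by blast
          then show ?thesis using False by (simp only: if_False mult_zero_right)
        qed
      qed
      also have "\<dots> = ?a (Y, w)" using fin Y w by (simp add: sum.delta)
      also have "\<dots> = real_of_int (frob l C1 sz ((\<lambda>i. int (enum Y i)) \<circ> w))"
        by (simp add: frob_permute[OF assms(2) w])
      also have "frob l C1 sz ((\<lambda>i. int (enum Y i)) \<circ> w) = frob l C1 sz b"
        by (rule frob_cong) (simp add: ew \<gamma>)
      finally show ?thesis by simp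
    qed
    show "(\<Sum>i<l. int (\<beta> i)) = int S + int (card C0)"
      using assms(6) by (simp flip: of_nat_sum)
  qed (use assms in auto)
  also have "(\<Sum>t\<in>?T. ?a t * (\<Prod>i<l. inv_fact (int (\<beta> i) - ?e t i))) =
      (\<Sum>X\<in>beta_sets l L S. of_int (frob l C1 sz (\<lambda>i. int (enum X i))) *
        ldet l (\<lambda>i j. inverse (fact (\<beta> i)) * (1 * falling (real (\<beta> i)) (enum X j))))"
  proof -
    have "(\<Sum>t\<in>?T. ?a t * (\<Prod>i<l. inv_fact (int (\<beta> i) - ?e t i))) =
        (\<Sum>(X, w)\<in>?T. ?a (X, w) * (\<Prod>i<l. inv_fact (int (\<beta> i) - ?e (X, w) i)))"
      by (intro sum.cong refl) auto
    then show ?thesis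
      unfolding ldet_def sum.cartesian_product[symmetric]
      by (simp add: inv_fact_diff sum_distrib_left mult_ac)
  qed
  also have "\<dots> = (\<Sum>X\<in>beta_sets l L S. of_int (frob l C1 sz (\<lambda>i. int (enum X i))) *
        ldet l (\<lambda>i j. falling (real (\<beta> i)) (enum X j))) / (\<Prod>i<l. fact (\<beta> i))"
    unfolding ldet_scale using prod_inversef[of "\<lambda>i. fact (\<beta> i) :: real" "{..<l}"]
    by (simp add: comp_def divide_inverse sum_distrib_left mult_ac)
  finally show ?thesis by simp
qed

text \<open>A composition of A + 1 either begins with 1 or arises from a composition of A by
  increasing its head, so the number at most doubles. Counting compositions instead of partitions is
  good enough, as a factor const^A is harmless.\<close>

lemma finite_card_compositions:
  "finite {xs. sum_list xs = A \<and> (\<forall>x\<in>set xs. 0 < x)} \<and>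
   card {xs. sum_list xs = A \<and> (\<forall>x\<in>set xs. 0 < (x::nat))} \<le> 2 ^ A"
proof (induction A)
  case 0
  have "{xs. sum_list xs = 0 \<and> (\<forall>x\<in>set xs. 0 < (x::nat))} = {[]}"
  proof (intro equalityI subsetI)
    fix xs :: "nat list" assume "xs \<in> {xs. sum_list xs = 0 \<and> (\<forall>x\<in>set xs. 0 < x)}"
    then show "xs \<in> {[]}" by (cases xs) auto
  qed auto
  then show ?case by simp
next
  case (Suc A)
  let ?K = "\<lambda>A. {xs. sum_list xs = A \<and> (\<forall>x\<in>set xs. 0 < (x::nat))}"
  let ?f = "\<lambda>xs. 1 # xs" and ?g = "\<lambda>xs. Suc (hd xs) # tl xs"
  have "?K (Suc A) \<subseteq> ?f ` ?K A \<union> ?g ` ?K A"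
  proof
    fix xs assume xs: "xs \<in> ?K (Suc A)"
    then obtain x ys where [simp]: "xs = x # ys" by (cases xs) auto
    show "xs \<in> ?f ` ?K A \<union> ?g ` ?K A"
    proof (cases "x = 1")
      case True
      then show ?thesis using xs by auto
    next
      case False
      then have "(x - 1) # ys \<in> ?K A" "xs = ?g ((x - 1) # ys)" using xs by auto
      then show ?thesis by blast
    qed
  qed
  moreover have "finite (?f ` ?K A \<union> ?g ` ?K A)" using Suc by blast
  ultimately have "finite (?K (Suc A))" "card (?K (Suc A)) \<le> card (?f ` ?K A \<union> ?g ` ?K A)"
    by (auto intro: finite_subset card_mono)
  moreover have "card (?f ` ?K A \<union> ?g ` ?K A) \<le> card (?K A) + card (?K A)"
    using Suc by (intro order_trans[OF card_Un_le] add_mono card_image_le) auto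
  ultimately show ?case using Suc by simp
qed

text \<open>Shows that a zero-padded partition, listed in increasing order, can be recovered from
  its positive parts once its length is known.\<close>

lemma sorted_split_zeros:
  "sorted xs \<Longrightarrow> xs = replicate (length xs - length (filter ((<) 0) xs)) 0 @ filter ((<) 0) (xs :: nat list)"
proof (induction xs)
  case (Cons x xs)
  show ?case
  proof (cases "x = 0")
    case True
    have "length (filter ((<) 0) xs) \<le> length xs" by simp
    then show ?thesis using Cons True by (simp add: Suc_diff_le)
  next
    case False
    then have "filter ((<) 0) (x # xs) = x # xs" using Cons by (auto intro!: filter_True)
    then show ?thesis by simp
  qed
qed simp

text \<open>The differences \<open>enum X i - i\<close> are the rows of the encoded partition in
  increasing order. Dropping the empty rows gives a composition of A, and nothing is lost because
  the number of rows is the fixed l.\<close>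

lemma card_beta_sets: "card (beta_sets l L (A + (\<Sum>i<l. i))) \<le> 2 ^ A"
proof -
  let ?B = "beta_sets l L (A + (\<Sum>i<l. i))"
  let ?d = "\<lambda>X. map (\<lambda>i. enum X i - i) [0..<l]"
  let ?f = "\<lambda>X. filter ((<) 0) (?d X)"
  let ?K = "{xs. sum_list xs = A \<and> (\<forall>x\<in>set xs. 0 < (x::nat))}"
  have X: "finite X" "card X = l" "\<Sum> X = A + (\<Sum>i<l. i)" if "X \<in> ?B" for X
    using that by (auto simp: beta_sets_def intro: finite_subset)
  have step: "enum X i - i \<le> enum X j - j \<and> i \<le> enum X i" if "X \<in> ?B" "i \<le> j" "j < l" for X i j
  proof -
    have "enum X i + (j - i) \<le> enum X j" using that(2,3)
    proof (induction j rule: dec_induct)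
      case (step k)
      then show ?case using enum_less[OF X(1)[OF that(1)], of k "Suc k"] X(2)[OF that(1)] by simp
    qed simp
    moreover have "i < l \<Longrightarrow> i \<le> enum X i" for i
    proof (induction i)
      case (Suc k)
      then show ?case using enum_less[OF X(1)[OF that(1)], of k "Suc k"] X(2)[OF that(1)] by simp
    qed simp
    ultimately show ?thesis using that by simp
  qed
  have "inj_on ?f ?B"
  proof (rule inj_onI)
    fix X Y assume XY: "X \<in> ?B" "Y \<in> ?B" "?f X = ?f Y"
    have "?d Z = replicate (l - length (?f Z)) 0 @ ?f Z" if "Z \<in> ?B" for Z
    proof -
      have "sorted (?d Z)" using step[OF that] by (auto simp: sorted_iff_nth_mono)
      from sorted_split_zeros[OF this] show ?thesis by (simp only: length_map length_upt diff_zero)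
    qed
    from this[OF XY(1)] this[OF XY(2)] have "?d X = ?d Y" by (simp only: XY(3))
    then have "enum X i - i = enum Y i - i" if "i < l" for i
      using that by (simp add: map_eq_conv)
    then have "enum X i = enum Y i" if "i < l" for i
      using that step[OF XY(1), of i i] step[OF XY(2), of i i] by (metis le_add_diff_inverse order_refl)
    then have "sorted_list_of_set X = sorted_list_of_set Y"
      using X[OF XY(1)] X[OF XY(2)] by (intro nth_equalityI) auto
    then show "X = Y" using X[OF XY(1)] X[OF XY(2)] sorted_list_of_set_inject by blast
  qed
  moreover have "?f ` ?B \<subseteq> ?K"
  proof clarify
    fix X assume B: "X \<in> ?B"
    have fil: "sum_list (filter ((<) 0) xs) = sum_list xs" for xs :: "nat list"
      by (induction xs) auto
    have "sum_list (?d X) + (\<Sum>i<l. i) = (\<Sum>i<l. (enum X i - i) + i)"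
      by (simp add: interv_sum_list_conv_sum_set_nat lessThan_atLeast0 sum.distrib)
    also have "\<dots> = (\<Sum>i<l. enum X i)"
    proof (intro sum.cong refl)
      fix i assume "i \<in> {..<l}"
      then have "i \<le> enum X i" using step[OF B, of i i] by simp
      then show "enum X i - i + i = enum X i" by simp
    qed
    also have "\<dots> = A + (\<Sum>i<l. i)" using sum_enum[OF X(1)[OF B], of "\<lambda>x. x"] X[OF B] by simp
    finally show "sum_list (?f X) = A \<and> (\<forall>x\<in>set (?f X). 0 < x)" by (simp add: fil)
  qed
  ultimately have "card ?B \<le> card ?K"
    using finite_card_compositions[of A] by (intro card_inj_on_le) auto
  then show ?thesis using finite_card_compositions[of A] by simp
qed

section \<open>The character ratio bound\<close>

text \<open>A single term of the exponential series; it serves as the lower Stirling bound for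
  A!.\<close>

lemma power_self_le_exp_fact: "real A ^ A \<le> exp (real A) * fact A"
proof -
  have "(\<Sum>k\<in>{A}. real A ^ k /\<^sub>R fact k) \<le> (\<Sum>k. real A ^ k /\<^sub>R fact k)"
    by (rule sum_le_suminf) (use exp_converges[of "real A"] in \<open>auto intro: sums_summable\<close>)
  also have "\<dots> = exp (real A)" using exp_converges[of "real A"] by (simp add: sums_iff)
  finally show ?thesis by (simp add: field_simps)
qed

text \<open>Combines (n/A)^A \<le> binomial(n, A) with the bound for A^A, where n = A + N. It says
  N! / n! \<le> (e/n)^A, which is the source of the n^A that compensates the powers of L.\<close>

lemma power_le_exp_fact_ratio:
  assumes "A \<ge> 1"
  shows "real (A + N) ^ A * fact N \<le> exp (real A) * fact (A + N)"
proof -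
  let ?n = "A + N"
  have pow: "real ?n ^ A = (real ?n / real A) ^ A * real A ^ A"
    using assms by (simp flip: power_mult_distrib)
  have "(real ?n / real A) ^ A \<le> real (?n choose A)"
    by (rule binomial_ge_n_over_k_pow_k) simp
  moreover have "real A ^ A \<le> exp (real A) * fact A" by (rule power_self_le_exp_fact)
  ultimately have "real ?n ^ A \<le> real (?n choose A) * (exp (real A) * fact A)"
    unfolding pow by (intro mult_mono) auto
  then have "real ?n ^ A * fact N \<le> real (?n choose A) * (exp (real A) * fact A) * fact N"
    by (rule mult_right_mono) simp
  also have "\<dots> = exp (real A) * (fact A * fact N * real (?n choose A))" by simp
  also have "fact A * fact N * real (?n choose A) = fact ?n"
    using binomial_fact_lemma[of A ?n] by (metis add_diff_cancel_left' le_add1 of_nat_fact of_nat_mult)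
  finally show ?thesis .
qed

lemma fact_le_power_mult_fact:
  assumes "i \<le> g" "g \<le> L"
  shows "(fact g :: real) \<le> real L ^ (g - i) * fact i"
  using assms
proof (induction g rule: dec_induct)
  case (step g)
  have "(fact (Suc g) :: real) = real (Suc g) * fact g" by simp
  also have "\<dots> \<le> real L * (real L ^ (g - i) * fact i)"
    by (rule mult_mono) (use step in auto)
  also have "\<dots> = real L ^ (Suc g - i) * fact i" using step by (simp add: Suc_diff_le)
  finally show ?case .
qed simp

text \<open>The rim hook estimate applied to A unit parts, that is, to the character at the
  identity, bounds the number of standard tableaux by sqrt(2A)^A. The degree formula translates this
  into a bound for the Vandermonde determinant, and the factorials of \<gamma> exceed those of 0,
  ..., l - 1 by A factors of size at most L.\<close>

lemma vander_le:
  fixes \<gamma> :: "nat \<Rightarrow> nat"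
  assumes "\<And>i j. i < j \<Longrightarrow> j < l \<Longrightarrow> \<gamma> i < \<gamma> j" "\<And>i. i < l \<Longrightarrow> \<gamma> i \<le> L"
    and "(\<Sum>i<l. \<gamma> i) = A + (\<Sum>i<l. i)"
  shows "vander l (\<lambda>i. real (\<gamma> i)) \<le> sqrt (2 * real A) ^ A * real L ^ A * (\<Prod>i<l. fact i) / fact A"
proof -
  let ?P = "\<Prod>i<l. (fact (\<gamma> i) :: real)"
  have ge: "i \<le> \<gamma> i" if "i < l" for i
    using that
  proof (induction i)
    case (Suc i)
    then show ?case using assms(1)[of i "Suc i"] by simp
  qed simp
  have P: "?P > 0" by (intro prod_pos) simp
  have "\<bar>real_of_int (frob l {0..<A} (\<lambda>_. 1) (\<lambda>i. int (\<gamma> i)))\<bar> \<le> sqrt (2 * real A) ^ card {0..<A}"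
    by (rule abs_frob_le) (use assms(3) in \<open>auto simp flip: of_nat_sum\<close>)
  moreover have "real_of_int (frob l {0..<A} (\<lambda>_. 1) (\<lambda>i. int (\<gamma> i))) =
      fact A * (vander l (\<lambda>i. real (\<gamma> i)) / ?P)"
    using frob_units[of "{0..<A}" "\<lambda>_. 1" \<gamma> l] assms(3) by simp
  ultimately have "fact A * (vander l (\<lambda>i. real (\<gamma> i)) / ?P) \<le> sqrt (2 * real A) ^ A"
    by (simp add: abs_le_iff)
  then have "vander l (\<lambda>i. real (\<gamma> i)) \<le> sqrt (2 * real A) ^ A / fact A * ?P"
    using P by (simp add: field_simps)
  moreover have "?P \<le> real L ^ A * (\<Prod>i<l. fact i)"
  proof -
    have "?P \<le> (\<Prod>i<l. real L ^ (\<gamma> i - i) * fact i)"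
      by (intro prod_mono conjI fact_le_power_mult_fact) (use ge assms(2) in auto)
    also have "\<dots> = real L ^ (\<Sum>i<l. \<gamma> i - i) * (\<Prod>i<l. fact i)"
      by (simp add: prod.distrib power_sum)
    also have "(\<Sum>i<l. \<gamma> i - i) = A"
    proof -
      have "(\<Sum>i<l. \<gamma> i - i) + (\<Sum>i<l. i) = (\<Sum>i<l. \<gamma> i)"
        unfolding sum.distrib[symmetric] by (intro sum.cong refl) (simp add: ge)
      then show ?thesis using assms(3) by simp
    qed
    finally show ?thesis .
  qed
  then have "sqrt (2 * real A) ^ A / fact A * ?P \<le> sqrt (2 * real A) ^ A / fact A * (real L ^ A * (\<Prod>i<l. fact i))"
    by (rule mult_left_mono) simp
  ultimately show ?thesis by simp
qed

text \<open>Per moved point, with u = (2A)^(1/4), the factors are: 2 for the number of beta-sets, u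
  for the character values on the long cycles, u^2 for the degree of the smaller partition, L once
  from the determinant and once from its factorials, and e^2 / (n A) from the ratio of factorials.
  As 1/A = 2/u^4, they combine to 4 e^2 L^2 / (n u). The first factor on the right is the degree of
  the ambient character.\<close>

lemma frob_ratio_bound:
  fixes \<beta> :: "nat \<Rightarrow> nat"
  assumes fin: "finite C0" "finite C1" "C0 \<inter> C1 = {}"
    and sz: "\<And>X. X \<in> C0 \<Longrightarrow> sz X = 1" "\<And>X. X \<in> C1 \<Longrightarrow> sz X \<ge> 2"
    and A: "A = (\<Sum>X\<in>C1. sz X)" "A \<ge> 1"
    and \<beta>: "\<And>i j. i < j \<Longrightarrow> j < l \<Longrightarrow> \<beta> i < \<beta> j" "\<And>i. i < l \<Longrightarrow> \<beta> i \<le> L" "L > 0"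
    and n: "n = A + card C0" "(\<Sum>i<l. \<beta> i) = n + (\<Sum>i<l. i)"
  shows "\<bar>real_of_int (frob l (C0 \<union> C1) sz (\<lambda>i. int (\<beta> i)))\<bar> \<le>
    fact n * (vander l (\<lambda>i. real (\<beta> i)) / (\<Prod>i<l. fact (\<beta> i))) *
    (4 * exp 2 * (real L)\<^sup>2 / (real n * sqrt (sqrt (2 * real A)))) ^ A"
proof -
  define u where "u = sqrt (sqrt (2 * real A))"
  define V where "V = vander l (\<lambda>i. real (\<beta> i))"
  define P where "P = (\<Prod>i<l. (fact (\<beta> i) :: real))"
  define S where "S = A + (\<Sum>i<l. i)"
  let ?N = "card C0"
  have u2: "sqrt (2 * real A) = u\<^sup>2" by (simp add: u_def)
  have "u ^ 4 = (u\<^sup>2)\<^sup>2" by simp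
  also have "\<dots> = 2 * real A" unfolding u2[symmetric] by simp
  finally have u4: "u ^ 4 = 2 * real A" .
  have u1: "u \<ge> 1" using A(2) by (simp add: u_def)
  have V: "V > 0" unfolding V_def by (rule vander_pos) (simp add: \<beta>(1))
  have P: "P > 0" unfolding P_def by (rule prod_pos) simp
  have bound: "\<bar>real_of_int (frob l C1 sz (\<lambda>i. int (enum X i))) *
      ldet l (\<lambda>i j. falling (real (\<beta> i)) (enum X j))\<bar> \<le>
      u ^ A * (real L ^ A * V * (u ^ (2 * A) * real L ^ A / fact A))"
    if X: "X \<in> beta_sets l L S" for X
  proof -
    have X': "finite X" "card X = l" "\<Sum> X = S" "X \<subseteq> {0..L}"
      using X by (auto simp: beta_sets_def intro: finite_subset)
    have en: "enum X i < enum X j" if "i < j" "j < l" for i j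
      using enum_less[OF X'(1)] X'(2) that by simp
    have enL: "enum X i \<le> L" if "i < l" for i
      using bij_betwE[OF bij_betw_enum[OF X'(1)]] X'(2,4) that by fastforce
    have enS: "(\<Sum>i<l. enum X i) = S" using sum_enum[OF X'(1), of "\<lambda>x. x"] X' by simp
    \<comment> \<open>Cycles in C1 have length at least 2, so there are at most A/2 of them, each
      contributing u^2.\<close>
    have "2 * card C1 \<le> A"
      using sum_mono[of C1 "\<lambda>_. 2" sz] sz(2) A(1) by simp
    then have "sqrt (2 * real A) ^ card C1 \<le> u ^ A"
      unfolding u2 power_mult[symmetric] by (rule power_increasing[OF _ u1])
    moreover have "\<bar>real_of_int (frob l C1 sz (\<lambda>i. int (enum X i)))\<bar> \<le> sqrt (2 * real A) ^ card C1"
      by (rule abs_frob_le) (use fin sz(2) enS S_def in \<open>force simp flip: of_nat_sum\<close>)+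
    ultimately have f: "\<bar>real_of_int (frob l C1 sz (\<lambda>i. int (enum X i)))\<bar> \<le> u ^ A" by linarith
    let ?D = "\<bar>ldet l (\<lambda>i j. falling (real (\<beta> i)) (enum X j))\<bar>"
    let ?F = "(\<Prod>m<l. fact m) :: real" and ?E = "vander l (\<lambda>i. real (enum X i))"
    have "?D * ?F * real L ^ (\<Sum>m<l. m) \<le> real L ^ (\<Sum>j<l. enum X j) * V * ?E"
      unfolding V_def by (rule ldet_falling_bound) (use \<beta> en enL in auto)
    also have "\<dots> = real L ^ A * V * ?E * real L ^ (\<Sum>m<l. m)"
      by (simp add: enS S_def power_add)
    finally have "?D * ?F \<le> real L ^ A * V * ?E" using \<beta>(3) by simp
    moreover have F: "?F > 0" by (rule prod_pos) simp
    ultimately have "?D \<le> real L ^ A * V * (?E / ?F)" by (simp add: field_simps)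
    also have "\<dots> \<le> real L ^ A * V * (u ^ (2 * A) * real L ^ A / fact A)"
    proof (rule mult_left_mono)
      have "?E \<le> sqrt (2 * real A) ^ A * real L ^ A * ?F / fact A"
        by (rule vander_le) (use en enL enS in \<open>auto simp: S_def\<close>)
      then show "?E / ?F \<le> u ^ (2 * A) * real L ^ A / fact A"
        using F unfolding u2 by (simp add: field_simps power_mult power2_eq_square power_mult_distrib)
    qed (use V in auto)
    finally show ?thesis unfolding abs_mult using f by (intro mult_mono) auto
  qed
  have "\<bar>real_of_int (frob l (C0 \<union> C1) sz (\<lambda>i. int (\<beta> i)))\<bar> =
      fact ?N / P * \<bar>\<Sum>X\<in>beta_sets l L S. real_of_int (frob l C1 sz (\<lambda>i. int (enum X i))) *
      ldet l (\<lambda>i j. falling (real (\<beta> i)) (enum X j))\<bar>"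
    using P unfolding P_def
    by (subst frob_expansion[where S = S and L = L]) (use fin sz(1) \<beta> n in \<open>auto simp: S_def abs_mult\<close>)
  also have "\<dots> \<le> fact ?N / P * (\<Sum>X\<in>beta_sets l L S.
      u ^ A * (real L ^ A * V * (u ^ (2 * A) * real L ^ A / fact A)))"
    using P by (intro mult_left_mono order_trans[OF sum_abs] sum_mono bound) auto
  also have "\<dots> = fact ?N / P * (real (card (beta_sets l L S)) *
      (u ^ A * (real L ^ A * V * (u ^ (2 * A) * real L ^ A / fact A))))" by simp
  also have "\<dots> \<le> fact ?N / P * (2 ^ A * (u ^ A * (real L ^ A * V * (u ^ (2 * A) * real L ^ A / fact A))))"
  proof (intro mult_left_mono mult_right_mono)
    show "real (card (beta_sets l L S)) \<le> 2 ^ A"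
      using card_beta_sets[of l L A] unfolding S_def by (metis of_nat_le_iff of_nat_numeral of_nat_power)
  qed (use P V u1 in auto)
  also have "\<dots> = (V / P) * (2 * u ^ 3 * (real L)\<^sup>2) ^ A * (fact ?N / fact A)"
  proof -
    have "A + 2 * A = 3 * A" "A + A = 2 * A" by simp_all
    then have "(2 * u ^ 3 * (real L)\<^sup>2) ^ A = 2 ^ A * (u ^ A * u ^ (2 * A)) * (real L ^ A * real L ^ A)"
      unfolding power_mult_distrib power_mult[symmetric] power_add[symmetric] by (simp only:)
    then show ?thesis by (simp only: divide_inverse mult_ac)
  qed
  also have "\<dots> \<le> (V / P) * (2 * u ^ 3 * (real L)\<^sup>2) ^ A * (fact n * (exp 2 / (real n * real A)) ^ A)"
  proof (rule mult_left_mono)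
    have nA: "real n ^ A * fact ?N \<le> exp (real A) * fact n"
      using power_le_exp_fact_ratio[OF A(2), of ?N] by (simp add: n(1))
    have "real n ^ A * fact ?N * real A ^ A \<le> (exp (real A) * fact n) * (exp (real A) * fact A)"
      by (intro mult_mono nA power_self_le_exp_fact) auto
    also have "exp (real A) * fact n * (exp (real A) * fact A) =
        (exp (real A) * exp (real A)) * fact n * fact A" by (simp only: mult_ac)
    also have "exp (real A) * exp (real A) = exp 2 ^ A"
      by (simp flip: exp_add exp_of_nat_mult)
    finally have "real n ^ A * fact ?N * real A ^ A \<le> exp 2 ^ A * fact n * fact A" .
    moreover have "real n ^ A * real A ^ A > 0" using A(2) n(1) by simp
    ultimately show "fact ?N / fact A \<le> fact n * (exp 2 / (real n * real A)) ^ A"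
      by (simp add: power_divide power_mult_distrib field_simps)
  qed (use V P u1 in auto)
  also have "\<dots> = fact n * (V / P) * (2 * u ^ 3 * (real L)\<^sup>2 * (exp 2 / (real n * real A))) ^ A"
    unfolding power_mult_distrib by (simp only: mult_ac)
  \<comment> \<open>Replacing A by u^4 / 2 cancels u^3 and doubles the constant.\<close>
  also have "2 * u ^ 3 * (real L)\<^sup>2 * (exp 2 / (real n * real A)) = 4 * exp 2 * (real L)\<^sup>2 / (real n * u)"
  proof -
    have "u ^ 4 = u ^ 3 * u" by (simp add: eval_nat_numeral)
    then have A_eq: "real A = u ^ 3 * u / 2" using u4 by simp
    show ?thesis unfolding A_eq using u1 by (simp add: field_simps)
  qed
  finally show ?thesis by (simp only: u_def V_def P_def)
qed

section \<open>Standard Young tableaux\<close>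

text \<open>Phrased for an arbitrary set of cells, so that deleting a corner stays within the
  definition.\<close>

definition tableaux :: "(nat \<times> nat) set \<Rightarrow> (nat \<times> nat \<Rightarrow> nat) set" where
  "tableaux D = {T \<in> D \<rightarrow>\<^sub>E {1..card D}. bij_betw T D {1..card D} \<and>
      (\<forall>i j. (i, Suc j) \<in> D \<longrightarrow> T (i, j) < T (i, Suc j)) \<and>
      (\<forall>i j. (Suc i, j) \<in> D \<longrightarrow> T (i, j) < T (Suc i, j))}"

lemma finite_tableaux: "finite D \<Longrightarrow> finite (tableaux D)"
  unfolding tableaux_def by (rule finite_subset[of _ "D \<rightarrow>\<^sub>E {1..card D}"]) (auto intro: finite_PiE)

definition corners :: "(nat \<times> nat) set \<Rightarrow> (nat \<times> nat) set" where
  "corners D = {(i, j) \<in> D. (i, Suc j) \<notin> D \<and> (Suc i, j) \<notin> D}"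

text \<open>The largest entry stands in a corner, and deleting it leaves a standard filling of the
  remaining cells; conversely it can be put back into any corner. Deleted cells are reset to
  \<open>undefined\<close> to keep fillings extensional.\<close>

lemma card_tableaux_rec:
  assumes fin: "finite D" and ne: "D \<noteq> {}"
    and down: "\<And>i j. (i, Suc j) \<in> D \<Longrightarrow> (i, j) \<in> D" "\<And>i j. (Suc i, j) \<in> D \<Longrightarrow> (i, j) \<in> D"
  shows "card (tableaux D) = (\<Sum>x\<in>corners D. card (tableaux (D - {x})))"
proof -
  let ?n = "card D"
  let ?S = "SIGMA x:corners D. tableaux (D - {x})"
  let ?pos = "\<lambda>T. the_inv_into D T ?n"
  have n: "?n \<ge> 1" using fin ne by (simp add: Suc_le_eq card_gt_0_iff)
  have cornD: "corners D \<subseteq> D" by (auto simp: corners_def)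
  have range_split: "{1..?n} = insert ?n {1..?n - 1}" using n by auto
  have "bij_betw (\<lambda>T. (?pos T, T(?pos T := undefined))) (tableaux D) ?S"
  proof (rule bij_betw_byWitness[where f' = "\<lambda>(x, T). T(x := ?n)"])
    have pos: "?pos T \<in> D" "T (?pos T) = ?n" if "T \<in> tableaux D" for T
    proof -
      have "bij_betw T D {1..?n}" using that by (simp add: tableaux_def)
      moreover have "?n \<in> {1..?n}" using n by simp
      ultimately show "?pos T \<in> D" "T (?pos T) = ?n"
        by (auto simp: bij_betw_def the_inv_into_into f_the_inv_into_f)
    qed
    show "\<forall>T\<in>tableaux D. (case (?pos T, T(?pos T := undefined)) of (x, T) \<Rightarrow> T(x := ?n)) = T"
      using pos by (simp add: fun_upd_idem_iff)
    show "(\<lambda>T. (?pos T, T(?pos T := undefined))) ` tableaux D \<subseteq> ?S"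
    proof (rule image_subsetI)
      fix T assume T: "T \<in> tableaux D"
      define x where "x = ?pos T"
      have x: "x \<in> D" "T x = ?n" using pos[OF T] by (auto simp: x_def)
      have bij: "bij_betw T D {1..?n}" using T by (simp add: tableaux_def)
      have le: "T y \<le> ?n" if "y \<in> D" for y using bij_betwE[OF bij] that by auto
      have row: "T (i, j) < T (i, Suc j)" if "(i, Suc j) \<in> D" for i j using T that by (simp add: tableaux_def)
      have colm: "T (i, j) < T (Suc i, j)" if "(Suc i, j) \<in> D" for i j using T that by (simp add: tableaux_def)
      have corner: "(fst x, Suc (snd x)) \<notin> D" "(Suc (fst x), snd x) \<notin> D"
        using row[of "fst x" "snd x"] colm[of "fst x" "snd x"]
          le[of "(fst x, Suc (snd x))"] le[of "(Suc (fst x), snd x)"] x by auto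
      have "bij_betw T (D - {x}) ({1..?n} - {?n})"
        using bij x inj_on_image_set_diff[of T D D "{x}"] by (intro bij_betw_subset[OF bij]) (auto simp: bij_betw_def)
      moreover have "{1..?n} - {?n} = {1..?n - 1}" using n by auto
      ultimately have "bij_betw T (D - {x}) {1..?n - 1}" by simp
      then have b: "bij_betw (T(x := undefined)) (D - {x}) {1..?n - 1}"
        by (rule bij_betw_cong[THEN iffD1, rotated]) auto
      have "T(x := undefined) \<in> tableaux (D - {x})"
        unfolding tableaux_def card_Diff_singleton[OF x(1)]
      proof (intro CollectI conjI allI impI)
        show "T(x := undefined) \<in> (D - {x}) \<rightarrow>\<^sub>E {1..?n - 1}"
          using bij_betwE[OF b] T by (auto simp: tableaux_def PiE_def extensional_def)
      qed (use b row colm corner in auto)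
      moreover have "x \<in> corners D" using x(1) corner by (auto simp: corners_def)
      ultimately show "(?pos T, T(?pos T := undefined)) \<in> ?S"
        unfolding x_def by (rule SigmaI[rotated])
    qed
    have extend: "T(x := ?n) \<in> tableaux D" "T x = undefined" if "x \<in> corners D" "T \<in> tableaux (D - {x})" for x T
    proof -
      have xD: "x \<in> D" using that cornD by auto
      have cd: "card (D - {x}) = ?n - 1" by (rule card_Diff_singleton[OF xD])
      have bij: "bij_betw T (D - {x}) {1..?n - 1}" using that(2) by (simp add: tableaux_def cd)
      have le: "T y < ?n" if "y \<in> D" "y \<noteq> x" for y
      proof -
        have "T y \<in> {1..?n - 1}" using bij_betwE[OF bij] that by blast
        then show ?thesis using n by auto
      qed
      have ext: "T y = undefined" if "y \<notin> D - {x}" for y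
      proof (rule PiE_arb[OF _ that])
        show "T \<in> (D - {x}) \<rightarrow>\<^sub>E {1..card (D - {x})}"
          using \<open>T \<in> tableaux (D - {x})\<close> unfolding tableaux_def by blast
      qed
      show "T x = undefined" by (rule ext) simp
      have row: "T (i, j) < T (i, Suc j)" if "(i, Suc j) \<in> D - {x}" for i j
        using \<open>T \<in> tableaux (D - {x})\<close> that unfolding tableaux_def by blast
      have colm: "T (i, j) < T (Suc i, j)" if "(Suc i, j) \<in> D - {x}" for i j
        using \<open>T \<in> tableaux (D - {x})\<close> that unfolding tableaux_def by blast
      have corner: "(i, j) = x \<Longrightarrow> (i, Suc j) \<notin> D" "(i, j) = x \<Longrightarrow> (Suc i, j) \<notin> D" for i j
        using that(1) by (auto simp: corners_def)
      have "bij_betw (T(x := ?n)) (D - {x}) {1..?n - 1}"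
        using bij by (rule bij_betw_cong[THEN iffD1, rotated]) auto
      moreover have "x \<notin> D - {x}" "(T(x := ?n)) x \<notin> {1..?n - 1}" using n by auto
      ultimately have "bij_betw (T(x := ?n)) ((D - {x}) \<union> {x}) ({1..?n - 1} \<union> {(T(x := ?n)) x})"
        by (subst notIn_Un_bij_betw3[symmetric]) auto
      moreover have "(D - {x}) \<union> {x} = D" using xD by auto
      moreover have "{1..?n - 1} \<union> {(T(x := ?n)) x} = {1..?n}" using n by auto
      ultimately have b: "bij_betw (T(x := ?n)) D {1..?n}" by simp
      show "T(x := ?n) \<in> tableaux D"
        unfolding tableaux_def
      proof (intro CollectI conjI allI impI)
        show "T(x := ?n) \<in> D \<rightarrow>\<^sub>E {1..?n}"
        proof (rule PiE_I)
          show "(T(x := ?n)) y = undefined" if "y \<notin> D" for y using ext[of y] xD that by auto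
        qed (use bij_betwE[OF b] in blast)
        show "(T(x := ?n)) (i, j) < (T(x := ?n)) (i, Suc j)" if "(i, Suc j) \<in> D" for i j
          using that down(1)[OF that] corner[of i j] row[of i j] le[of "(i, j)"] by auto
        show "(T(x := ?n)) (i, j) < (T(x := ?n)) (Suc i, j)" if "(Suc i, j) \<in> D" for i j
          using that down(2)[OF that] corner[of i j] colm[of i j] le[of "(i, j)"] by auto
      qed (rule b)
    qed
    then show "(\<lambda>(x, T). T(x := ?n)) ` ?S \<subseteq> tableaux D" by auto
    show "\<forall>p\<in>?S. (?pos (case p of (x, T) \<Rightarrow> T(x := ?n)),
        (case p of (x, T) \<Rightarrow> T(x := ?n))(?pos (case p of (x, T) \<Rightarrow> T(x := ?n)) := undefined)) = p"
    proof
      fix p assume "p \<in> ?S"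
      then obtain x T where p: "p = (x, T)" and xT: "x \<in> corners D" "T \<in> tableaux (D - {x})" by auto
      have "inj_on (T(x := ?n)) D" using extend(1)[OF xT] by (simp add: tableaux_def bij_betw_def)
      then have "?pos (T(x := ?n)) = x"
        using xT(1) cornD by (intro the_inv_into_f_eq) auto
      moreover have "T(x := undefined) = T" using extend(2)[OF xT] by (simp add: fun_upd_idem_iff)
      ultimately show "(?pos (case p of (x, T) \<Rightarrow> T(x := ?n)),
        (case p of (x, T) \<Rightarrow> T(x := ?n))(?pos (case p of (x, T) \<Rightarrow> T(x := ?n)) := undefined)) = p"
        by (simp add: p)
    qed
  qed
  then have "card (tableaux D) = card ?S" by (rule bij_betw_same_card)
  also have "\<dots> = (\<Sum>x\<in>corners D. card (tableaux (D - {x})))"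
    using fin cornD by (intro card_SigmaI) (auto intro: finite_subset finite_tableaux)
  finally show ?thesis .
qed

text \<open>Both sides obey the same branching recursion: deleting a corner is lowering one
  beta-number by 1. Rows are indexed from the top and exponents from the smallest, whence the
  reflection of indices.\<close>

lemma card_tableaux_eq_frob:
  fixes \<nu> :: "nat \<Rightarrow> nat"
  assumes "\<And>i. Suc i < l \<Longrightarrow> \<nu> (Suc i) \<le> \<nu> i" "(\<Sum>i<l. \<nu> i) = n"
  shows "int (card (tableaux (SIGMA i:{..<l}. {..<\<nu> i}))) =
    frob l {0..<n} (\<lambda>_. 1) (\<lambda>i. int (\<nu> (l - 1 - i)) + int i)"
  using assms
proof (induction n arbitrary: \<nu>)
  case 0
  have "frob l {0..<0::nat} (\<lambda>_. 1) (\<lambda>i. int (\<nu> (l - 1 - i)) + int i) = frob l {0..<0::nat} (\<lambda>_. 1) int"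
    by (rule frob_cong) (use 0 in auto)
  also have "\<dots> = frob l {} (\<lambda>_::nat. 1) int" by simp
  also have "\<dots> = (\<Sum>w\<in>{w. w permutes {0..<l}}. if w = id then 1 else 0)"
    unfolding frob_empty
  proof (intro sum.cong refl)
    fix w assume "w \<in> {w. w permutes {0..<l}}"
    then have "w i = i" if "\<not> i < l" for i using that by (auto simp: permutes_def)
    then have "(\<forall>i<l. int i = int (w i)) \<longleftrightarrow> w = id"
      unfolding fun_eq_iff of_nat_eq_iff id_apply by metis
    then show "(if \<forall>i<l. int i = int (w i) then sign w else 0) = (if w = id then 1 else 0)" by auto
  qed
  also have "\<dots> = 1" by (simp add: sum.delta finite_permutations permutes_id)
  finally have "frob l {0..<0::nat} (\<lambda>_. 1) (\<lambda>i. int (\<nu> (l - 1 - i)) + int i) = 1" .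
  moreover have "(SIGMA i:{..<l}. {..<\<nu> i}) = {}" using 0 by auto
  moreover have "tableaux {} = {\<lambda>_. undefined}" by (auto simp: tableaux_def bij_betw_def)
  ultimately show ?case by (simp only: card_1_singleton_iff) simp
next
  case (Suc n)
  let ?D = "\<lambda>\<nu>. SIGMA i:{..<l}. {..<(\<nu> i :: nat)}"
  let ?b = "\<lambda>\<nu> i. int (\<nu> (l - 1 - i)) + int i"
  let ?I = "{i\<in>{..<l}. \<nu> i > 0 \<and> (Suc i < l \<longrightarrow> \<nu> (Suc i) < \<nu> i)}"
  have corn: "corners (?D \<nu>) = (\<lambda>i. (i, \<nu> i - 1)) ` ?I"
  proof (intro equalityI subsetI)
    fix x assume x: "x \<in> corners (?D \<nu>)"
    obtain i j where ij: "x = (i, j)" by (cases x)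
    have c: "i < l" "j < \<nu> i" "\<not> Suc j < \<nu> i" "\<not> (Suc i < l \<and> j < \<nu> (Suc i))"
      using x by (auto simp: corners_def ij)
    then have "j = \<nu> i - 1" "i \<in> ?I" by auto
    then show "x \<in> (\<lambda>i. (i, \<nu> i - 1)) ` ?I" by (auto simp: ij)
  qed (auto simp: corners_def)
  have "int (card (tableaux (?D \<nu>))) = (\<Sum>x\<in>corners (?D \<nu>). int (card (tableaux (?D \<nu> - {x}))))"
  proof (subst card_tableaux_rec)
    show "?D \<nu> \<noteq> {}"
    proof
      assume "?D \<nu> = {}"
      then have "\<forall>i<l. \<nu> i = 0" by auto
      then show False using Suc.prems(2) by simp
    qed
    show "(i, j) \<in> ?D \<nu>" if "(Suc i, j) \<in> ?D \<nu>" for i j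
      using that Suc.prems(1)[of i] by auto
  qed auto
  also have "\<dots> = (\<Sum>i\<in>?I. int (card (tableaux (?D \<nu> - {(i, \<nu> i - 1)}))))"
    unfolding corn by (subst sum.reindex) (auto simp: inj_on_def)
  also have "\<dots> = (\<Sum>i\<in>?I. frob l {0..<n} (\<lambda>_. 1) ((?b \<nu>)(l - 1 - i := ?b \<nu> (l - 1 - i) - 1)))"
  proof (intro sum.cong refl)
    fix i assume i: "i \<in> ?I"
    let ?\<nu> = "\<nu>(i := \<nu> i - 1)"
    have "?D \<nu> - {(i, \<nu> i - 1)} = ?D ?\<nu>" by (auto split: if_splits)
    moreover have "int (card (tableaux (?D ?\<nu>))) = frob l {0..<n} (\<lambda>_. 1) (?b ?\<nu>)"
    proof (rule Suc.IH)
      show "?\<nu> (Suc k) \<le> ?\<nu> k" if "Suc k < l" for k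
        using Suc.prems(1)[OF that] i that by auto
      have "(\<Sum>k<l. ?\<nu> k) + 1 = (\<Sum>k<l. \<nu> k)"
        using i by (subst (1 2) sum.remove[of _ i]) (auto intro!: sum.cong)
      then show "(\<Sum>k<l. ?\<nu> k) = n" using Suc.prems(2) by simp
    qed
    moreover have "frob l {0..<n} (\<lambda>_. 1) (?b ?\<nu>) =
        frob l {0..<n} (\<lambda>_. 1) ((?b \<nu>)(l - 1 - i := ?b \<nu> (l - 1 - i) - 1))"
      by (rule frob_cong) (use i in auto)
    ultimately show "int (card (tableaux (?D \<nu> - {(i, \<nu> i - 1)}))) =
        frob l {0..<n} (\<lambda>_. 1) ((?b \<nu>)(l - 1 - i := ?b \<nu> (l - 1 - i) - 1))" by simp
  qed
  also have "\<dots> = (\<Sum>i<l. frob l {0..<n} (\<lambda>_. 1) ((?b \<nu>)(l - 1 - i := ?b \<nu> (l - 1 - i) - 1)))"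
  proof (rule sum.mono_neutral_left)
    \<comment> \<open>Rows without a corner contribute nothing: lowering a row equal to the next one
      makes two exponents coincide, and lowering an empty last row makes the exponent at index 0
      equal to -1.\<close>
    show "\<forall>i\<in>{..<l} - ?I. frob l {0..<n} (\<lambda>_. 1) ((?b \<nu>)(l - 1 - i := ?b \<nu> (l - 1 - i) - 1)) = 0"
    proof
      fix i assume i: "i \<in> {..<l} - ?I"
      let ?c = "(?b \<nu>)(l - 1 - i := ?b \<nu> (l - 1 - i) - 1)"
      show "frob l {0..<n} (\<lambda>_. 1) ?c = 0"
      proof (cases "Suc i < l")
        case True
        then have "\<nu> (Suc i) = \<nu> i" using i Suc.prems(1)[OF True] by auto
        moreover have "l - 1 - (l - 1 - i - 1) = Suc i" "l - 1 - (l - 1 - i) = i" using True by auto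
        ultimately have "?c (l - 1 - i) = ?c (l - 1 - i - 1)" using True by simp
        then show ?thesis
          by (intro frob_eq_0_repeat[of _ "l - 1 - i" l "l - 1 - i - 1"]) (use True in auto)
      next
        case False
        then have "\<nu> i = 0" "l - 1 - i = 0" "l - 1 = i" using i by auto
        then show ?thesis by (intro frob_eq_0_neg[of _ 0]) (use i in auto)
      qed
    qed
  qed auto
  also have "\<dots> = (\<Sum>i<l. frob l {0..<n} (\<lambda>_. 1) ((?b \<nu>)(i := ?b \<nu> i - 1)))"
    by (rule sum.reindex_bij_witness[of _ "\<lambda>i. l - 1 - i" "\<lambda>i. l - 1 - i"]) auto
  also have "\<dots> = frob l {0..<Suc n} (\<lambda>_. 1) (?b \<nu>)"
    using frob_insert[of "{0..<n}" n l "\<lambda>_. 1" "?b \<nu>"] by (simp add: atLeast0_lessThan_Suc)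
  finally show ?case .
qed

section \<open>Irreducible characters\<close>

lemma frob_image:
  assumes "finite C" "inj_on \<phi> C" "\<And>X. X \<in> C \<Longrightarrow> sz' (\<phi> X) = sz X"
  shows "frob l (\<phi> ` C) sz' b = frob l C sz b"
  using assms
proof (induction C arbitrary: b)
  case empty
  then show ?case by (simp add: frob_empty)
next
  case (insert X C)
  then show ?case by (simp add: frob_insert)
qed

text \<open>Reversing the order of the variables turns the decreasing staircase into the increasing
  one. The reversal is applied both to the summation permutation and to the exponents, so its sign
  appears twice and cancels.\<close>

lemma irr_char_eq_frob:
  assumes "finite (cycles_of n \<sigma>)"
  shows "irr_char \<nu> n \<sigma> = frob (length \<nu>) (cycles_of n \<sigma>) card
    (\<lambda>i. int (\<nu> ! (length \<nu> - 1 - i)) + int i)"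
proof -
  define l where "l = length \<nu>"
  define C where "C = cycles_of n \<sigma>"
  define r where "r i = (if i < l then l - 1 - i else i)" for i
  define b where "b i = int (\<nu> ! i) + int (l - 1 - i)" for i
  have r: "r permutes {0..<l}"
    by (rule bij_imp_permutes, rule bij_betw_byWitness[where f' = r]) (auto simp: r_def)
  have sr: "sign r * sign r = 1" by (simp add: sign_def)
  have "irr_char \<nu> n \<sigma> = (\<Sum>w\<in>{w. w permutes {0..<l}}.
      sign w * int (card (colourings l C card (\<lambda>i. b i - int (l - 1 - w i)))))"
    by (simp add: irr_char_def Let_def l_def C_def b_def colourings_def)
  also have "\<dots> = (\<Sum>w\<in>{w. w permutes {0..<l}}.
      sign (r \<circ> w) * int (card (colourings l C card (\<lambda>i. b i - int (l - 1 - (r \<circ> w) i)))))"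
    by (rule setum_permutations_compose_left[OF r])
  also have "\<dots> = (\<Sum>w\<in>{w. w permutes {0..<l}}.
      sign r * (sign w * int (card (colourings l C card (\<lambda>i. b i - int (w i))))))"
  proof (intro sum.cong refl)
    fix w assume "w \<in> {w. w permutes {0..<l}}"
    then have w: "w permutes {0..<l}" by simp
    have "colourings l C card (\<lambda>i. b i - int (l - 1 - (r \<circ> w) i)) = colourings l C card (\<lambda>i. b i - int (w i))"
    proof (rule colourings_cong)
      fix i assume "i < l"
      then have "w i < l" by (rule permutes_less[OF w])
      then have "l - 1 - (r \<circ> w) i = w i" by (simp add: r_def)
      then show "b i - int (l - 1 - (r \<circ> w) i) = b i - int (w i)" by (simp only:)
    qed
    moreover have "sign (r \<circ> w) = sign r * sign w"
      using w r by (subst sign_compose) (auto intro: permutation_permutes[THEN iffD2])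
    ultimately show "sign (r \<circ> w) * int (card (colourings l C card (\<lambda>i. b i - int (l - 1 - (r \<circ> w) i)))) =
        sign r * (sign w * int (card (colourings l C card (\<lambda>i. b i - int (w i)))))" by simp
  qed
  also have "\<dots> = sign r * frob l C card b" by (simp add: frob_def sum_distrib_left)
  also have "\<dots> = frob l C card (b \<circ> r)"
    using frob_permute[OF _ r, of C card b] assms by (simp add: C_def)
  also have "\<dots> = frob l C card (\<lambda>i. int (\<nu> ! (l - 1 - i)) + int i)"
    by (rule frob_cong) (simp add: b_def r_def)
  finally show ?thesis by (simp only: l_def C_def)
qed

section \<open>Cycles as orbits; fixed points and conjugation\<close>

lemma cycles_of_eq_orbits:
  assumes "\<sigma> permutes {0..<n}"
  shows "cycles_of n \<sigma> = orbit \<sigma> ` {0..<n}"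
proof -
  have "permutation \<sigma>" using assms by (auto simp: permutation_permutes)
  then show ?thesis by (simp add: cycles_of_def orbit_altdef_permutation)
qed

lemma cycles_of_partition:
  assumes "\<sigma> permutes {0..<n}"
  shows "\<Union> (cycles_of n \<sigma>) = {0..<n}" "disjoint (cycles_of n \<sigma>)"
proof -
  have perm: "permutation \<sigma>" using assms by (auto simp: permutation_permutes)
  show "\<Union> (cycles_of n \<sigma>) = {0..<n}"
    unfolding cycles_of_eq_orbits[OF assms]
    using permutes_orbit_subset[OF assms] permutation_self_in_orbit[OF perm] by fastforce
  show "disjoint (cycles_of n \<sigma>)"
    unfolding cycles_of_eq_orbits[OF assms] disjoint_def
  proof (intro ballI impI)
    fix X Y assume "X \<in> orbit \<sigma> ` {0..<n}" "Y \<in> orbit \<sigma> ` {0..<n}" "X \<noteq> Y"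
    then have "cyclic_on \<sigma> X" "cyclic_on \<sigma> Y" using cyclic_on_orbit'[OF perm] by auto
    then show "X \<inter> Y = {}" using \<open>X \<noteq> Y\<close> by (metis disjoint_iff orbit_cyclic_eq3)
  qed
qed

lemma sum_card_cycles_of:
  assumes "\<sigma> permutes {0..<n}"
  shows "(\<Sum>X\<in>cycles_of n \<sigma>. card X) = n"
proof -
  have "finite X" if "X \<in> cycles_of n \<sigma>" for X
    using cycles_of_partition(1)[OF assms] that by (metis Sup_upper finite_atLeastLessThan finite_subset)
  then have "card (\<Union> (cycles_of n \<sigma>)) = (\<Sum>X\<in>cycles_of n \<sigma>. card X)"
    using cycles_of_partition(2)[OF assms] by (intro card_Union_disjoint) (auto simp: disjoint_def pairwise_def disjnt_def)
  then show ?thesis by (simp add: cycles_of_partition(1)[OF assms])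
qed

lemma singleton_cycles_of:
  assumes "\<sigma> permutes {0..<n}"
  shows "{X \<in> cycles_of n \<sigma>. card X = 1} = (\<lambda>x. {x}) ` {x. x < n \<and> \<sigma> x = x}"
proof -
  have perm: "permutation \<sigma>" using assms by (auto simp: permutation_permutes)
  show ?thesis
    unfolding cycles_of_eq_orbits[OF assms]
  proof (intro equalityI subsetI)
    fix X assume "X \<in> {X \<in> orbit \<sigma> ` {0..<n}. card X = 1}"
    then obtain x where x: "x < n" "X = orbit \<sigma> x" "card X = 1" by auto
    then have "X = {x}"
      using permutation_self_in_orbit[OF perm, of x] by (metis card_1_singletonE singletonD)
    then show "X \<in> (\<lambda>x. {x}) ` {x. x < n \<and> \<sigma> x = x}" using x orbit_eq_singleton_iff[of \<sigma> x] by auto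
  next
    fix X assume "X \<in> (\<lambda>x. {x}) ` {x. x < n \<and> \<sigma> x = x}"
    then obtain x where x: "x < n" "\<sigma> x = x" "X = {x}" by auto
    then have "X = orbit \<sigma> x" using orbit_eq_singleton_iff[of \<sigma> x] by simp
    moreover have "card X = 1" using x by simp
    ultimately show "X \<in> {X \<in> orbit \<sigma> ` {0..<n}. card X = 1}" using x(1) by auto
  qed
qed

text \<open>Conjugation by g carries each cycle to its image under g, and the coefficient depends
  only on the cardinalities of the cycles.\<close>

lemma irr_char_conj:
  assumes g: "g permutes {0..<n}" and \<sigma>: "\<sigma> permutes {0..<n}"
  shows "irr_char \<nu> n (g \<circ> \<sigma> \<circ> inv_into UNIV g) = irr_char \<nu> n \<sigma>"
proof -
  let ?h = "inv_into UNIV g"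
  let ?\<tau> = "g \<circ> \<sigma> \<circ> ?h"
  have inv: "?h (g x) = x" for x using permutes_inverses(2)[OF g] .
  have pow: "(?\<tau> ^^ k) (g x) = g ((\<sigma> ^^ k) x)" for k x
    by (induction k) (simp_all add: inv)
  have "cycles_of n ?\<tau> = (\<lambda>x. {(?\<tau> ^^ k) x | k. True}) ` (g ` {0..<n})"
    by (simp add: cycles_of_def permutes_image[OF g])
  also have "\<dots> = (\<lambda>x. {(?\<tau> ^^ k) (g x) | k. True}) ` {0..<n}" by (simp only: image_image)
  also have "\<dots> = (image g) ` cycles_of n \<sigma>"
    unfolding cycles_of_def image_image pow by (intro image_cong refl) auto
  finally have C: "cycles_of n ?\<tau> = (image g) ` cycles_of n \<sigma>" .
  have inj: "inj g" by (rule permutes_inj[OF g])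
  have fin: "finite (cycles_of n \<sigma>)" by (simp add: cycles_of_def)
  have "irr_char \<nu> n ?\<tau> = frob (length \<nu>) (image g ` cycles_of n \<sigma>) card
      (\<lambda>i. int (\<nu> ! (length \<nu> - 1 - i)) + int i)"
    by (subst irr_char_eq_frob) (simp_all add: C fin)
  also have "\<dots> = frob (length \<nu>) (cycles_of n \<sigma>) card (\<lambda>i. int (\<nu> ! (length \<nu> - 1 - i)) + int i)"
    by (rule frob_image) (use inj fin in \<open>auto simp: inj_on_def inj_image_eq_iff card_image inj_on_subset\<close>)
  finally show ?thesis by (simp add: irr_char_eq_frob fin)
qed

lemma num_syt_eq_frob:
  assumes "is_partition n \<nu>"
  shows "int (num_syt \<nu>) = frob (length \<nu>) {0..<n} (\<lambda>_. 1)
    (\<lambda>i. int (\<nu> ! (length \<nu> - 1 - i)) + int i)"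
proof -
  have sum: "(\<Sum>i<length \<nu>. \<nu> ! i) = n"
    using assms by (simp add: is_partition_def sum_list_sum_nth lessThan_atLeast0)
  have cells: "cells \<nu> = (SIGMA i:{..<length \<nu>}. {..<\<nu> ! i})" by (auto simp: cells_def)
  have "num_syt \<nu> = card (tableaux (cells \<nu>))"
    using sum assms by (simp add: num_syt_def tableaux_def cells card_SigmaI is_partition_def)
  also have "int \<dots> = frob (length \<nu>) {0..<n} (\<lambda>_. 1)
      (\<lambda>i. int (\<nu> ! (length \<nu> - 1 - i)) + int i)"
    unfolding cells
    by (rule card_tableaux_eq_frob) (use assms sum in \<open>auto simp: is_partition_def sorted_wrt_iff_nth_less\<close>)
  finally show ?thesis .
qed

text \<open>All cycles of the identity are singletons, so the character value and the number of
  tableaux are the same coefficient of a power of p_1.\<close>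

lemma irr_char_id:
  assumes "is_partition n \<nu>"
  shows "irr_char \<nu> n id = int (num_syt \<nu>)"
proof -
  have C: "cycles_of n id = (\<lambda>x. {x}) ` {0..<n}" by (auto simp: cycles_of_def image_iff)
  show ?thesis
    unfolding num_syt_eq_frob[OF assms]
    by (subst irr_char_eq_frob) (auto simp: C intro!: frob_image)
qed

section \<open>Degree and character ratios of a fixed partition\<close>

context
  fixes n :: nat and \<nu> :: "nat list"
  assumes part: "is_partition n \<nu>"
begin

private abbreviation (input) "l \<equiv> length \<nu>"
private abbreviation (input) "\<beta> \<equiv> \<lambda>i. \<nu> ! (l - 1 - i) + i"

private lemma \<beta>_less: "i < j \<Longrightarrow> j < l \<Longrightarrow> \<beta> i < \<beta> j"
  using part by (auto simp: is_partition_def sorted_wrt_iff_nth_less intro!: add_le_less_mono)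

private lemma \<beta>_sum: "(\<Sum>i<l. \<beta> i) = n + (\<Sum>i<l. i)"
proof -
  have "(\<Sum>i<l. \<nu> ! (l - 1 - i)) = (\<Sum>i<l. \<nu> ! i)"
    by (rule sum.reindex_bij_witness[of _ "\<lambda>i. l - 1 - i" "\<lambda>i. l - 1 - i"]) auto
  also have "\<dots> = n" using part by (simp add: is_partition_def sum_list_sum_nth lessThan_atLeast0)
  finally show ?thesis by (simp add: sum.distrib)
qed

private lemma num_syt_vander:
  "real (num_syt \<nu>) = fact n * (vander l (\<lambda>i. real (\<beta> i)) / (\<Prod>i<l. fact (\<beta> i)))"
proof -
  have "real (num_syt \<nu>) = real_of_int (int (num_syt \<nu>))" by simp
  also have "\<dots> = fact n * (vander l (\<lambda>i. real (\<beta> i)) / (\<Prod>i<l. fact (\<beta> i)))"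
    unfolding num_syt_eq_frob[OF part]
    using frob_units[of "{0..<n}" "\<lambda>_. 1" \<beta> l] \<beta>_sum by simp
  finally show ?thesis .
qed

lemma num_syt_pos: "num_syt \<nu> > 0"
proof -
  have "vander l (\<lambda>i. real (\<beta> i)) > 0" by (rule vander_pos) (simp only: of_nat_less_iff \<beta>_less)
  then have "real (num_syt \<nu>) > 0"
    unfolding num_syt_vander by (intro mult_pos_pos divide_pos_pos prod_pos) auto
  then show ?thesis by simp
qed

text \<open>Fixed points are the unit parts and the remaining cycles carry the support of size A.
  The largest beta-number is the first row plus the number of rows minus 1, so L dominates all of
  them.\<close>

lemma irr_char_bound:
  assumes \<sigma>: "\<sigma> permutes {0..<n}" and A: "A = card {x. x < n \<and> \<sigma> x \<noteq> x}" "A \<ge> 1"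
    and L: "first_row \<nu> + length \<nu> \<le> L"
  shows "\<bar>real_of_int (irr_char \<nu> n \<sigma>)\<bar> \<le>
    real (num_syt \<nu>) * (4 * exp 2 * (real L)\<^sup>2 / (real n * sqrt (sqrt (2 * real A)))) ^ A"
proof -
  define C where "C = cycles_of n \<sigma>"
  define C0 where "C0 = {X \<in> C. card X = 1}"
  define C1 where "C1 = {X \<in> C. card X \<noteq> 1}"
  have fin: "finite C" by (simp add: C_def cycles_of_def)
  have C: "C0 \<union> C1 = C" "C0 \<inter> C1 = {}" by (auto simp: C0_def C1_def)
  have "card C0 = card {x. x < n \<and> \<sigma> x = x}"
    unfolding C0_def C_def singleton_cycles_of[OF \<sigma>] by (rule card_image) simp
  moreover have "card {x. x < n \<and> \<sigma> x = x} + A = card ({x. x < n \<and> \<sigma> x = x} \<union> {x. x < n \<and> \<sigma> x \<noteq> x})"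
    unfolding A by (rule card_Un_disjoint[symmetric]) auto
  moreover have "{x. x < n \<and> \<sigma> x = x} \<union> {x. x < n \<and> \<sigma> x \<noteq> x} = {0..<n}" by auto
  ultimately have c0: "card C0 + A = n" by simp
  have "(\<Sum>X\<in>C0. card X) + (\<Sum>X\<in>C1. card X) = n"
    using sum_card_cycles_of[OF \<sigma>] C fin
    by (subst sum.union_disjoint[symmetric]) (auto simp: C_def[symmetric] C0_def C1_def)
  then have A1: "A = (\<Sum>X\<in>C1. card X)" using c0 by (simp add: C0_def)
  have "card X \<noteq> 0" if "X \<in> C" for X
  proof -
    have "X \<subseteq> {0..<n}" using cycles_of_partition(1)[OF \<sigma>] that by (auto simp: C_def)
    moreover have "X \<noteq> {}" using that unfolding C_def cycles_of_eq_orbits[OF \<sigma>] by (auto simp: orbit_nonempty)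
    ultimately show ?thesis by (metis card_0_eq finite_atLeastLessThan finite_subset)
  qed
  then have sz1: "card X \<ge> 2" if "X \<in> C1" for X
    using that by (fastforce simp: C1_def numeral_2_eq_2 Suc_le_eq)
  \<comment> \<open>A moved point forces n > 0; the partition is then nonempty and L
    positive.\<close>
  have "\<nu> \<noteq> []" using part A by (auto simp: is_partition_def)
  then have l: "l > 0" by simp
  have "\<beta> i \<le> L" if "i < l" for i
  proof -
    have "\<nu> ! (l - 1 - i) \<le> \<nu> ! 0"
      using part that by (cases "l - 1 - i = 0") (auto simp: is_partition_def sorted_wrt_iff_nth_less)
    also have "\<nu> ! 0 = first_row \<nu>" using \<open>\<nu> \<noteq> []\<close> by (cases \<nu>) (auto simp: first_row_def)
    finally show ?thesis using L that by simp
  qed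
  then have "\<bar>real_of_int (frob l (C0 \<union> C1) card (\<lambda>i. int (\<beta> i)))\<bar> \<le>
    fact n * (vander l (\<lambda>i. real (\<beta> i)) / (\<Prod>i<l. fact (\<beta> i))) *
    (4 * exp 2 * (real L)\<^sup>2 / (real n * sqrt (sqrt (2 * real A)))) ^ A"
    using fin C A A1 sz1 \<beta>_less \<beta>_sum l L c0
    by (intro frob_ratio_bound) (auto simp: C0_def C1_def)
  then show ?thesis
    unfolding num_syt_vander[symmetric] using fin by (simp add: irr_char_eq_frob C C_def[symmetric])
qed

end

section \<open>The centralizer\<close>

lemma block_start_Suc: "i < length \<mu> \<Longrightarrow> block_start \<mu> (Suc i) = block_start \<mu> i + \<mu> ! i"
  by (simp add: block_start_def take_Suc_conv_app_nth)

lemma block_start_mono: "i \<le> j \<Longrightarrow> block_start \<mu> i \<le> block_start \<mu> j"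
proof -
  assume "i \<le> j"
  then have "take j \<mu> = take i \<mu> @ take (j - i) (drop i \<mu>)" by (metis le_add_diff_inverse take_add)
  then show ?thesis by (simp add: block_start_def)
qed

definition block :: "nat list \<Rightarrow> nat \<Rightarrow> nat set" where
  "block \<mu> i = {block_start \<mu> i..<block_start \<mu> i + \<mu> ! i}"

lemma block_unique:
  assumes "x \<in> block \<mu> i" "x \<in> block \<mu> j" "i < length \<mu>" "j < length \<mu>"
  shows "i = j"
proof (rule ccontr)
  assume "i \<noteq> j"
  then consider "Suc i \<le> j" | "Suc j \<le> i" by linarith
  then show False
  proof cases
    case 1
    then show False
      using block_start_mono[OF 1, of \<mu>] assms by (simp add: block_def block_start_Suc)
  next
    case 2
    then show False
      using block_start_mono[OF 2, of \<mu>] assms by (simp add: block_def block_start_Suc)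
  qed
qed

lemma ex_block:
  assumes "x < sum_list \<mu>"
  shows "\<exists>i<length \<mu>. x \<in> block \<mu> i"
proof -
  have "k \<le> length \<mu> \<Longrightarrow> x < block_start \<mu> k \<Longrightarrow> \<exists>i<k. x \<in> block \<mu> i" for k
  proof (induction k)
    case 0
    then show ?case by (simp add: block_start_def)
  next
    case (Suc k)
    show ?case
    proof (cases "x < block_start \<mu> k")
      case True
      then show ?thesis using Suc by (auto intro: less_SucI)
    next
      case False
      then show ?thesis using Suc by (auto simp: block_def block_start_Suc)
    qed
  qed
  from this[of "length \<mu>"] show ?thesis using assms by (simp add: block_start_def)
qed

lemma block_less: "i < length \<mu> \<Longrightarrow> x \<in> block \<mu> i \<Longrightarrow> x < sum_list \<mu>"
  using block_start_mono[of "Suc i" "length \<mu>" \<mu>]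
  by (simp add: block_def block_start_Suc) (simp add: block_start_def)

lemma cycle_of_list_upt:
  assumes "j < m"
  shows "cycle_of_list [s..<s + m] (s + j) = s + Suc j mod m"
proof -
  have "map (cycle_of_list [s..<s + m]) [s..<s + m] ! j = rotate1 [s..<s + m] ! j"
    using cyclic_rotation[of "[s..<s + m]" 1] by simp
  then show ?thesis using assms by (simp add: nth_rotate1)
qed

text \<open>The cycles have disjoint supports, so only the one belonging to the block of x acts on
  x. An arbitrary distinct list of block indices replaces the full range to make the induction go
  through.\<close>

lemma foldr_cycles:
  assumes "distinct is" "set is \<subseteq> {..<length \<mu>}" "i < length \<mu>" "x \<in> block \<mu> i"
  shows "foldr (\<lambda>i p. cycle_of_list [block_start \<mu> i..<block_start \<mu> (Suc i)] \<circ> p) is id x =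
    (if i \<in> set is then cycle_of_list [block_start \<mu> i..<block_start \<mu> (Suc i)] x else x)"
  using assms(1,2)
proof (induction "is")
  case (Cons k "is")
  let ?c = "\<lambda>i. cycle_of_list [block_start \<mu> i..<block_start \<mu> (Suc i)]"
  have set: "set [block_start \<mu> i..<block_start \<mu> (Suc i)] = block \<mu> i" if "i < length \<mu>" for i
    using that by (simp add: block_def block_start_Suc)
  have inv: "?c i x \<in> block \<mu> i"
    using permutes_in_image[OF cycle_permutes, of "[block_start \<mu> i..<block_start \<mu> (Suc i)]" x]
    unfolding set[OF assms(3)] using assms(4) by blast
  have outside: "?c k y = y" if "y \<in> block \<mu> i" "k \<noteq> i" for y
  proof (rule id_outside_supp)
    have k: "k < length \<mu>" using Cons.prems by simp
    show "y \<notin> set [block_start \<mu> k..<block_start \<mu> (Suc k)]"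
      unfolding set[OF k] using block_unique[OF that(1) _ assms(3) k] that(2) by blast
  qed
  show ?case using Cons inv outside assms(4) by auto
qed simp

lemma std_perm_block:
  assumes "i < length \<mu>" "j < \<mu> ! i"
  shows "std_perm \<mu> (block_start \<mu> i + j) = block_start \<mu> i + Suc j mod \<mu> ! i"
  unfolding std_perm_def using assms
  by (subst foldr_cycles[of _ \<mu> i]) (auto simp: block_def block_start_Suc cycle_of_list_upt)

lemma std_perm_permutes: "std_perm \<mu> permutes {0..<sum_list \<mu>}"
proof -
  have "foldr (\<lambda>i p. cycle_of_list [block_start \<mu> i..<block_start \<mu> (Suc i)] \<circ> p) is id
      permutes {0..<sum_list \<mu>}" if "set is \<subseteq> {..<length \<mu>}" for "is"
    using that
  proof (induction "is")
    case (Cons k "is")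
    have "set [block_start \<mu> k..<block_start \<mu> (Suc k)] = block \<mu> k"
      using Cons.prems by (simp add: block_def block_start_Suc)
    also have "\<dots> \<subseteq> {0..<sum_list \<mu>}" using Cons.prems block_less[of k \<mu>] by auto
    finally have "cycle_of_list [block_start \<mu> k..<block_start \<mu> (Suc k)] permutes {0..<sum_list \<mu>}"
      by (rule permutes_subset[OF cycle_permutes])
    moreover have "set is \<subseteq> {..<length \<mu>}" using Cons.prems by simp
    ultimately have "cycle_of_list [block_start \<mu> k..<block_start \<mu> (Suc k)] \<circ>
        foldr (\<lambda>i p. cycle_of_list [block_start \<mu> i..<block_start \<mu> (Suc i)] \<circ> p) is id
        permutes {0..<sum_list \<mu>}" by (intro permutes_compose Cons.IH)
    moreover have "foldr (\<lambda>i p. cycle_of_list [block_start \<mu> i..<block_start \<mu> (Suc i)] \<circ> p) (k # is) id =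
        cycle_of_list [block_start \<mu> k..<block_start \<mu> (Suc k)] \<circ>
        foldr (\<lambda>i p. cycle_of_list [block_start \<mu> i..<block_start \<mu> (Suc i)] \<circ> p) is id" by simp
    ultimately show ?case by (simp only:)
  qed (simp add: permutes_id)
  then show ?thesis unfolding std_perm_def by force
qed

lemma funpow_std_perm_block:
  assumes "i < length \<mu>" "j < \<mu> ! i"
  shows "(std_perm \<mu> ^^ k) (block_start \<mu> i + j) = block_start \<mu> i + (j + k) mod \<mu> ! i"
proof (induction k)
  case (Suc k)
  have "(j + k) mod \<mu> ! i < \<mu> ! i" using assms by simp
  then show ?case by (simp add: Suc std_perm_block[OF assms(1)] mod_Suc_eq)
qed (use assms in simp)

lemma block_funpow:
  assumes "i < length \<mu>" "x \<in> block \<mu> i"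
  shows "(std_perm \<mu> ^^ k) x \<in> block \<mu> i"
proof -
  obtain j where "x = block_start \<mu> i + j" "j < \<mu> ! i"
    using assms by (auto simp: block_def dest: le_Suc_ex)
  then show ?thesis using funpow_std_perm_block[OF assms(1), of j k] by (simp add: block_def)
qed

lemma inj_funpow_std_perm: "inj (std_perm \<mu> ^^ k)"
  using permutes_inj[OF permutes_funpow[OF std_perm_permutes]] .

section \<open>The centralizer as a product of cyclic groups\<close>

context
  fixes \<mu> :: "nat list"
  assumes distinct: "distinct \<mu>" and pos: "\<And>x. x \<in> set \<mu> \<Longrightarrow> 0 < x"
begin

private abbreviation (input) "n \<equiv> sum_list \<mu>"
private abbreviation (input) "\<pi> \<equiv> std_perm \<mu>"

private lemma part_pos: "i < length \<mu> \<Longrightarrow> 0 < \<mu> ! i"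
  using pos by simp

private lemma centralizer_funpow:
  assumes "h \<in> centralizer \<mu>"
  shows "h ((\<pi> ^^ k) x) = (\<pi> ^^ k) (h x)"
proof (induction k)
  case (Suc k)
  have "h (\<pi> y) = \<pi> (h y)" for y using assms by (simp add: centralizer_def fun_eq_iff)
  then show ?case by (simp add: Suc)
qed simp

private lemma centralizer_permutes: "h \<in> centralizer \<mu> \<Longrightarrow> h permutes {0..<n}"
  by (simp add: centralizer_def Sym_def)

text \<open>A commuting permutation preserves orbit lengths, and these are pairwise distinct.\<close>

lemma centralizer_block_start:
  assumes h: "h \<in> centralizer \<mu>" and i: "i < length \<mu>"
  shows "h (block_start \<mu> i) \<in> block \<mu> i"
proof -
  let ?s = "block_start \<mu> i"
  have m: "0 < \<mu> ! i" by (rule part_pos[OF i])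
  have "?s < n" using i m by (intro block_less[OF i]) (simp add: block_def)
  then have "h ?s < n" using permutes_less[OF centralizer_permutes[OF h]] by simp
  then obtain k where k: "k < length \<mu>" "h ?s \<in> block \<mu> k" using ex_block by blast
  then obtain j where j: "h ?s = block_start \<mu> k + j" "j < \<mu> ! k" by (auto simp: block_def dest: le_Suc_ex)
  \<comment> \<open>The power fixes the block start and hence its image under h, so the length of
    the cycle containing the image divides \<open>\<mu> ! i\<close>. Injectivity of h gives the
    reverse divisibility below.\<close>
  have "(\<pi> ^^ (\<mu> ! i)) (h ?s) = h ?s"
    using centralizer_funpow[OF h, of "\<mu> ! i" ?s] funpow_std_perm_block[OF i m, of "\<mu> ! i"] by simp
  then have "(j + \<mu> ! i) mod \<mu> ! k = j mod \<mu> ! k"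
    unfolding j(1) funpow_std_perm_block[OF k(1) j(2)] using j(2) by simp
  then have "\<mu> ! k dvd \<mu> ! i" using mod_eq_dvd_iff_nat[of j "j + \<mu> ! i" "\<mu> ! k"] by simp
  moreover have "(\<pi> ^^ (\<mu> ! k)) (h ?s) = h ?s"
    unfolding j(1) funpow_std_perm_block[OF k(1) j(2)] using j(2) by simp
  then have "h ((\<pi> ^^ (\<mu> ! k)) ?s) = h ?s" using centralizer_funpow[OF h] by simp
  then have "(\<pi> ^^ (\<mu> ! k)) ?s = ?s"
    using permutes_inj[OF centralizer_permutes[OF h]] by (simp add: inj_def)
  then have "\<mu> ! i dvd \<mu> ! k"
    using funpow_std_perm_block[OF i m, of "\<mu> ! k"] by (simp add: mod_eq_0_iff_dvd)
  ultimately have "\<mu> ! i = \<mu> ! k" by (rule dvd_antisym[rotated])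
  then have "i = k" using distinct i k(1) by (simp add: nth_eq_iff_index_eq)
  then show ?thesis using k by simp
qed

text \<open>Coordinates on the product of cyclic groups: the i-th entry is the power of the i-th
  cycle by which h acts. It is read off at the first point of the block, where
  \<open>lie_lin_char\<close> is evaluated too.\<close>

definition shifts :: "(nat \<Rightarrow> nat) \<Rightarrow> nat \<Rightarrow> nat" where
  "shifts h = restrict (\<lambda>i. h (block_start \<mu> i) - block_start \<mu> i) {..<length \<mu>}"

lemma shifts_less:
  assumes "h \<in> centralizer \<mu>" "i < length \<mu>"
  shows "shifts h i < \<mu> ! i"
proof -
  let ?s = "block_start \<mu> i"
  have "?s \<le> h ?s" "h ?s < ?s + \<mu> ! i" using centralizer_block_start[OF assms] by (auto simp: block_def)
  then have "h ?s - ?s < \<mu> ! i" by linarith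
  then show ?thesis using assms(2) by (simp add: shifts_def)
qed

text \<open>Each point of a block is a power of the standard permutation applied to the block start,
  and h commutes with that power; hence one value determines h on the whole block.\<close>

lemma centralizer_apply:
  assumes h: "h \<in> centralizer \<mu>" and i: "i < length \<mu>" and x: "x \<in> block \<mu> i"
  shows "h x = (\<pi> ^^ shifts h i) x"
proof -
  let ?s = "block_start \<mu> i"
  have m: "0 < \<mu> ! i" by (rule part_pos[OF i])
  have hs: "?s \<le> h ?s" "h ?s < ?s + \<mu> ! i" using centralizer_block_start[OF h i] by (auto simp: block_def)
  obtain j where j: "x = ?s + j" "j < \<mu> ! i" using x by (auto simp: block_def dest: le_Suc_ex)
  have "x = (\<pi> ^^ j) ?s" using funpow_std_perm_block[OF i m, of j] j by simp
  then have "h x = (\<pi> ^^ j) (h ?s)" by (simp add: centralizer_funpow[OF h])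
  also have "h ?s = (\<pi> ^^ shifts h i) ?s"
    using funpow_std_perm_block[OF i m, of "shifts h i"] hs i by (simp add: shifts_def)
  also have "(\<pi> ^^ j) ((\<pi> ^^ shifts h i) ?s) = (\<pi> ^^ shifts h i) ((\<pi> ^^ j) ?s)"
    by (metis comp_apply funpow_add add.commute)
  finally show ?thesis using \<open>x = (\<pi> ^^ j) ?s\<close> by simp
qed

lemma bij_betw_shifts:
  "bij_betw shifts (centralizer \<mu>) (PiE {..<length \<mu>} (\<lambda>i. {..<\<mu> ! i}))"
proof (rule bij_betw_imageI)
  show "inj_on shifts (centralizer \<mu>)"
  proof (rule inj_onI, rule ext)
    fix h h' x assume h: "h \<in> centralizer \<mu>" "h' \<in> centralizer \<mu>" "shifts h = shifts h'"
    show "h x = h' x"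
    proof (cases "x < n")
      case True
      then obtain i where i: "i < length \<mu>" "x \<in> block \<mu> i" using ex_block by blast
      show ?thesis using centralizer_apply[OF h(1) i] centralizer_apply[OF h(2) i] h(3) by simp
    next
      case False
      then show ?thesis using centralizer_permutes[OF h(1)] centralizer_permutes[OF h(2)] by (simp add: permutes_def)
    qed
  qed
  show "shifts ` centralizer \<mu> = PiE {..<length \<mu>} (\<lambda>i. {..<\<mu> ! i})"
  proof (intro equalityI subsetI)
    fix K assume "K \<in> shifts ` centralizer \<mu>"
    then obtain h where h: "h \<in> centralizer \<mu>" "K = shifts h" by auto
    show "K \<in> PiE {..<length \<mu>} (\<lambda>i. {..<\<mu> ! i})"
    proof (rule PiE_I)
      show "K i \<in> {..<\<mu> ! i}" if "i \<in> {..<length \<mu>}" for i using shifts_less[OF h(1)] that h(2) by simp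
      show "K i = undefined" if "i \<notin> {..<length \<mu>}" for i using that by (simp add: h(2) shifts_def)
    qed
  next
    fix K assume K: "K \<in> PiE {..<length \<mu>} (\<lambda>i. {..<\<mu> ! i})"
    \<comment> \<open>The preimage of K applies the power \<open>K i\<close> on block i; the index
      of the block of x is unique because blocks are disjoint.\<close>
    define idx where "idx x = (THE i. i < length \<mu> \<and> x \<in> block \<mu> i)" for x
    define h where "h x = (\<pi> ^^ K (idx x)) x" for x
    have idx: "idx x = i" if "i < length \<mu>" "x \<in> block \<mu> i" for x i
      unfolding idx_def using that block_unique by blast
    have h_block: "h x \<in> block \<mu> i" if "i < length \<mu>" "x \<in> block \<mu> i" for x i
      using block_funpow[OF that] by (simp add: h_def)
    have out: "(\<pi> ^^ k) x = x" if "\<not> x < n" for x k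
      using permutes_funpow[OF std_perm_permutes[of \<mu>], of k] that by (simp add: permutes_def)
    have "inj_on h {0..<n}"
    proof (rule inj_onI)
      fix x y assume xy: "x \<in> {0..<n}" "y \<in> {0..<n}" "h x = h y"
      obtain i where i: "i < length \<mu>" "x \<in> block \<mu> i" using ex_block[of x \<mu>] xy by auto
      obtain j where j: "j < length \<mu>" "y \<in> block \<mu> j" using ex_block[of y \<mu>] xy by auto
      have "i = j" using block_unique[of "h x" \<mu> i j] h_block[OF i] h_block[OF j] xy i j by simp
      then have "(\<pi> ^^ K i) x = (\<pi> ^^ K i) y" using xy(3) idx[OF i] idx[OF j] by (simp add: h_def)
      then show "x = y" using inj_funpow_std_perm by (simp add: inj_def)
    qed
    moreover have "h ` {0..<n} \<subseteq> {0..<n}"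
    proof clarify
      fix x assume "x \<in> {0..<n}"
      then obtain i where i: "i < length \<mu>" "x \<in> block \<mu> i" using ex_block[of x \<mu>] by auto
      then show "h x \<in> {0..<n}" using block_less[OF i(1) h_block[OF i]] by simp
    qed
    ultimately have "bij_betw h {0..<n} {0..<n}" by (simp add: bij_betw_def endo_inj_surj)
    then have "h permutes {0..<n}" by (rule bij_imp_permutes) (simp add: h_def out)
    moreover have "h (\<pi> x) = \<pi> (h x)" for x
    proof (cases "x < n")
      case True
      then obtain i where i: "i < length \<mu>" "x \<in> block \<mu> i" using ex_block by blast
      then have "\<pi> x \<in> block \<mu> i" using block_funpow[of i \<mu> x 1] by simp
      then show ?thesis using idx[OF i] idx[OF i(1)] by (simp add: h_def funpow_swap1)
    next
      case False
      then show ?thesis using out[of x 1] out[of x] by (simp add: h_def)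
    qed
    ultimately have h: "h \<in> centralizer \<mu>" by (simp add: centralizer_def Sym_def fun_eq_iff)
    have "shifts h = K"
    proof
      fix i show "shifts h i = K i"
      proof (cases "i < length \<mu>")
        case True
        then have "block_start \<mu> i \<in> block \<mu> i" using part_pos by (simp add: block_def)
        then have "h (block_start \<mu> i) = (\<pi> ^^ K i) (block_start \<mu> i)" using idx True by (simp add: h_def)
        also have "\<dots> = block_start \<mu> i + K i"
          using funpow_std_perm_block[OF True part_pos[OF True], of "K i"] K True by (auto dest!: PiE_mem)
        finally show ?thesis using True by (simp add: shifts_def)
      next
        case False
        then show ?thesis using PiE_arb[OF K, of i] by (simp add: shifts_def)
      qed
    qed
    then show "K \<in> shifts ` centralizer \<mu>" using h by blast
  qed
qed

lemma card_centralizer: "card (centralizer \<mu>) = z_distinct \<mu>"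
  using bij_betw_same_card[OF bij_betw_shifts]
  by (simp add: card_PiE z_distinct_def prod.list_conv_set_nth lessThan_atLeast0)

text \<open>A nontrivial rotation of a cycle fixes no point of it, so every block is moved entirely
  or not at all. In particular a nontrivial element moves at least as many points as the smallest
  part.\<close>

lemma card_support_centralizer:
  assumes h: "h \<in> centralizer \<mu>"
  shows "card {x. x < n \<and> h x \<noteq> x} = (\<Sum>i\<in>{i. i < length \<mu> \<and> shifts h i \<noteq> 0}. \<mu> ! i)"
proof -
  have moved: "h x \<noteq> x \<longleftrightarrow> shifts h i \<noteq> 0" if i: "i < length \<mu>" and x: "x \<in> block \<mu> i" for x i
  proof -
    obtain j where j: "x = block_start \<mu> i + j" "j < \<mu> ! i" using x by (auto simp: block_def dest: le_Suc_ex)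
    have lt: "shifts h i < \<mu> ! i" by (rule shifts_less[OF h i])
    have "h x = block_start \<mu> i + (j + shifts h i) mod \<mu> ! i"
      using centralizer_apply[OF h i x] funpow_std_perm_block[OF i j(2)] j(1) by simp
    moreover have "(j + shifts h i) mod \<mu> ! i = j \<longleftrightarrow> shifts h i = 0"
    proof
      assume "(j + shifts h i) mod \<mu> ! i = j"
      then have "(j + shifts h i) mod \<mu> ! i = j mod \<mu> ! i" using j(2) by simp
      then have "\<mu> ! i dvd shifts h i" using mod_eq_dvd_iff_nat[of j "j + shifts h i" "\<mu> ! i"] by simp
      then show "shifts h i = 0" using lt by (meson nat_dvd_not_less not_gr_zero)
    qed (use j(2) in simp)
    ultimately show ?thesis by (simp add: j(1))
  qed
  have "{x. x < n \<and> h x \<noteq> x} = (\<Union>i\<in>{i. i < length \<mu> \<and> shifts h i \<noteq> 0}. block \<mu> i)"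
  proof (intro equalityI subsetI)
    fix x assume x: "x \<in> {x. x < n \<and> h x \<noteq> x}"
    then obtain i where i: "i < length \<mu>" "x \<in> block \<mu> i" using ex_block by blast
    then show "x \<in> (\<Union>i\<in>{i. i < length \<mu> \<and> shifts h i \<noteq> 0}. block \<mu> i)"
      using moved[OF i] x by blast
  next
    fix x assume "x \<in> (\<Union>i\<in>{i. i < length \<mu> \<and> shifts h i \<noteq> 0}. block \<mu> i)"
    then obtain i where i: "i < length \<mu>" "x \<in> block \<mu> i" and "shifts h i \<noteq> 0" by blast
    then show "x \<in> {x. x < n \<and> h x \<noteq> x}" using moved[OF i] block_less[OF i] by simp
  qed
  also have "card \<dots> = (\<Sum>i\<in>{i. i < length \<mu> \<and> shifts h i \<noteq> 0}. card (block \<mu> i))"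
  proof (rule card_UN_disjoint)
    show "\<forall>i\<in>{i. i < length \<mu> \<and> shifts h i \<noteq> 0}. finite (block \<mu> i)" by (simp add: block_def)
    show "\<forall>i\<in>{i. i < length \<mu> \<and> shifts h i \<noteq> 0}. \<forall>j\<in>{i. i < length \<mu> \<and> shifts h i \<noteq> 0}.
        i \<noteq> j \<longrightarrow> block \<mu> i \<inter> block \<mu> j = {}"
      using block_unique by blast
  qed simp
  finally show ?thesis by (simp add: block_def)
qed

lemma id_in_centralizer: "id \<in> centralizer \<mu>"
  by (simp add: centralizer_def Sym_def permutes_id)

end

section \<open>Higher Lie characters\<close>

text \<open>Frobenius reciprocity from the induced character formula: after exchanging the sums,
  conjugation by g permutes the group and leaves the irreducible character unchanged, so all n!
  choices of g give the same sum over the centralizer. The complex conjugate disappears because the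
  irreducible character has integer values.\<close>

lemma lie_schur_coeff_eq:
  assumes "is_partition (sum_list \<mu>) \<nu>"
  shows "lie_schur_coeff \<mu> \<nu> = 1 / of_nat (card (centralizer \<mu>)) *
    (\<Sum>h\<in>centralizer \<mu>. lie_lin_char \<mu> h * of_int (irr_char \<nu> (sum_list \<mu>) h))"
proof -
  let ?n = "sum_list \<mu>"
  let ?Z = "centralizer \<mu>"
  let ?\<chi> = "\<lambda>\<sigma>. of_int (irr_char \<nu> ?n \<sigma>) :: complex"
  let ?conj = "\<lambda>g \<sigma>. g \<circ> \<sigma> \<circ> inv_into UNIV g"
  let ?T = "\<lambda>\<tau>. if \<tau> \<in> ?Z then lie_lin_char \<mu> \<tau> * ?\<chi> \<tau> else 0"
  have finS: "finite (Sym ?n)" by (simp add: Sym_def finite_permutations)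
  have ZS: "?Z \<subseteq> Sym ?n" by (auto simp: centralizer_def)
  have conj_bij: "bij_betw (?conj g) (Sym ?n) (Sym ?n)" if g: "g permutes {0..<?n}" for g
  proof (rule bij_betw_byWitness[where f' = "\<lambda>\<sigma>. inv_into UNIV g \<circ> \<sigma> \<circ> g"])
    show "\<forall>\<sigma>\<in>Sym ?n. inv_into UNIV g \<circ> ?conj g \<sigma> \<circ> g = \<sigma>"
      using permutes_inverses[OF g] by (auto simp: fun_eq_iff)
    show "\<forall>\<sigma>\<in>Sym ?n. ?conj g (inv_into UNIV g \<circ> \<sigma> \<circ> g) = \<sigma>"
      using permutes_inverses[OF g] by (auto simp: fun_eq_iff)
  qed (use g permutes_inv[OF g] in \<open>auto simp: Sym_def intro!: permutes_compose\<close>)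
  have inner: "(\<Sum>\<sigma>\<in>Sym ?n. (if ?conj g \<sigma> \<in> ?Z then lie_lin_char \<mu> (?conj g \<sigma>) else 0) * ?\<chi> \<sigma>) =
      (\<Sum>h\<in>?Z. lie_lin_char \<mu> h * ?\<chi> h)" if "g \<in> Sym ?n" for g
  proof -
    have g: "g permutes {0..<?n}" using that by (simp add: Sym_def)
    have "(\<Sum>\<sigma>\<in>Sym ?n. (if ?conj g \<sigma> \<in> ?Z then lie_lin_char \<mu> (?conj g \<sigma>) else 0) * ?\<chi> \<sigma>) =
        (\<Sum>\<sigma>\<in>Sym ?n. ?T (?conj g \<sigma>))"
      by (intro sum.cong refl) (simp add: irr_char_conj[OF g] Sym_def)
    also have "\<dots> = (\<Sum>\<tau>\<in>Sym ?n. ?T \<tau>)" by (rule sum.reindex_bij_betw[OF conj_bij[OF g]])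
    also have "\<dots> = (\<Sum>h\<in>?Z. ?T h)" by (rule sum.mono_neutral_right[OF finS ZS]) auto
    finally show ?thesis by simp
  qed
  have cardS: "card (Sym ?n) = fact ?n"
    using card_permutations[of "{0..<?n}" ?n] by (simp add: Sym_def)
  have "(\<Sum>\<sigma>\<in>Sym ?n. higher_lie_char \<mu> \<sigma> * ?\<chi> \<sigma>) = 1 / of_nat (card ?Z) *
      (\<Sum>\<sigma>\<in>Sym ?n. \<Sum>g\<in>Sym ?n. (if ?conj g \<sigma> \<in> ?Z then lie_lin_char \<mu> (?conj g \<sigma>) else 0) * ?\<chi> \<sigma>)"
    unfolding higher_lie_char_def by (simp add: sum_distrib_left sum_distrib_right mult_ac)
  also have "\<dots> = 1 / of_nat (card ?Z) *
      (\<Sum>g\<in>Sym ?n. \<Sum>\<sigma>\<in>Sym ?n. (if ?conj g \<sigma> \<in> ?Z then lie_lin_char \<mu> (?conj g \<sigma>) else 0) * ?\<chi> \<sigma>)"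
    by (subst sum.swap) (rule refl)
  also have "\<dots> = 1 / of_nat (card ?Z) * (\<Sum>g\<in>Sym ?n. \<Sum>h\<in>?Z. lie_lin_char \<mu> h * ?\<chi> h)"
    by (intro arg_cong2[where f = "(*)"] refl sum.cong inner)
  also have "\<dots> = 1 / of_nat (card ?Z) * (of_nat (fact ?n) * (\<Sum>h\<in>?Z. lie_lin_char \<mu> h * ?\<chi> h))"
    by (simp add: cardS)
  finally have "(\<Sum>\<sigma>\<in>Sym ?n. higher_lie_char \<mu> \<sigma> * ?\<chi> \<sigma>) =
      1 / of_nat (card ?Z) * (of_nat (fact ?n) * (\<Sum>h\<in>?Z. lie_lin_char \<mu> h * ?\<chi> h))" .
  then show ?thesis unfolding lie_schur_coeff_def Let_def complex_cnj_of_int by simp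
qed

lemma norm_lie_lin_char: "cmod (lie_lin_char \<mu> h) = 1"
  by (simp add: lie_lin_char_def prod_norm[symmetric])

lemma lie_lin_char_id: "lie_lin_char \<mu> id = 1"
  by (simp add: lie_lin_char_def)

lemma cmod_rel_err_le:
  assumes \<mu>: "distinct \<mu>" "\<And>x. x \<in> set \<mu> \<Longrightarrow> 0 < x" and \<nu>: "is_partition (sum_list \<mu>) \<nu>"
  shows "cmod (rel_err \<mu> \<nu>) \<le>
    (\<Sum>h\<in>centralizer \<mu> - {id}. \<bar>real_of_int (irr_char \<nu> (sum_list \<mu>) h)\<bar> / real (num_syt \<nu>))"
proof -
  let ?n = "sum_list \<mu>"
  let ?Z = "centralizer \<mu>"
  let ?t = "\<lambda>h. lie_lin_char \<mu> h * of_int (irr_char \<nu> ?n h) / of_nat (num_syt \<nu>) :: complex"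
  have fin: "finite ?Z"
    by (rule finite_subset[of _ "{p. p permutes {0..<?n}}"])
      (auto simp: centralizer_def Sym_def finite_permutations)
  have f: "num_syt \<nu> > 0" by (rule num_syt_pos[OF \<nu>])
  have z: "card ?Z = z_distinct \<mu>" by (rule card_centralizer[OF \<mu>])
  have "card ?Z > 0" using fin id_in_centralizer[OF \<mu>] by (auto simp: card_gt_0_iff)
  then have "rel_err \<mu> \<nu> = (\<Sum>h\<in>?Z. ?t h) - 1"
    unfolding sum_divide_distrib[symmetric] rel_err_def lie_schur_coeff_eq[OF \<nu>] by (simp add: z)
  also have "(\<Sum>h\<in>?Z. ?t h) = ?t id + (\<Sum>h\<in>?Z - {id}. ?t h)"
    by (rule sum.remove[OF fin id_in_centralizer[OF \<mu>]])
  also have "?t id = 1" using f by (simp add: lie_lin_char_id irr_char_id[OF \<nu>])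
  also have "1 + (\<Sum>h\<in>?Z - {id}. ?t h) - 1 = (\<Sum>h\<in>?Z - {id}. ?t h)" by (rule add_diff_cancel_left')
  finally have "cmod (rel_err \<mu> \<nu>) = cmod (\<Sum>h\<in>?Z - {id}. ?t h)" by (rule arg_cong)
  also have "\<dots> \<le> (\<Sum>h\<in>?Z - {id}. cmod (?t h))" by (rule norm_sum)
  also have "\<dots> = (\<Sum>h\<in>?Z - {id}. \<bar>real_of_int (irr_char \<nu> ?n h)\<bar> / real (num_syt \<nu>))"
    by (intro sum.cong refl) (simp add: norm_mult norm_divide norm_lie_lin_char)
  finally show ?thesis .
qed

text \<open>A finite set of exponents gives a subsum of a geometric tail. Applied to the set of
  parts, it bounds the sum over the cycles independently of how many there are.\<close>

lemma sum_half_powers_le: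
  assumes "finite S" "\<And>m. m \<in> S \<Longrightarrow> M \<le> m"
  shows "(\<Sum>m\<in>S. (1/2::real) ^ m) \<le> 2 * (1/2) ^ M"
proof -
  obtain N where N: "S \<subseteq> {..<N}" using finite_nat_iff_bounded assms(1) by blast
  have "(\<Sum>m\<in>S. (1/2::real) ^ m) \<le> (\<Sum>m\<in>{M..<M + N}. (1/2) ^ m)"
    by (rule sum_mono2) (use N assms in fastforce)+
  also have "\<dots> = (\<Sum>k<N. (1/2) ^ (M + k))"
    by (rule sum.reindex_bij_witness[of _ "\<lambda>k. M + k" "\<lambda>m. m - M"]) auto
  also have "\<dots> = (1/2) ^ M * (\<Sum>k<N. (1/2) ^ k)" by (simp add: power_add sum_distrib_left)
  also have "(\<Sum>k<N. (1/2::real) ^ k) \<le> 2" by (subst sum_gp_strict) (auto simp: field_simps)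
  finally show ?thesis by (simp add: mult.commute)
qed

text \<open>The nontrivial elements of the centralizer are summed by expanding a product over the cycles:
  an element moving the cycles in \<open>I\<close> contributes at most \<open>\<Prod>i\<in>I. (1/4) ^ \<mu> ! i\<close>.\<close>

lemma cmod_rel_err_bound:
  assumes \<mu>: "distinct \<mu>" "\<And>x. x \<in> set \<mu> \<Longrightarrow> M \<le> x" "M \<ge> 1"
    and \<nu>: "is_partition (sum_list \<mu>) \<nu>" and L: "first_row \<nu> + length \<nu> \<le> L"
    and small: "\<And>A. A \<ge> M \<Longrightarrow> 4 * exp 2 * (real L)\<^sup>2 / (real (sum_list \<mu>) * sqrt (sqrt (2 * real A))) \<le> 1/4"
  shows "cmod (rel_err \<mu> \<nu>) \<le> 4 * (1/2) ^ M"
proof -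
  let ?n = "sum_list \<mu>"
  let ?Z = "centralizer \<mu>"
  let ?P = "PiE {..<length \<mu>} (\<lambda>i. {..<\<mu> ! i})"
  let ?w = "\<lambda>K. \<Prod>i<length \<mu>. if K i = 0 then 1 else (1/4::real) ^ \<mu> ! i"
  have pos: "\<And>x. x \<in> set \<mu> \<Longrightarrow> 0 < x" using \<mu>(2,3) by fastforce
  have M: "M \<le> \<mu> ! i" if "i < length \<mu>" for i using \<mu>(2) that by simp
  have f: "real (num_syt \<nu>) > 0" using num_syt_pos[OF \<nu>] by simp
  note bij = bij_betw_shifts[OF \<mu>(1) pos]
  have fin: "finite ?Z" using bij_betw_finite[OF bij] by (simp add: finite_PiE)
  have each: "\<bar>real_of_int (irr_char \<nu> ?n h)\<bar> / real (num_syt \<nu>) \<le> ?w (shifts \<mu> h)"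
    if h: "h \<in> ?Z" "h \<noteq> id" for h
  proof -
    let ?I = "{i. i < length \<mu> \<and> shifts \<mu> h i \<noteq> 0}"
    define A where "A = card {x. x < ?n \<and> h x \<noteq> x}"
    have A: "A = (\<Sum>i\<in>?I. \<mu> ! i)"
      unfolding A_def by (rule card_support_centralizer[OF \<mu>(1) pos h(1)])
    have "h permutes {0..<?n}" using h(1) by (simp add: centralizer_def Sym_def)
    moreover have "?I \<noteq> {}"
    proof
      assume "?I = {}"
      then have "A = 0" unfolding A by (simp only: sum.empty)
      then have "h x = x" if "x < ?n" for x using that by (auto simp: A_def)
      then have "h = id" using \<open>h permutes {0..<?n}\<close> by (auto simp: permutes_def fun_eq_iff)
      then show False using h(2) by simp
    qed
    then obtain i where i: "i \<in> ?I" by blast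
    then have "\<mu> ! i \<le> A" unfolding A by (intro member_le_sum) auto
    then have AM: "A \<ge> M" using M[of i] i by simp
    ultimately have "\<bar>real_of_int (irr_char \<nu> ?n h)\<bar> \<le>
        real (num_syt \<nu>) * (4 * exp 2 * (real L)\<^sup>2 / (real ?n * sqrt (sqrt (2 * real A)))) ^ A"
      using \<mu>(3) L by (intro irr_char_bound[OF \<nu>]) (auto simp: A_def)
    then have "\<bar>real_of_int (irr_char \<nu> ?n h)\<bar> / real (num_syt \<nu>) \<le>
        (4 * exp 2 * (real L)\<^sup>2 / (real ?n * sqrt (sqrt (2 * real A)))) ^ A"
      using f by (simp add: divide_le_eq mult.commute)
    \<comment> \<open>The base 1/4 leaves room for the rotations: a cycle of length m has fewer than
      2^m of them, so its total nontrivial weight is still at most (1/2)^m.\<close>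
    also have "\<dots> \<le> (1/4) ^ A" by (rule power_mono[OF small[OF AM]]) simp
    also have "\<dots> = (\<Prod>i\<in>?I. (1/4) ^ \<mu> ! i)" unfolding A power_sum ..
    also have "\<dots> = ?w (shifts \<mu> h)"
      by (rule prod.mono_neutral_cong_left) auto
    finally show ?thesis .
  qed
  have w_id: "?w (shifts \<mu> id) = 1"
    by (rule prod.neutral) (simp add: shifts_def[OF \<mu>(1) pos])
  have "cmod (rel_err \<mu> \<nu>) \<le> (\<Sum>h\<in>?Z - {id}. \<bar>real_of_int (irr_char \<nu> ?n h)\<bar> / real (num_syt \<nu>))"
    by (rule cmod_rel_err_le[OF \<mu>(1) pos \<nu>])
  also have "\<dots> \<le> (\<Sum>h\<in>?Z - {id}. ?w (shifts \<mu> h))" by (intro sum_mono each) auto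
  also have "\<dots> = (\<Sum>h\<in>?Z. ?w (shifts \<mu> h)) - 1"
    using sum.remove[OF fin id_in_centralizer[OF \<mu>(1) pos], of "\<lambda>h. ?w (shifts \<mu> h)"] w_id by simp
  also have "(\<Sum>h\<in>?Z. ?w (shifts \<mu> h)) = (\<Sum>K\<in>?P. ?w K)" by (rule sum.reindex_bij_betw[OF bij])
  also have "\<dots> = (\<Prod>i<length \<mu>. \<Sum>k<\<mu> ! i. if k = 0 then 1 else (1/4) ^ \<mu> ! i)"
    by (rule prod_sum_PiE[symmetric]) auto
  also have "\<dots> \<le> (\<Prod>i<length \<mu>. exp ((1/2) ^ \<mu> ! i))"
  proof (intro prod_mono conjI)
    fix i assume "i \<in> {..<length \<mu>}"
    then obtain m where m: "\<mu> ! i = Suc m" using M[of i] \<mu>(3) by (cases "\<mu> ! i") auto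
    have "(\<Sum>k<\<mu> ! i. if k = 0 then 1 else (1/4::real) ^ \<mu> ! i) = 1 + real m * (1/4) ^ Suc m"
      unfolding m by (subst sum.lessThan_Suc_shift) simp
    also have "real m * (1/4) ^ Suc m \<le> 2 ^ Suc m * (1/4) ^ Suc m"
    proof (rule mult_right_mono)
      have "real m < 2 ^ m" by (rule of_nat_less_two_power)
      also have "\<dots> \<le> 2 ^ Suc m" by simp
      finally show "real m \<le> 2 ^ Suc m" by simp
    qed simp
    also have "2 ^ Suc m * (1/4::real) ^ Suc m = (1/2) ^ Suc m"
      unfolding power_mult_distrib[symmetric] by simp
    also have "1 + (1/2) ^ Suc m \<le> exp ((1/2::real) ^ Suc m)" by (rule exp_ge_add_one_self)
    finally show "(\<Sum>k<\<mu> ! i. if k = 0 then 1 else (1/4::real) ^ \<mu> ! i) \<le> exp ((1/2) ^ \<mu> ! i)"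
      by (simp add: m)
  qed (auto intro!: sum_nonneg)
  also have "\<dots> = exp (\<Sum>i<length \<mu>. (1/2) ^ \<mu> ! i)" by (simp add: exp_sum)
  also have "(\<Sum>i<length \<mu>. (1/2::real) ^ \<mu> ! i) = (\<Sum>m\<in>set \<mu>. (1/2) ^ m)"
    by (rule sum.reindex_bij_betw) (use \<mu>(1) in \<open>simp add: bij_betw_nth\<close>)
  finally have "cmod (rel_err \<mu> \<nu>) \<le> exp (\<Sum>m\<in>set \<mu>. (1/2) ^ m) - 1" by simp
  moreover have S: "(\<Sum>m\<in>set \<mu>. (1/2::real) ^ m) \<le> 2 * (1/2) ^ M"
    by (rule sum_half_powers_le) (use \<mu>(2) in auto)
  moreover have "(1/2::real) ^ M \<le> (1/2) ^ 1" by (rule power_decreasing) (use \<mu>(3) in auto)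
  \<comment> \<open>Used with x the sum over the parts, which is at most 2 * (1/2)^M and hence at
    most 1 because M \<ge> 1; this yields the constant 4.\<close>
  moreover have "exp x \<le> 1 + 2 * x" if "0 \<le> x" "x \<le> 1" for x :: real
    using exp_bound[OF that] mult_left_le[OF that(2,1)] by (simp add: power2_eq_square)
  moreover have "(\<Sum>m\<in>set \<mu>. (1/2::real) ^ m) \<ge> 0" by (rule sum_nonneg) simp
  ultimately show ?thesis by fastforce
qed

text \<open>The smallest part M is at least f(n), so for large n every nontrivial element moves
  enough points for the ratio per moved point to be at most 1/4. The resulting error 4 * (1/2)^M is
  exponentially small in f(n) and beats every power.\<close>

theorem theorem5p1:
  fixes f g :: "nat \<Rightarrow> real" and \<mu> :: "nat \<Rightarrow> nat list" and a :: real
  assumes f_inf: "filterlim f at_top sequentially"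
    and g_O: "g \<in> O(\<lambda>n. f n / ln (real n))"
    and g_o: "g \<in> o(\<lambda>n. sqrt (real n))"
    and mu_part: "\<And>n. is_partition n (\<mu> n)"
    and mu_distinct: "\<And>n. sorted_wrt (>) (\<mu> n)"
    and mu_len: "eventually (\<lambda>n. real (length (\<mu> n)) \<le> g n) sequentially"
    and mu_last: "eventually (\<lambda>n. real (last (\<mu> n)) \<ge> f n) sequentially"
    and a_pos: "a > 0"
  shows "\<forall>q>0. \<forall>c>0. eventually (\<lambda>n. \<forall>\<nu>. is_partition n \<nu> \<and>
            real (first_row \<nu>) \<le> a * sqrt (real n) \<and> real (length \<nu>) \<le> a * sqrt (real n)
            \<longrightarrow> cmod (rel_err (\<mu> n) \<nu>) \<le> c * f n powr (- q)) sequentially"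
proof (intro allI impI)
  fix q c :: real assume q: "q > 0" and c: "c > 0"
  \<comment> \<open>For balanced \<nu> one has L \<le> 2 a sqrt(n), so the base of the ratio bound
    is at most 16 e^2 a^2 / (2A)^(1/4). It is at most 1/4 as soon as (2A)^(1/4) reaches B.\<close>
  define B where "B = 64 * exp 2 * a\<^sup>2"
  have "((\<lambda>x. 4 * 2 powr (- x) * x powr q) \<longlongrightarrow> 0) at_top" by real_asymp
  then have "\<forall>\<^sub>F x in at_top. 4 * 2 powr (- x) * x powr q < c" using c by (rule order_tendstoD)
  moreover have "\<forall>\<^sub>F x::real in at_top. x \<ge> 1" by (rule eventually_ge_at_top)
  moreover have "filterlim (\<lambda>x. sqrt (sqrt (2 * x))) at_top at_top" by real_asymp
  then have "\<forall>\<^sub>F x in at_top. sqrt (sqrt (2 * x)) \<ge> B" by (simp add: filterlim_at_top)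
  ultimately have "\<forall>\<^sub>F x in at_top. 4 * 2 powr (- x) * x powr q < c \<and> x \<ge> 1 \<and> sqrt (sqrt (2 * x)) \<ge> B"
    by eventually_elim simp
  then have "\<forall>\<^sub>F n in sequentially. 4 * 2 powr (- f n) * f n powr q < c \<and> f n \<ge> 1 \<and> sqrt (sqrt (2 * f n)) \<ge> B"
    by (rule eventually_compose_filterlim[OF _ f_inf])
  moreover note mu_last
  moreover have "\<forall>\<^sub>F n in sequentially. n \<ge> (1::nat)" by (rule eventually_ge_at_top)
  ultimately show "\<forall>\<^sub>F n in sequentially. \<forall>\<nu>. is_partition n \<nu> \<and>
            real (first_row \<nu>) \<le> a * sqrt (real n) \<and> real (length \<nu>) \<le> a * sqrt (real n)
            \<longrightarrow> cmod (rel_err (\<mu> n) \<nu>) \<le> c * f n powr (- q)"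
  proof eventually_elim
    case (elim n)
    show ?case
    proof (intro allI impI)
      fix \<nu> assume \<nu>: "is_partition n \<nu> \<and>
            real (first_row \<nu>) \<le> a * sqrt (real n) \<and> real (length \<nu>) \<le> a * sqrt (real n)"
      define M where "M = last (\<mu> n)"
      have fM: "f n \<le> real M" using elim by (simp add: M_def)
      then have M1: "M \<ge> 1" using elim by linarith
      have sum: "sum_list (\<mu> n) = n" using mu_part[of n] by (simp add: is_partition_def)
      then have ne: "\<mu> n \<noteq> []" using elim by auto
      have dist: "distinct (\<mu> n)"
        using mu_distinct[of n] by (auto simp: distinct_conv_nth sorted_wrt_iff_nth_less nat_neq_iff)
      have last: "M \<le> x" if "x \<in> set (\<mu> n)" for x
      proof -
        obtain i where i: "i < length (\<mu> n)" "\<mu> n ! i = x"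
          using \<open>x \<in> set (\<mu> n)\<close> unfolding in_set_conv_nth by blast
        show ?thesis
        proof (cases "i = length (\<mu> n) - 1")
          case True
          then show ?thesis using i ne by (simp add: M_def last_conv_nth)
        next
          case False
          then have "\<mu> n ! i > \<mu> n ! (length (\<mu> n) - 1)"
            using mu_distinct[of n] i unfolding sorted_wrt_iff_nth_less by auto
          then show ?thesis using i ne by (simp add: M_def last_conv_nth)
        qed
      qed
      let ?L = "first_row \<nu> + length \<nu>"
      have "real ?L \<le> 2 * a * sqrt (real n)" using \<nu> by simp
      then have "(real ?L)\<^sup>2 \<le> (2 * a * sqrt (real n))\<^sup>2" by (rule power_mono) simp
      also have "\<dots> = 4 * a\<^sup>2 * real n" by (simp add: power_mult_distrib)
      finally have L2: "(real ?L)\<^sup>2 \<le> 4 * a\<^sup>2 * real n" .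
      have "cmod (rel_err (\<mu> n) \<nu>) \<le> 4 * (1/2) ^ M"
      proof (rule cmod_rel_err_bound[OF dist last M1])
        fix A assume "M \<le> A"
        then have "sqrt (sqrt (2 * f n)) \<le> sqrt (sqrt (2 * real A))" using fM by simp
        then have B: "B \<le> sqrt (sqrt (2 * real A))" using elim by linarith
        have Bpos: "B > 0" using a_pos by (simp add: B_def)
        have "4 * exp 2 * (real ?L)\<^sup>2 / (real n * sqrt (sqrt (2 * real A))) \<le>
            4 * exp 2 * (4 * a\<^sup>2 * real n) / (real n * B)"
          using L2 B Bpos elim by (intro frac_le mult_left_mono mult_pos_pos) auto
        also have "\<dots> = 1/4" using elim a_pos by (simp add: B_def field_simps)
        finally show "4 * exp 2 * (real ?L)\<^sup>2 / (real (sum_list (\<mu> n)) * sqrt (sqrt (2 * real A))) \<le> 1/4"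
          by (simp only: sum)
      qed (use \<nu> sum in auto)
      also have "(1/2::real) ^ M = 2 powr (- real M)"
        by (simp add: powr_minus powr_realpow power_one_over inverse_eq_divide)
      also have "4 * 2 powr (- real M) \<le> 4 * 2 powr (- f n)" using fM by simp
      also have "\<dots> \<le> c * f n powr (- q)"
      proof -
        have "f n powr q > 0" using elim by simp
        then show ?thesis using elim by (simp add: powr_minus field_simps)
      qed
      finally show "cmod (rel_err (\<mu> n) \<nu>) \<le> c * f n powr (- q)" .
    qed
  qed
qed

end
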